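(* Let $N\ge1$ and let $J$ be the junction with $N$ branches described in the context. Assume (A0) and (A1') of the context and let $T>0$. Let $u=(u^\alpha)_\alpha:[0,T)\times J\to\mathbb R$ be the unique viscosity solution (in the sense of the context) of the Hamilton–Jacobi problem on $[0,T)\times J$ with initial data $u_0$. For $\varepsilon=(\Delta t,\Delta x)$ with $\Delta t,\Delta x>0$ satisfying the CFL condition of the context, let $(U^{\alpha,n}_i)$ be the numerical solution of the scheme of the context with initial condition $U^{\alpha,0}_i=u_0^\alpha(i\Delta x)$. Then, as $\varepsilon\to0$ (with the CFL condition satisfied), the numerical solution converges to $u$ locally uniformly: for every compact set $\mathcal K\subset[0,T)\times J$, $$\limsup_{\varepsilon\to 0}\ \sup_{(n\Delta t,i\Delta x)\in\mathcal K}\bigl|u^\alpha(n\Delta t,i\Delta x)-U^{\alpha,n}_i\bigr|=0,$$ where the supremum is over all grid points lying in $\mathcal K$, and for each such point $\alpha$ is an index for which the point belongs to $\mathcal K\cap\bigl([0,T)\times J_\alpha\bigr)$.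
   Context: Junction: $e_1,\dots,e_N\in\mathbb R^2$ are distinct unit vectors, $J_\alpha=[0,+\infty)e_\alpha$, $J_\alpha^*=J_\alpha\setminus\{0\}$, $J=\bigcup_\alpha J_\alpha$, $J_T=(0,T)\times J$. For a function $u$ of $(t,y)$, $y\in J$, write $u^\alpha(t,x)=u(t,xe_\alpha)$, $x\ge 0$; the grid point $(n\Delta t,i\Delta x)$ of branch $\alpha$ is identified with $(n\Delta t,i\Delta x\,e_\alpha)$. $C^1_*(J_T)$ is the set of $u\in C(J_T)$ with $u^\alpha\in C^1((0,T)\times[0,+\infty))$ for every $\alpha$. (A0): $u_0=(u_0^\alpha)_\alpha$ is globally Lipschitz on $J$, i.e. each $u_0^\alpha$ is Lipschitz on $[0,+\infty)$ and $u_0^\alpha(0)=u_0^\beta(0)$ for all $\alpha,\beta$. (A1'): there is $\gamma>0$ such that for each $\alpha$ there is $L_\alpha\in C^2(\mathbb R;\mathbb R)$ with $L_\alpha''\ge\gamma$ and $H_\alpha(p)=\sup_{q\in\mathbb R}(pq-L_\alpha(q))$, $H_\alpha^-(p)=\sup_{q\le0}(pq-L_\alpha(q))$, $H_\alpha^+(p)=\sup_{q\ge0}(pq-L_\alpha(q))$. (Then $H_\alpha$ is $C^1$, coercive, with a unique minimum point $p_0^\alpha$; $H_\alpha^-$ is its non-increasing part, equal to $H_\alpha$ on $(-\infty,p_0^\alpha]$ and to $H_\alpha(p_0^\alpha)$ on $[p_0^\alpha,+\infty)$, and $H_\alpha^+$ is its non-decreasing part, equal to $H_\alpha(p_0^\alpha)$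 on $(-\infty,p_0^\alpha]$ and to $H_\alpha$ on $[p_0^\alpha,+\infty)$.) Generalized inverses: $(H_\alpha^-)^{-1}(a)=\inf\{p:H_\alpha^-(p)=a\}$, $(H_\alpha^+)^{-1}(a)=\sup\{p:H_\alpha^+(p)=a\}$, $(H_\alpha^\pm)^{-1}(+\infty)=\pm\infty$. HJ problem: $u^\alpha_t+H_\alpha(u^\alpha_x)=0$ on $(0,T)\times(0,+\infty)$ for all $\alpha$; at $x=0$, $u^\beta=:u$ for all $\beta$ and $u_t+\max_\beta H_\beta^-(u^\beta_x)=0$ on $(0,T)\times\{0\}$; $u^\alpha(0,x)=u^\alpha_0(x)$. Viscosity solutions: an upper (resp. lower) semi-continuous function $u:[0,T)\times J\to\mathbb R$ is a viscosity subsolution (resp. supersolution) on $J_T$ if for any $P=(t,y)\in J_T$ and $\varphi\in C^1_*(J_T)$ such that $u\le\varphi$ (resp. $u\ge\varphi$) in a neighbourhood of $P$ with equality at $P$, one has $\varphi^\alpha_t(t,x)+H_\alpha(\varphi^\alpha_x(t,x))\le0$ (resp. $\ge0$) if $y=xe_\alpha\in J_\alpha^*$, and $\varphi_t(t,0)+\max_\alpha H_\alpha^-(\varphi_x^\alpha(t,0))\le0$ (resp. $\ge0$) if $y=0$. A function $u:[0,T)\times J\to\mathbb R$ is a viscosity solution of the problem with initial data $u_0$ if its upper semi-continuous envelope $u^*$ is a subsolution with $u^*(0,\cdot)\le u_0$ on $J$ and its lower semi-continuous envelope $u_*$ is a supersolution with $u_*(0,\cdot)\ge u_0$ on $J$.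 Known result defining $u$ (Imbert–Monneau–Zidani): under (A0) and (A1') there is a unique viscosity solution $u$ with initial data $u_0$ satisfying $|u(t,y)-u_0(y)|\le C_T$ on $J_T$ for some constant $C_T>0$, and it is Lipschitz continuous in $(t,y)$ on $J_T$; "the unique viscosity solution" means this one. Scheme (steps $\Delta t,\Delta x>0$): with $p^{\alpha,n}_{i,+}=\frac{U^{\alpha,n}_{i+1}-U^{\alpha,n}_i}{\Delta x}$, $p^{\alpha,n}_{i,-}=\frac{U^{\alpha,n}_i-U^{\alpha,n}_{i-1}}{\Delta x}$, $W^{\alpha,n}_i=\frac{U^{\alpha,n+1}_i-U^{\alpha,n}_i}{\Delta t}$, for all $n\ge0$: $W^{\alpha,n}_i+\max\{H_\alpha^+(p^{\alpha,n}_{i,-}),H_\alpha^-(p^{\alpha,n}_{i,+})\}=0$ for $i\ge1$; at $i=0$, $U^{\beta,n}_0=:U^n_0$ for all $\beta$ and $\frac{U^{n+1}_0-U^n_0}{\Delta t}+\max_\beta H_\beta^-(p^{\beta,n}_{0,+})=0$. CFL condition: $\frac{\Delta x}{\Delta t}\ge\sup_{\alpha,\ p\in[\underline p_\alpha,\overline p_\alpha]}|H_\alpha'(p)|$, where $\underline p_\alpha=(H_\alpha^-)^{-1}(-m^0)$, $\overline p_\alpha=(H_\alpha^+)^{-1}(-m^0)$, $m^0=\inf_{\beta,\,i\ge0}W^{\beta,0}_i$ (these depend on $\Delta x$ but not on $\Delta t$). *)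

theory Defs
  imports "HOL-Analysis.Analysis"
begin

text \<open>The branches are indexed by a finite type \<open>'n\<close>, so \<open>N = CARD('n) \<ge> 1\<close>; \<open>e\<close> gives their directions.
  Functions of \<open>(t, y)\<close> with \<open>y\<close> in the junction are total functions on \<open>real \<times> real^2\<close>
  of which only the values on the relevant domain are ever used.\<close>

definition junction :: "('n::finite \<Rightarrow> real^2) \<Rightarrow> (real^2) set" where
  "junction e = (\<Union>\<alpha>. {x *\<^sub>R e \<alpha> | x. 0 \<le> x})"

abbreviation JT :: "('n::finite \<Rightarrow> real^2) \<Rightarrow> real \<Rightarrow> (real \<times> (real^2)) set" where
  "JT e T \<equiv> {0<..<T} \<times> junction e"

abbreviation JT0 :: "('n::finite \<Rightarrow> real^2) \<Rightarrow> real \<Rightarrow> (real \<times> (real^2)) set" where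
  "JT0 e T \<equiv> {0..<T} \<times> junction e"

definition branch :: "('n::finite \<Rightarrow> real^2) \<Rightarrow> (real \<times> (real^2) \<Rightarrow> real) \<Rightarrow> 'n \<Rightarrow> real \<Rightarrow> real \<Rightarrow> real" where
  "branch e u \<alpha> t x = u (t, x *\<^sub>R e \<alpha>)"

definition time_deriv :: "(real \<Rightarrow> real \<Rightarrow> real) \<Rightarrow> real \<Rightarrow> real \<Rightarrow> real" where
  "time_deriv f t x = deriv (\<lambda>s. f s x) t"

text \<open>Derivative within the half-line: one-sided at \<open>x = 0\<close>, the usual one for \<open>x > 0\<close>.\<close>

definition space_deriv :: "(real \<Rightarrow> real \<Rightarrow> real) \<Rightarrow> real \<Rightarrow> real \<Rightarrow> real" where
  "space_deriv f t x = vector_derivative (\<lambda>y. f t y) (at x within {0..})"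

definition C1_halfline :: "real \<Rightarrow> (real \<Rightarrow> real \<Rightarrow> real) \<Rightarrow> bool" where
  "C1_halfline T f \<longleftrightarrow>
     (\<forall>t\<in>{0<..<T}. \<forall>x\<in>{0..}.
        (\<lambda>s. f s x) differentiable (at t) \<and>
        (\<lambda>y. f t y) differentiable (at x within {0..})) \<and>
     continuous_on ({0<..<T} \<times> {0..}) (\<lambda>(t, x). time_deriv f t x) \<and>
     continuous_on ({0<..<T} \<times> {0..}) (\<lambda>(t, x). space_deriv f t x)"

definition C1_star :: "('n::finite \<Rightarrow> real^2) \<Rightarrow> real \<Rightarrow> (real \<times> (real^2) \<Rightarrow> real) set" where
  "C1_star e T = {\<phi>. continuous_on (JT e T) \<phi> \<and> (\<forall>\<alpha>. C1_halfline T (branch e \<phi> \<alpha>))}"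

definition A0 :: "('n::finite \<Rightarrow> real^2) \<Rightarrow> (real^2 \<Rightarrow> real) \<Rightarrow> bool" where
  "A0 e u0 \<longleftrightarrow> (\<forall>\<alpha>. \<exists>K. K-lipschitz_on {0..} (\<lambda>x. u0 (x *\<^sub>R e \<alpha>)))"

text \<open>The three suprema are suprema of non-empty bounded sets, as \<open>L\<close> is uniformly convex.\<close>

definition A1' :: "('n::finite \<Rightarrow> real \<Rightarrow> real) \<Rightarrow> ('n \<Rightarrow> real \<Rightarrow> real) \<Rightarrow> ('n \<Rightarrow> real \<Rightarrow> real) \<Rightarrow> bool" where
  "A1' H Hm Hp \<longleftrightarrow> (\<exists>\<gamma>>0. \<forall>\<alpha>. \<exists>L L' L'' :: real \<Rightarrow> real.
     (\<forall>q. (L has_real_derivative L' q) (at q)) \<and>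
     (\<forall>q. (L' has_real_derivative L'' q) (at q)) \<and>
     continuous_on UNIV L'' \<and> (\<forall>q. \<gamma> \<le> L'' q) \<and>
     (\<forall>p. H \<alpha> p = (SUP q. p * q - L q)) \<and>
     (\<forall>p. Hm \<alpha> p = (SUP q\<in>{..0}. p * q - L q)) \<and>
     (\<forall>p. Hp \<alpha> p = (SUP q\<in>{0..}. p * q - L q)))"

definition usc_on :: "'a::topological_space set \<Rightarrow> ('a \<Rightarrow> real) \<Rightarrow> bool" where
  "usc_on S u \<longleftrightarrow> (\<forall>z\<in>S. \<forall>c>u z. \<forall>\<^sub>F w in at z within S. u w < c)"

definition lsc_on :: "'a::topological_space set \<Rightarrow> ('a \<Rightarrow> real) \<Rightarrow> bool" where
  "lsc_on S u \<longleftrightarrow> (\<forall>z\<in>S. \<forall>c<u z. \<forall>\<^sub>F w in at z within S. c < u w)"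

text \<open>The filter \<open>inf (nhds z) (principal S)\<close> includes the point \<open>z\<close> itself,
  unlike \<open>at z within S\<close>.\<close>

definition usc_env :: "'a::topological_space set \<Rightarrow> ('a \<Rightarrow> real) \<Rightarrow> 'a \<Rightarrow> ereal" where
  "usc_env S u z = Limsup (inf (nhds z) (principal S)) (\<lambda>w. ereal (u w))"

definition lsc_env :: "'a::topological_space set \<Rightarrow> ('a \<Rightarrow> real) \<Rightarrow> 'a \<Rightarrow> ereal" where
  "lsc_env S u z = Liminf (inf (nhds z) (principal S)) (\<lambda>w. ereal (u w))"

definition touches_from_above ::
  "('n::finite \<Rightarrow> real^2) \<Rightarrow> real \<Rightarrow> (real \<times> (real^2) \<Rightarrow> real) \<Rightarrow> (real \<times> (real^2) \<Rightarrow> real) \<Rightarrow> real \<times> (real^2) \<Rightarrow> bool" where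
  "touches_from_above e T \<phi> u P \<longleftrightarrow> u P = \<phi> P \<and> (\<forall>\<^sub>F Q in at P within JT e T. u Q \<le> \<phi> Q)"

definition touches_from_below ::
  "('n::finite \<Rightarrow> real^2) \<Rightarrow> real \<Rightarrow> (real \<times> (real^2) \<Rightarrow> real) \<Rightarrow> (real \<times> (real^2) \<Rightarrow> real) \<Rightarrow> real \<times> (real^2) \<Rightarrow> bool" where
  "touches_from_below e T \<phi> u P \<longleftrightarrow> u P = \<phi> P \<and> (\<forall>\<^sub>F Q in at P within JT e T. u Q \<ge> \<phi> Q)"

definition interior_operator ::
  "('n::finite \<Rightarrow> real^2) \<Rightarrow> ('n \<Rightarrow> real \<Rightarrow> real) \<Rightarrow> (real \<times> (real^2) \<Rightarrow> real) \<Rightarrow> 'n \<Rightarrow> real \<Rightarrow> real \<Rightarrow> real" where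
  "interior_operator e H \<phi> \<alpha> t x =
     time_deriv (branch e \<phi> \<alpha>) t x + H \<alpha> (space_deriv (branch e \<phi> \<alpha>) t x)"

definition junction_operator ::
  "('n::finite \<Rightarrow> real^2) \<Rightarrow> ('n \<Rightarrow> real \<Rightarrow> real) \<Rightarrow> (real \<times> (real^2) \<Rightarrow> real) \<Rightarrow> real \<Rightarrow> real" where
  "junction_operator e Hm \<phi> t =
     deriv (\<lambda>s. \<phi> (s, 0)) t + (MAX \<alpha>. Hm \<alpha> (space_deriv (branch e \<phi> \<alpha>) t 0))"

definition viscosity_subsolution ::
  "('n::finite \<Rightarrow> real^2) \<Rightarrow> real \<Rightarrow> ('n \<Rightarrow> real \<Rightarrow> real) \<Rightarrow> ('n \<Rightarrow> real \<Rightarrow> real) \<Rightarrow> (real \<times> (real^2) \<Rightarrow> real) \<Rightarrow> bool" where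
  "viscosity_subsolution e T H Hm u \<longleftrightarrow> usc_on (JT0 e T) u \<and>
     (\<forall>\<phi>\<in>C1_star e T. \<forall>t\<in>{0<..<T}.
        (\<forall>\<alpha>. \<forall>x>0. touches_from_above e T \<phi> u (t, x *\<^sub>R e \<alpha>) \<longrightarrow> interior_operator e H \<phi> \<alpha> t x \<le> 0) \<and>
        (touches_from_above e T \<phi> u (t, 0) \<longrightarrow> junction_operator e Hm \<phi> t \<le> 0))"

definition viscosity_supersolution ::
  "('n::finite \<Rightarrow> real^2) \<Rightarrow> real \<Rightarrow> ('n \<Rightarrow> real \<Rightarrow> real) \<Rightarrow> ('n \<Rightarrow> real \<Rightarrow> real) \<Rightarrow> (real \<times> (real^2) \<Rightarrow> real) \<Rightarrow> bool" where
  "viscosity_supersolution e T H Hm u \<longleftrightarrow> lsc_on (JT0 e T) u \<and>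
     (\<forall>\<phi>\<in>C1_star e T. \<forall>t\<in>{0<..<T}.
        (\<forall>\<alpha>. \<forall>x>0. touches_from_below e T \<phi> u (t, x *\<^sub>R e \<alpha>) \<longrightarrow> interior_operator e H \<phi> \<alpha> t x \<ge> 0) \<and>
        (touches_from_below e T \<phi> u (t, 0) \<longrightarrow> junction_operator e Hm \<phi> t \<ge> 0))"

text \<open>Sub- and supersolutions are real-valued, so both envelopes are required to be finite.\<close>

definition viscosity_solution ::
  "('n::finite \<Rightarrow> real^2) \<Rightarrow> real \<Rightarrow> ('n \<Rightarrow> real \<Rightarrow> real) \<Rightarrow> ('n \<Rightarrow> real \<Rightarrow> real) \<Rightarrow> (real^2 \<Rightarrow> real)
    \<Rightarrow> (real \<times> (real^2) \<Rightarrow> real) \<Rightarrow> bool" where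
  "viscosity_solution e T H Hm u0 u \<longleftrightarrow>
     (\<forall>z\<in>JT0 e T. \<bar>usc_env (JT0 e T) u z\<bar> \<noteq> \<infinity> \<and> \<bar>lsc_env (JT0 e T) u z\<bar> \<noteq> \<infinity>) \<and>
     viscosity_subsolution e T H Hm (\<lambda>z. real_of_ereal (usc_env (JT0 e T) u z)) \<and>
     viscosity_supersolution e T H Hm (\<lambda>z. real_of_ereal (lsc_env (JT0 e T) u z)) \<and>
     (\<forall>y\<in>junction e. usc_env (JT0 e T) u (0, y) \<le> ereal (u0 y)) \<and>
     (\<forall>y\<in>junction e. lsc_env (JT0 e T) u (0, y) \<ge> ereal (u0 y))"

definition bounded_distance_to_initial ::
  "('n::finite \<Rightarrow> real^2) \<Rightarrow> real \<Rightarrow> (real^2 \<Rightarrow> real) \<Rightarrow> (real \<times> (real^2) \<Rightarrow> real) \<Rightarrow> bool" where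
  "bounded_distance_to_initial e T u0 u \<longleftrightarrow> (\<exists>C>0. \<forall>(t, y)\<in>JT e T. \<bar>u (t, y) - u0 y\<bar> \<le> C)"

text \<open>Grid functions are written \<open>U \<alpha> n i\<close>, with \<open>n\<close> the time index and \<open>i\<close> the space index.
  The backward slope is only meant for \<open>i \<ge> 1\<close>.\<close>

definition slope_fwd :: "real \<Rightarrow> ('n \<Rightarrow> nat \<Rightarrow> nat \<Rightarrow> real) \<Rightarrow> 'n \<Rightarrow> nat \<Rightarrow> nat \<Rightarrow> real" where
  "slope_fwd dx U \<alpha> n i = (U \<alpha> n (i + 1) - U \<alpha> n i) / dx"

definition slope_bwd :: "real \<Rightarrow> ('n \<Rightarrow> nat \<Rightarrow> nat \<Rightarrow> real) \<Rightarrow> 'n \<Rightarrow> nat \<Rightarrow> nat \<Rightarrow> real" where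
  "slope_bwd dx U \<alpha> n i = (U \<alpha> n i - U \<alpha> n (i - 1)) / dx"

definition time_slope :: "real \<Rightarrow> ('n \<Rightarrow> nat \<Rightarrow> nat \<Rightarrow> real) \<Rightarrow> 'n \<Rightarrow> nat \<Rightarrow> nat \<Rightarrow> real" where
  "time_slope dt U \<alpha> n i = (U \<alpha> (n + 1) i - U \<alpha> n i) / dt"

definition numerical_solution ::
  "('n::finite \<Rightarrow> real^2) \<Rightarrow> ('n \<Rightarrow> real \<Rightarrow> real) \<Rightarrow> ('n \<Rightarrow> real \<Rightarrow> real) \<Rightarrow> (real^2 \<Rightarrow> real)
    \<Rightarrow> real \<Rightarrow> real \<Rightarrow> ('n \<Rightarrow> nat \<Rightarrow> nat \<Rightarrow> real) \<Rightarrow> bool" where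
  "numerical_solution e Hm Hp u0 dt dx U \<longleftrightarrow>
     (\<forall>\<alpha> i. U \<alpha> 0 i = u0 ((real i * dx) *\<^sub>R e \<alpha>)) \<and>
     (\<forall>\<alpha> n. \<forall>i\<ge>1. time_slope dt U \<alpha> n i
        + max (Hp \<alpha> (slope_bwd dx U \<alpha> n i)) (Hm \<alpha> (slope_fwd dx U \<alpha> n i)) = 0) \<and>
     (\<forall>\<alpha> \<beta> n. U \<alpha> n 0 = U \<beta> n 0) \<and>
     (\<forall>\<alpha> n. time_slope dt U \<alpha> n 0 + (MAX \<beta>. Hm \<beta> (slope_fwd dx U \<beta> n 0)) = 0)"

definition m0 :: "real \<Rightarrow> ('n \<Rightarrow> nat \<Rightarrow> nat \<Rightarrow> real) \<Rightarrow> ereal" where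
  "m0 dt U = (INF \<beta>. INF i. ereal (time_slope dt U \<beta> 0 i))"

definition inv_minus :: "(real \<Rightarrow> real) \<Rightarrow> ereal \<Rightarrow> ereal" where
  "inv_minus h a = (if a = \<infinity> then - \<infinity> else Inf {ereal p | p. ereal (h p) = a})"

definition inv_plus :: "(real \<Rightarrow> real) \<Rightarrow> ereal \<Rightarrow> ereal" where
  "inv_plus h a = (if a = \<infinity> then \<infinity> else Sup {ereal p | p. ereal (h p) = a})"

definition CFL ::
  "('n::finite \<Rightarrow> real \<Rightarrow> real) \<Rightarrow> ('n \<Rightarrow> real \<Rightarrow> real) \<Rightarrow> ('n \<Rightarrow> real \<Rightarrow> real)
    \<Rightarrow> real \<Rightarrow> real \<Rightarrow> ('n \<Rightarrow> nat \<Rightarrow> nat \<Rightarrow> real) \<Rightarrow> bool" where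
  "CFL H Hm Hp dt dx U \<longleftrightarrow>
     ereal (dx / dt) \<ge>
       (SUP \<alpha>. SUP p\<in>{p. inv_minus (Hm \<alpha>) (- m0 dt U) \<le> ereal p \<and> ereal p \<le> inv_plus (Hp \<alpha>) (- m0 dt U)}.
          ereal \<bar>deriv (H \<alpha>) p\<bar>)"

text \<open>The supremum is taken in \<open>ennreal\<close>, so it is \<open>0\<close> if no grid point lies in \<open>K\<close>.\<close>

definition grid_error ::
  "('n::finite \<Rightarrow> real^2) \<Rightarrow> (real \<times> (real^2)) set \<Rightarrow> (real \<times> (real^2) \<Rightarrow> real)
    \<Rightarrow> real \<Rightarrow> real \<Rightarrow> ('n \<Rightarrow> nat \<Rightarrow> nat \<Rightarrow> real) \<Rightarrow> ennreal" where
  "grid_error e K u dt dx U =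
     (SUP (\<alpha>, n, i)\<in>{(\<alpha>, n, i). (real n * dt, (real i * dx) *\<^sub>R e \<alpha>) \<in> K}.
        ennreal \<bar>branch e u \<alpha> (real n * dt) (real i * dx) - U \<alpha> n i\<bar>)"

end

theory Submission
  imports Defs
begin

text \<open>Under the CFL condition the scheme is monotone on the slopes it produces, so the time slopes stay
  between their initial bounds and the grid functions are Lipschitz uniformly in the steps. By
  Tychonoff's theorem every family of grid functions has a locally uniform limit along a finer filter;
  monotonicity makes each such limit a viscosity solution, and it stays at bounded distance from the
  initial data, so the uniqueness hypothesis identifies it with \<open>u\<close>. No comparison principle is
  used. The viscosity inequalities are tested with the cones
  \<open>a (t - t0) + b (x - x0) \<plusminus> 2\<eta> (|t - t0| + |x - x0|)\<close>, whose difference quotients are within \<open>2\<eta>\<close> of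
  \<open>a\<close> and \<open>b\<close>.\<close>

text \<open>The CFL condition controls \<open>H'\<close> only on \<open>[l, r]\<close>, so it yields
  monotonicity only for data with slopes in that interval. A direct gradient estimate would be
  circular: the slopes at the next level are controlled through monotonicity there, which
  presupposes their control. The fluxes are therefore replaced outside \<open>[l, r]\<close> by
  extensions of speed at most \<open>dx / dt\<close>. The extended update is monotone on all arrays,
  and it is identified with the scheme once its slopes are bounded. The cones need the same device,
  as their slopes may leave \<open>[l, r]\<close>.

  For a test at the vertex, the discrete contact may fall inside a branch, where the scheme only
  knows the full \<open>H\<close> of that branch, whereas the supersolution test asks for the
  maximum of the \<open>Hm\<close>. The limit argument thus gives only that some branch satisfies
  the inequality with \<open>H\<close>; for slopes left of the minimum points this is the vertex
  condition.

  Filters replace subsequences because limits are taken at uncountably many fixed points, where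
  compactness of the product does not provide convergent subsequences.\<close>

section \<open>Convex Hamiltonians\<close>


text \<open>For \<open>k = 0\<close> this is the truncation of the flux to slopes above \<open>l\<close>; for \<open>k > 0\<close> the
  extension moreover exceeds \<open>F l\<close> strictly to the left of \<open>l\<close>.\<close>

definition extension :: "(real \<Rightarrow> real) \<Rightarrow> real \<Rightarrow> real \<Rightarrow> real \<Rightarrow> real" where
  "extension F k l p = F (max p l) + k * max (l - p) 0"

lemma extension_eq: "l \<le> p \<Longrightarrow> extension F k l p = F p"
  by (simp add: extension_def max_def)

text \<open>Convexity itself is dropped: what the scheme sees is monotonicity on either side of the
  minimum point \<open>c\<close>, coercivity and differentiability. These are preserved by changing
  the sign of the slope, which exchanges \<open>hm\<close> and \<open>hp\<close>.\<close>

locale split_hamiltonian =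
  fixes c :: real and h hm hp :: "real \<Rightarrow> real"
  assumes differentiable: "h differentiable (at p)"
    and antimono: "p \<le> q \<Longrightarrow> q \<le> c \<Longrightarrow> h q \<le> h p"
    and mono: "c \<le> p \<Longrightarrow> p \<le> q \<Longrightarrow> h p \<le> h q"
    and bounded_sublevel: "bounded {p. h p \<le> a}"
    and hm_eq: "hm p = h (min p c)"
    and hp_eq: "hp p = h (max p c)"
begin

text \<open>Halves the work: right ends of sublevel sets and all facts about the backward flux are
  the left-hand facts for the reflected Hamiltonian.\<close>

lemma reflect: "split_hamiltonian (- c) (\<lambda>p. h (- p)) (\<lambda>p. hp (- p)) (\<lambda>p. hm (- p))"
proof
  fix p
  show "(\<lambda>p. h (- p)) differentiable at p"
    using differentiable_compose[of h uminus p UNIV] differentiable by (auto intro: derivative_intros)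
  show "bounded {p. h (- p) \<le> a}" for a
  proof -
    have "{p. h (- p) \<le> a} = uminus ` {p. h p \<le> a}"
      by (auto simp: image_iff intro!: exI[of _ "- _"])
    then show ?thesis using bounded_sublevel[of a] by simp
  qed
  show "hp (- p) = h (- min p (- c))" "hm (- p) = h (- max p (- c))"
    by (simp_all add: hp_eq hm_eq minus_min_eq_max minus_max_eq_min)
qed (use antimono mono in auto)

lemma continuous_h: "continuous_on S h"
  using differentiable by (meson continuous_at_imp_continuous_on differentiable_imp_continuous_within)

lemma continuous_hm: "continuous_on S hm" and continuous_hp: "continuous_on S hp"
  unfolding hm_eq[abs_def] hp_eq[abs_def]
  by (auto intro!: continuous_on_compose2[OF continuous_h[of UNIV]] continuous_intros)

lemma h_eq_max: "h p = max (hp p) (hm p)"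
  using antimono[of p c] mono[of c p] by (auto simp: hp_eq hm_eq min_def max_def)

lemma hm_antimono: "p \<le> q \<Longrightarrow> hm q \<le> hm p"
  by (auto simp: hm_eq min_def intro: antimono)

lemma min_le_hm: "h c \<le> hm p"
  by (auto simp: hm_eq min_def intro: antimono)

text \<open>Take the infimum of \<open>{p. h p \<le> a}\<close>: closedness gives
  \<open>h l \<le> a\<close>, and the limit from the left, where \<open>h\<close> is above
  \<open>a\<close>, gives the converse. Slopes beyond \<open>c\<close>, where \<open>hm\<close> is
  constant, cause no trouble because \<open>l \<le> c\<close>.\<close>

lemma sublevel_left_end:
  assumes "h c \<le> a"
  obtains l where "l \<le> c" "h l = a" "\<And>p. hm p \<le> a \<Longrightarrow> l \<le> p"
proof
  let ?A = "{p. h p \<le> a}"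
  define l where "l = Inf ?A"
  have bdd: "bdd_below ?A" using bounded_sublevel by (rule bounded_imp_bdd_below)
  have ne: "?A \<noteq> {}" using assms by auto
  have "closed ?A" by (intro closed_Collect_le continuous_h continuous_intros)
  then have le: "h l \<le> a" using closed_contains_Inf[OF ne bdd] by (simp add: l_def)
  show lc: "l \<le> c" unfolding l_def using assms bdd by (auto intro: cInf_lower)
  show "l \<le> p" if "hm p \<le> a" for p
  proof (cases "p \<le> c")
    case True
    then show ?thesis unfolding l_def using bdd that by (auto simp: hm_eq intro!: cInf_lower)
  qed (use lc in auto)
  have "(h \<longlongrightarrow> h l) (at_left l)"
    using continuous_h[of UNIV] by (simp add: continuous_on_eq_continuous_within continuous_within filterlim_at_split)
  moreover have "\<forall>\<^sub>F p in at_left l. a \<le> h p"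
  proof -
    have "a \<le> h p" if "p < l" for p
    proof (rule ccontr)
      assume "\<not> ?thesis"
      then have "l \<le> p" unfolding l_def using bdd by (auto intro: cInf_lower)
      then show False using that by simp
    qed
    then show ?thesis by (auto simp: eventually_at_filter)
  qed
  ultimately have "a \<le> h l"
    by (rule tendsto_lowerbound) simp
  then show "h l = a" using le by simp
qed

lemma deriv_bound_imp_lipschitz:
  assumes "\<And>p. l \<le> p \<Longrightarrow> p \<le> r \<Longrightarrow> \<bar>deriv h p\<bar> \<le> k" and "l \<le> p" "p \<le> q" "q \<le> r"
  shows "\<bar>h q - h p\<bar> \<le> k * (q - p)"
proof (cases "p = q")
  case False
  then have "p < q" using assms by simp
  have "(h has_real_derivative deriv h x) (at x)" for x
    using differentiable[of x] by (simp add: DERIV_deriv_iff_real_differentiable)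
  then obtain z where z: "p < z" "z < q" "h q - h p = (q - p) * deriv h z"
    using MVT2[OF \<open>p < q\<close>, of h "deriv h"] by auto
  have "\<bar>deriv h z\<bar> \<le> k" using z assms by auto
  then show ?thesis using z \<open>p < q\<close> by (simp add: abs_mult mult.commute mult_left_mono)
qed simp

lemma deriv_reflect: "deriv (\<lambda>p. h (- p)) p = - deriv h (- p)"
proof -
  have "(h has_real_derivative deriv h (- p)) (at (- p))"
    using differentiable by (simp add: DERIV_deriv_iff_real_differentiable)
  then have "((\<lambda>p. h (- p)) has_real_derivative deriv h (- p) * - 1) (at p)"
    by (rule DERIV_chain2) (auto intro!: derivative_eq_intros)
  then show ?thesis by (simp add: DERIV_imp_deriv)
qed

lemma extension_antimono:
  assumes "0 \<le> k" "p \<le> q" shows "extension hm k l q \<le> extension hm k l p"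
proof -
  have "hm (max q l) \<le> hm (max p l)" using assms by (intro hm_antimono) auto
  moreover have "k * max (l - q) 0 \<le> k * max (l - p) 0" using assms by (intro mult_left_mono) auto
  ultimately show ?thesis by (simp add: extension_def)
qed

text \<open>The increment \<open>q - p\<close> splits into a part right of \<open>l\<close>, where
  \<open>hm\<close> has speed at most \<open>k'\<close>, and a part left of \<open>l\<close>, where
  only the linear term varies, with speed \<open>k \<le> k'\<close>. The parts are disjoint, so the
  two speeds do not add up. Truncating at \<open>c \<le> r\<close> keeps the first part inside the
  interval of the derivative bound.\<close>

lemma extension_lipschitz:
  assumes k: "0 \<le> k" "k \<le> k'" and d: "\<And>p. l \<le> p \<Longrightarrow> p \<le> r \<Longrightarrow> \<bar>deriv h p\<bar> \<le> k'"
    and lr: "l \<le> c" "c \<le> r" and pq: "p \<le> q"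
  shows "extension hm k l p \<le> extension hm k l q + k' * (q - p)"
proof -
  have 1: "hm p' \<le> hm q' + k' * (q' - p')" if "l \<le> p'" "p' \<le> q'" for p' q'
  proof -
    have "\<bar>h (min q' c) - h (min p' c)\<bar> \<le> k' * (min q' c - min p' c)"
      using that lr by (intro deriv_bound_imp_lipschitz[OF d]) auto
    also have "\<dots> \<le> k' * (q' - p')" using k that by (intro mult_left_mono) (auto simp: min_def)
    finally show ?thesis by (simp add: hm_eq)
  qed
  have "hm (max p l) \<le> hm (max q l) + k' * (max q l - max p l)"
    using 1[of "max p l" "max q l"] pq by auto
  moreover have "k * max (l - p) 0 \<le> k * max (l - q) 0 + k' * ((q - p) - (max q l - max p l))"
  proof -
    have "max (l - p) 0 - max (l - q) 0 = (q - p) - (max q l - max p l)" by (auto simp: max_def)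
    moreover have "0 \<le> (q - p) - (max q l - max p l)" using pq by (auto simp: max_def)
    ultimately have "k * (max (l - p) 0 - max (l - q) 0) \<le> k' * ((q - p) - (max q l - max p l))"
      using k by (metis mult_right_mono)
    then show ?thesis by (simp add: right_diff_distrib)
  qed
  ultimately show ?thesis by (simp add: extension_def algebra_simps)
qed

end

text \<open>Uniform convexity gives \<open>L'\<close> a Lipschitz inverse \<open>g\<close>, which is
  the derivative of \<open>h\<close>. For fixed \<open>p\<close> the function
  \<open>p * q - L q\<close> increases up to \<open>q = g p\<close> and decreases afterwards, so
  restricting \<open>q\<close> to a half-line moves the maximiser to \<open>min (g p) 0\<close> or
  \<open>max (g p) 0\<close>. The minimum point of \<open>h\<close> is the zero of \<open>g\<close>,
  namely \<open>L' 0\<close>.\<close>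

lemma legendre_split:
  fixes L L' L'' :: "real \<Rightarrow> real"
  assumes \<gamma>: "0 < \<gamma>" "\<And>q. \<gamma> \<le> L'' q"
    and L: "\<And>q. (L has_real_derivative L' q) (at q)" "\<And>q. (L' has_real_derivative L'' q) (at q)"
    and h: "\<And>p. h p = (SUP q. p * q - L q)"
    and hm: "\<And>p. hm p = (SUP q\<in>{..0}. p * q - L q)"
    and hp: "\<And>p. hp p = (SUP q\<in>{0..}. p * q - L q)"
  shows "split_hamiltonian (L' 0) h hm hp"
proof -
  have L'_mono: "\<gamma> * (q - p) \<le> L' q - L' p" if "p \<le> q" for p q
  proof -
    have "L' p - \<gamma> * p \<le> L' q - \<gamma> * q"
      by (rule DERIV_nonneg_imp_nondecreasing[OF that])
        (use \<gamma> in \<open>auto intro!: exI[of _ "L'' _ - \<gamma>"] derivative_eq_intros L\<close>)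
    then show ?thesis by (simp add: algebra_simps)
  qed
  have L'_cont: "continuous_on S L'" for S
    using L(2) by (meson DERIV_isCont continuous_at_imp_continuous_on)
  have "\<exists>q. L' q = p" for p
  proof -
    \<comment> \<open>\<open>L'\<close> grows at least at rate \<open>\<gamma>\<close>, so within
      distance \<open>R\<close> of \<open>0\<close> it has reached \<open>p\<close>.\<close>
    define R where "R = \<bar>p - L' 0\<bar> / \<gamma>"
    have R: "0 \<le> R" "\<gamma> * R = \<bar>p - L' 0\<bar>" using \<gamma> by (auto simp: R_def)
    have "p \<le> L' R" "L' (- R) \<le> p" using L'_mono[of 0 R] L'_mono[of "-R" 0] R by auto
    then show ?thesis using IVT'[of L' "-R" p R] R L'_cont by auto
  qed
  then obtain g where g: "\<And>p. L' (g p) = p" by metis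
  have L'_less: "L' p < L' q \<longleftrightarrow> p < q" for p q
    using L'_mono[of p q] L'_mono[of q p] \<gamma>
    by (smt (verit) mult_pos_pos)
  have g_mono: "g p \<le> g q \<longleftrightarrow> p \<le> q" for p q
    using L'_less[of "g q" "g p"] g by (simp add: not_less[symmetric])
  have g_lip: "\<bar>g p - g q\<bar> \<le> \<bar>p - q\<bar> / \<gamma>" for p q
    using L'_mono[of "g p" "g q"] L'_mono[of "g q" "g p"] g g_mono[of p q] g_mono[of q p] \<gamma>
    by (cases "p \<le> q") (simp_all add: field_simps abs_if)
  define k where "k p q = p * q - L q" for p q
  have k_deriv: "(k p has_real_derivative p - L' q) (at q)" for p q
    unfolding k_def by (auto intro!: derivative_eq_intros L)
  have k_up: "k p q \<le> k p q'" if "q \<le> q'" "q' \<le> g p" for p q q'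
  proof (rule DERIV_nonneg_imp_nondecreasing[OF that(1)], intro exI conjI)
    fix x assume "x \<le> q'"
    then show "0 \<le> p - L' x" using L'_less[of "g p" x] g[of p] that by auto
  qed (rule k_deriv)
  have k_down: "k p q' \<le> k p q" if "q \<le> q'" "g p \<le> q" for p q q'
  proof (rule DERIV_nonpos_imp_nonincreasing[OF that(1)], intro exI conjI)
    fix x assume "q \<le> x"
    then show "p - L' x \<le> 0" using L'_less[of x "g p"] g[of p] that by auto
  qed (rule k_deriv)
  have k_max: "k p q \<le> k p (g p)" for p q
    using k_up[of q "g p" p] k_down[of "g p" q p] by linarith
  have h_k: "h p = k p (g p)" for p
    unfolding h using k_max by (intro cSup_eq_maximum) (auto simp: k_def)
  have hm_k: "hm p = k p (min (g p) 0)" for p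
    unfolding hm
  proof (intro cSup_eq_maximum)
    fix y assume "y \<in> (\<lambda>q. p * q - L q) ` {..0}"
    then show "y \<le> k p (min (g p) 0)"
      using k_max[of p] k_up[of _ 0 p] by (auto simp: k_def min_def)
  qed (auto simp: k_def)
  have hp_k: "hp p = k p (max (g p) 0)" for p
    unfolding hp
  proof (intro cSup_eq_maximum)
    fix y assume "y \<in> (\<lambda>q. p * q - L q) ` {0..}"
    then show "y \<le> k p (max (g p) 0)"
      using k_max[of p] k_down[of 0 _ p] by (auto simp: k_def max_def)
  qed (auto simp: k_def)
  have g0: "g (L' 0) = 0" using L'_less[of "g (L' 0)" 0] L'_less[of 0 "g (L' 0)"] g[of "L' 0"] by linarith
  have sub: "h p + (q - p) * g p \<le> h q" for p q
    using k_max[of q "g p"] by (simp add: h_k k_def algebra_simps)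
  \<comment> \<open>The subgradient inequalities at \<open>p\<close> and at \<open>y\<close> enclose
    the first-order error between \<open>0\<close> and \<open>(y - p) * (g y - g p)\<close>, which
    is quadratic because \<open>g\<close> is Lipschitz.\<close>
  have h_deriv: "(h has_real_derivative g p) (at p)" for p
    unfolding has_field_derivative_iff
  proof (rule tendsto_sandwich)
    have "\<bar>(h y - h p) / (y - p) - g p\<bar> \<le> \<bar>y - p\<bar> / \<gamma>" if "y \<noteq> p" for y
    proof -
      have "0 \<le> h y - h p - (y - p) * g p" "h y - h p - (y - p) * g p \<le> (y - p) * (g y - g p)"
        using sub[of p y] sub[of y p] by (auto simp: algebra_simps)
      then have "\<bar>h y - h p - (y - p) * g p\<bar> \<le> \<bar>y - p\<bar> * \<bar>g y - g p\<bar>"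
        by (auto simp flip: abs_mult)
      also have "\<dots> \<le> \<bar>y - p\<bar> * (\<bar>y - p\<bar> / \<gamma>)" by (intro mult_left_mono g_lip) simp
      finally have "\<bar>h y - h p - (y - p) * g p\<bar> / \<bar>y - p\<bar> \<le> \<bar>y - p\<bar> / \<gamma>"
        using that by (simp add: divide_le_eq mult.commute)
      moreover have "(h y - h p) / (y - p) - g p = (h y - h p - (y - p) * g p) / (y - p)"
        using that by (simp add: field_simps)
      ultimately show ?thesis by simp
    qed
    then have *: "g p - \<bar>y - p\<bar> / \<gamma> \<le> (h y - h p) / (y - p)"
       "(h y - h p) / (y - p) \<le> g p + \<bar>y - p\<bar> / \<gamma>" if "y \<noteq> p" for y using that by (smt (verit))+
    show "\<forall>\<^sub>F y in at p. g p - \<bar>y - p\<bar> / \<gamma> \<le> (h y - h p) / (y - p)"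
      "\<forall>\<^sub>F y in at p. (h y - h p) / (y - p) \<le> g p + \<bar>y - p\<bar> / \<gamma>"
      using * by (auto simp: eventually_at_filter)
    show "((\<lambda>y. g p - \<bar>y - p\<bar> / \<gamma>) \<longlongrightarrow> g p) (at p)" "((\<lambda>y. g p + \<bar>y - p\<bar> / \<gamma>) \<longlongrightarrow> g p) (at p)"
      using \<gamma> by (auto intro!: tendsto_eq_intros)
  qed
  show ?thesis
  proof
    fix p q a
    show "h differentiable at p"
      using h_deriv real_differentiable_def by blast
    show "h q \<le> h p" if "p \<le> q" "q \<le> L' 0"
    proof -
      have "g q \<le> 0" using g_mono[of q "L' 0"] that g0 by simp
      then have "0 \<le> (p - q) * g q" using that by (simp add: mult_nonpos_nonpos)
      then show ?thesis using sub[of q p] by simp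
    qed
    show "h p \<le> h q" if "L' 0 \<le> p" "p \<le> q"
    proof -
      have "0 \<le> g p" using g_mono[of "L' 0" p] that g0 by simp
      then have "0 \<le> (q - p) * g p" using that by simp
      then show ?thesis using sub[of p q] by simp
    qed
    \<comment> \<open>Coercivity by testing the supremum with \<open>q = 1\<close> and
      \<open>q = - 1\<close>.\<close>
    have "\<bar>p\<bar> \<le> a + \<bar>L 1\<bar> + \<bar>L (- 1)\<bar>" if "h p \<le> a" for p
      using k_max[of p 1] k_max[of p "-1"] that by (auto simp: h_k k_def)
    then show "bounded {p. h p \<le> a}" by (auto intro!: boundedI)
    show "hm p = h (min p (L' 0))"
      using g_mono[of p "L' 0"] g0 by (auto simp: hm_k h_k min_def k_def)
    show "hp p = h (max p (L' 0))"
      using g_mono[of p "L' 0"] g0 by (auto simp: hp_k h_k max_def k_def)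
  qed
qed


section \<open>Gradient estimates for the scheme\<close>

text \<open>Raising \<open>b\<close> by one unit lowers the slope by \<open>1 / dx\<close>, so
  \<open>dt * f\<close> changes by at most one unit and the update does not decrease. Split by the
  order of the two slopes, each case uses just one inequality of \<open>le\<close>: the first that
  on \<open>b\<close>, the second that on \<open>c\<close>.\<close>

lemma upwind_step_mono:
  fixes f :: "real \<Rightarrow> real"
  assumes f: "\<And>p q. p \<le> q \<Longrightarrow> f q \<le> f p" "\<And>p q. p \<le> q \<Longrightarrow> f p \<le> f q + dx / dt * (q - p)"
    and pos: "0 < dt" "0 < dx" and le: "b \<le> b' + k" "c \<le> c' + k"
  shows "b - dt * f ((c - b) / dx) \<le> b' + k - dt * f ((c' - b') / dx)"
proof (cases "(c - b) / dx \<le> (c' - b') / dx")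
  case True
  then have "dt * f ((c' - b') / dx) \<le> dt * f ((c - b) / dx)" using f(1) pos by simp
  then show ?thesis using le by simp
next
  case False
  let ?p = "(c' - b') / dx" and ?q = "(c - b) / dx"
  have "dt * f ?p \<le> dt * (f ?q + dx / dt * (?q - ?p))"
    using f(2)[of ?p ?q] False pos by simp
  also have "\<dots> = dt * f ?q + ((c - b) - (c' - b'))"
    using pos by (simp add: field_simps)
  finally show ?thesis using le by simp
qed

text \<open>The scheme combines its two fluxes by a maximum and not by a sum; the update is
  therefore a minimum of two one-sided updates, each monotone under the CFL bound as it stands,
  without a factor 2.\<close>

lemma minus_mult_max: "0 \<le> d \<Longrightarrow> a - d * max x y = min (a - d * x) (a - d * y)" for a d x y :: real
  by (auto simp: max_def min_def mult_left_mono dest: mult_left_mono[of _ _ d])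

lemma MAX_attained: "\<exists>x. (MAX x. f x) = f x" for f :: "'n::finite \<Rightarrow> 'b::linorder"
  by (metis Max_in UNIV_not_empty finite finite_imageI image_is_empty rangeE)

locale junction_scheme =
  fixes c :: "'n::finite \<Rightarrow> real" and H Hm Hp :: "'n \<Rightarrow> real \<Rightarrow> real" and dt dx :: real
    and U :: "'n \<Rightarrow> nat \<Rightarrow> nat \<Rightarrow> real"
  assumes split: "split_hamiltonian (c \<alpha>) (H \<alpha>) (Hm \<alpha>) (Hp \<alpha>)"
    and pos: "0 < dt" "0 < dx"
    and interior_step: "1 \<le> i \<Longrightarrow> time_slope dt U \<alpha> n i
        + max (Hp \<alpha> (slope_bwd dx U \<alpha> n i)) (Hm \<alpha> (slope_fwd dx U \<alpha> n i)) = 0"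
    and vertex: "U \<alpha> n 0 = U \<beta> n 0"
    and vertex_step: "time_slope dt U \<alpha> n 0 + (MAX \<beta>. Hm \<beta> (slope_fwd dx U \<beta> n 0)) = 0"
begin

sublocale split_hamiltonian "c \<alpha>" "H \<alpha>" "Hm \<alpha>" "Hp \<alpha>" for \<alpha>
  by (rule split)

sublocale R: split_hamiltonian "- c \<alpha>" "\<lambda>p. H \<alpha> (- p)" "\<lambda>p. Hp \<alpha> (- p)" "\<lambda>p. Hm \<alpha> (- p)" for \<alpha>
  by (rule reflect)

lemma step_fwd: "time_slope dt U \<alpha> n i + Hm \<alpha> (slope_fwd dx U \<alpha> n i) \<le> 0"
proof (cases "i = 0")
  case True
  have "Hm \<alpha> (slope_fwd dx U \<alpha> n 0) \<le> (MAX \<beta>. Hm \<beta> (slope_fwd dx U \<beta> n 0))" by simp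
  then show ?thesis using vertex_step[of \<alpha> n] unfolding True by linarith
qed (use interior_step[of i \<alpha> n] in auto)

lemma step_bwd: "1 \<le> i \<Longrightarrow> time_slope dt U \<alpha> n i + Hp \<alpha> (slope_bwd dx U \<alpha> n i) \<le> 0"
  using interior_step[of i \<alpha> n] by auto

end

locale bounded_slope_scheme = junction_scheme +
  fixes l r :: "'n::finite \<Rightarrow> real"
  assumes ends: "l \<alpha> \<le> c \<alpha>" "c \<alpha> \<le> r \<alpha>"
    and speed: "\<And>p. l \<alpha> \<le> p \<Longrightarrow> p \<le> r \<alpha> \<Longrightarrow> \<bar>deriv (H \<alpha>) p\<bar> \<le> dx / dt"
begin

text \<open>The backward flux is reflected, so that \<open>G\<close>, like \<open>F\<close>, is a non-increasing function of the slope
  towards the neighbour.\<close>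

definition F where "F k \<alpha> = extension (Hm \<alpha>) k (l \<alpha>)"
definition G where "G k \<alpha> = extension (\<lambda>p. Hp \<alpha> (- p)) k (- r \<alpha>)"

context
  fixes k assumes k: "0 \<le> k" "k \<le> dx / dt"
begin

lemma F_step_mono:
  assumes "b \<le> b' + s" "a \<le> a' + s"
  shows "b - dt * F k \<alpha> ((a - b) / dx) \<le> b' + s - dt * F k \<alpha> ((a' - b') / dx)"
  by (rule upwind_step_mono)
    (use assms extension_antimono[OF k(1)] extension_lipschitz[OF k speed ends] pos in \<open>auto simp: F_def\<close>)

lemma G_step_mono:
  assumes "b \<le> b' + s" "a \<le> a' + s"
  shows "b - dt * G k \<alpha> ((a - b) / dx) \<le> b' + s - dt * G k \<alpha> ((a' - b') / dx)"
  unfolding G_def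
proof (rule upwind_step_mono[OF _ _ pos assms])
  show "extension (\<lambda>p. Hp \<alpha> (- p)) k (- r \<alpha>) p
         \<le> extension (\<lambda>p. Hp \<alpha> (- p)) k (- r \<alpha>) q + dx / dt * (q - p)" if "p \<le> q" for p q
    by (rule R.extension_lipschitz[OF k _ _ _ that, of "- r \<alpha>" "- l \<alpha>"])
      (use speed ends in \<open>auto simp: deriv_reflect\<close>)
qed (rule R.extension_antimono[OF k(1)])

lemma interior_step_mono:
  assumes "b \<le> b' + s" "a \<le> a' + s" "d \<le> d' + s"
  shows "b - dt * max (G k \<alpha> ((a - b) / dx)) (F k \<alpha> ((d - b) / dx))
    \<le> b' + s - dt * max (G k \<alpha> ((a' - b') / dx)) (F k \<alpha> ((d' - b') / dx))"
  unfolding minus_mult_max[OF less_imp_le[OF pos(1)]]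
  by (intro min.mono F_step_mono G_step_mono assms)

lemma vertex_step_mono:
  assumes "b \<le> b' + s" "\<And>\<alpha>. a \<alpha> \<le> a' \<alpha> + s"
  shows "b - dt * (MAX \<alpha>. F k \<alpha> ((a \<alpha> - b) / dx)) \<le> b' + s - dt * (MAX \<alpha>. F k \<alpha> ((a' \<alpha> - b') / dx))"
proof -
  \<comment> \<open>It suffices to compare along the branch that attains the maximum for the primed
    data: replacing the other maximum by this one branch can only raise the left-hand side.\<close>
  obtain \<alpha> where \<alpha>: "(MAX \<alpha>. F k \<alpha> ((a' \<alpha> - b') / dx)) = F k \<alpha> ((a' \<alpha> - b') / dx)"
    using MAX_attained[of "\<lambda>\<alpha>. F k \<alpha> ((a' \<alpha> - b') / dx)"] by auto
  have "F k \<alpha> ((a \<alpha> - b) / dx) \<le> (MAX \<alpha>. F k \<alpha> ((a \<alpha> - b) / dx))" by simp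
  then have "dt * F k \<alpha> ((a \<alpha> - b) / dx) \<le> dt * (MAX \<alpha>. F k \<alpha> ((a \<alpha> - b) / dx))" using pos by simp
  then show ?thesis using F_step_mono[OF assms(1) assms(2), of \<alpha> \<alpha>] \<alpha> by simp
qed

text \<open>The vertex value is read on \<open>\<alpha>\<close> for every \<open>\<beta>\<close>, so
  monotonicity holds for arrays whose branches need not agree at index 0.\<close>

definition flux :: "('n \<Rightarrow> nat \<Rightarrow> real) \<Rightarrow> 'n \<Rightarrow> nat \<Rightarrow> real" where
  "flux X \<alpha> i = (if i = 0 then MAX \<beta>. F k \<beta> ((X \<beta> 1 - X \<alpha> 0) / dx)
     else max (G k \<alpha> ((X \<alpha> (i - 1) - X \<alpha> i) / dx)) (F k \<alpha> ((X \<alpha> (i + 1) - X \<alpha> i) / dx)))"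

lemma flux_step_mono:
  assumes "\<And>\<alpha> i. X \<alpha> i \<le> Y \<alpha> i + s"
  shows "X \<alpha> i - dt * flux X \<alpha> i \<le> Y \<alpha> i + s - dt * flux Y \<alpha> i"
  unfolding flux_def by (auto intro!: assms vertex_step_mono interior_step_mono)

lemma flux_eq_time_slope:
  assumes slopes: "\<And>\<alpha> i. l \<alpha> \<le> slope_fwd dx U \<alpha> n i \<and> slope_fwd dx U \<alpha> n i \<le> r \<alpha>"
  shows "flux (\<lambda>\<alpha>. U \<alpha> n) \<alpha> i = - time_slope dt U \<alpha> n i"
proof (cases "i = 0")
  case True
  have "F k \<beta> ((U \<beta> n 1 - U \<alpha> n 0) / dx) = Hm \<beta> (slope_fwd dx U \<beta> n 0)" for \<beta>
    using slopes[of \<beta> 0] vertex[of \<alpha> n \<beta>] by (simp add: F_def extension_eq slope_fwd_def)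
  then show ?thesis using vertex_step[of \<alpha> n] True by (simp add: flux_def)
next
  case False
  then obtain j where i: "i = Suc j" by (cases i) auto
  have neg: "(U \<alpha> n j - U \<alpha> n i) / dx = - slope_fwd dx U \<alpha> n j"
    by (simp add: slope_fwd_def i minus_divide_left)
  show ?thesis
    using slopes[of \<alpha> i] slopes[of \<alpha> j] interior_step[of i \<alpha> n] i neg
    by (simp add: flux_def F_def G_def extension_eq slope_fwd_def slope_bwd_def)
qed

end

text \<open>The bounds on the time slopes propagate because the extended scheme is monotone and commutes with
  constants; the bounds on the space slopes are then read off \<open>flux \<le> - m\<close>.\<close>

lemma gradient_estimate:
  assumes level: "\<And>\<alpha>. H \<alpha> (l \<alpha>) = - m" "\<And>\<alpha>. H \<alpha> (r \<alpha>) = - m"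
    and sublevel: "\<And>\<alpha> p. Hm \<alpha> p \<le> - m \<Longrightarrow> l \<alpha> \<le> p" "\<And>\<alpha> p. Hp \<alpha> p \<le> - m \<Longrightarrow> p \<le> r \<alpha>"
    and initial: "\<And>\<alpha> i. m \<le> time_slope dt U \<alpha> 0 i" "\<And>\<alpha> i. time_slope dt U \<alpha> 0 i \<le> M"
  shows "(\<forall>\<alpha> i. l \<alpha> \<le> slope_fwd dx U \<alpha> n i \<and> slope_fwd dx U \<alpha> n i \<le> r \<alpha>) \<and>
    (\<forall>\<alpha> i. m \<le> time_slope dt U \<alpha> n i \<and> time_slope dt U \<alpha> n i \<le> M)"
proof (induction n)
  case 0
  have "l \<alpha> \<le> slope_fwd dx U \<alpha> 0 i" for \<alpha> i
    using sublevel(1)[of \<alpha> "slope_fwd dx U \<alpha> 0 i"] step_fwd[of \<alpha> 0 i] initial(1)[of \<alpha> i] by simp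
  \<comment> \<open>The upper bound for the slope leaving \<open>i\<close> comes from the backward
    inequality at \<open>i + 1\<close>; index 0, which has no backward inequality, is never asked
    for one.\<close>
  moreover have "slope_fwd dx U \<alpha> 0 i \<le> r \<alpha>" for \<alpha> i
    using sublevel(2)[of \<alpha> "slope_bwd dx U \<alpha> 0 (i + 1)"] step_bwd[of "i + 1" \<alpha> 0] initial(1)[of \<alpha> "i + 1"]
    by (simp add: slope_fwd_def slope_bwd_def)
  ultimately show ?case using initial by simp
next
  case (Suc n)
  \<comment> \<open>\<open>k\<close> must be positive, so that an extended flux exceeds
    \<open>- m\<close> as soon as the slope leaves \<open>[l, r]\<close>, and at most
    \<open>dx / dt\<close>, so that monotonicity survives.\<close>
  define k where "k = dx / dt"
  have k: "0 < k" "0 \<le> k" "k \<le> dx / dt" using pos by (auto simp: k_def)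
  note flux_mono = flux_step_mono[OF k(2,3)]
  let ?X = "\<lambda>\<alpha>. U \<alpha> n" and ?Y = "\<lambda>\<alpha>. U \<alpha> (n + 1)"
  have flux_n: "flux k ?X \<alpha> i = - time_slope dt U \<alpha> n i" for \<alpha> i
    using Suc by (intro flux_eq_time_slope k) auto
  have next_eq: "U \<alpha> n i - dt * flux k ?X \<alpha> i = U \<alpha> (n + 1) i" for \<alpha> i
    using pos by (simp add: flux_n time_slope_def)
  have le: "U \<alpha> n i + dt * m \<le> U \<alpha> (n + 1) i" "U \<alpha> (n + 1) i \<le> U \<alpha> n i + dt * M" for \<alpha> i
    using Suc pos by (auto simp: time_slope_def field_simps)
  \<comment> \<open>The update of \<open>?X\<close> is \<open>?Y\<close>; comparing it with the
    update of \<open>?Y\<close> leaves only the flux of \<open>?Y\<close>. This is still the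
    extended flux, not yet a time slope, because the slopes at the new level are not controlled so
    far.\<close>
  have "dt * flux k ?Y \<alpha> i \<le> dt * (- m)" "dt * (- M) \<le> dt * flux k ?Y \<alpha> i" for \<alpha> i
    using flux_mono[of ?X ?Y "- dt * m" \<alpha> i] flux_mono[of ?Y ?X "dt * M" \<alpha> i] le next_eq[of \<alpha> i]
    by (auto simp: algebra_simps)
  then have flux_le: "flux k ?Y \<alpha> i \<le> - m" and flux_ge: "- M \<le> flux k ?Y \<alpha> i" for \<alpha> i
    by (simp_all only: mult_le_cancel_left_pos[OF pos(1)])
  have F_le: "F k \<alpha> (slope_fwd dx U \<alpha> (n + 1) i) \<le> - m" for \<alpha> i
  proof (cases "i = 0")
    case True
    have "F k \<alpha> (slope_fwd dx U \<alpha> (n + 1) 0) \<le> flux k ?Y \<alpha> 0"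
      unfolding flux_def[OF k(2,3)] by (auto simp: slope_fwd_def vertex[of \<alpha> _ _])
    then show ?thesis using flux_le[of \<alpha> 0] True by simp
  next
    case False
    then have "F k \<alpha> (slope_fwd dx U \<alpha> (n + 1) i) \<le> flux k ?Y \<alpha> i"
      unfolding flux_def[OF k(2,3)] by (simp add: slope_fwd_def)
    then show ?thesis using flux_le[of \<alpha> i] by simp
  qed
  have G_le: "G k \<alpha> (- slope_fwd dx U \<alpha> (n + 1) i) \<le> - m" for \<alpha> i
  proof -
    have eq: "(U \<alpha> (n + 1) i - U \<alpha> (n + 1) (i + 1)) / dx = - slope_fwd dx U \<alpha> (n + 1) i"
      by (simp add: slope_fwd_def minus_divide_left)
    have "G k \<alpha> (- slope_fwd dx U \<alpha> (n + 1) i) \<le> flux k ?Y \<alpha> (i + 1)"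
      unfolding flux_def[OF k(2,3)] using eq by simp
    then show ?thesis using flux_le[of \<alpha> "i + 1"] by simp
  qed
  have slopes: "l \<alpha> \<le> slope_fwd dx U \<alpha> (n + 1) i \<and> slope_fwd dx U \<alpha> (n + 1) i \<le> r \<alpha>" for \<alpha> i
  proof (intro conjI; rule ccontr)
    assume "\<not> l \<alpha> \<le> slope_fwd dx U \<alpha> (n + 1) i"
    then have "0 < k * (l \<alpha> - slope_fwd dx U \<alpha> (n + 1) i)" using k by simp
    moreover have "Hm \<alpha> (l \<alpha>) = - m" using ends[of \<alpha>] level by (simp add: hm_eq)
    ultimately show False
      using F_le[of \<alpha> i] \<open>\<not> _\<close> by (simp add: F_def extension_def max_def)
  next
    assume "\<not> slope_fwd dx U \<alpha> (n + 1) i \<le> r \<alpha>"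
    then have "0 < k * (slope_fwd dx U \<alpha> (n + 1) i - r \<alpha>)" using k by simp
    moreover have "Hp \<alpha> (r \<alpha>) = - m" using ends[of \<alpha>] level by (simp add: hp_eq)
    ultimately show False
      using G_le[of \<alpha> i] \<open>\<not> _\<close> by (simp add: G_def extension_def max_def)
  qed
  have "flux k ?Y \<alpha> i = - time_slope dt U \<alpha> (n + 1) i" for \<alpha> i
    using slopes by (intro flux_eq_time_slope k) auto
  then show ?case using slopes flux_le flux_ge by simp
qed

end


section \<open>Bounds uniform in the steps\<close>

lemma finite_uniform_bound:
  fixes Q :: "'n::finite \<Rightarrow> real \<Rightarrow> bool"
  assumes "\<And>\<alpha>. \<exists>K. Q \<alpha> K" and mono: "\<And>\<alpha> K K'. Q \<alpha> K \<Longrightarrow> K \<le> K' \<Longrightarrow> Q \<alpha> K'"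
  obtains K where "0 \<le> K" "\<And>\<alpha>. Q \<alpha> K"
proof -
  obtain k where k: "\<And>\<alpha>. Q \<alpha> (k \<alpha>)" using assms(1) by metis
  show thesis
  proof
    show "0 \<le> max 0 (MAX \<alpha>. k \<alpha>)" by simp
    show "Q \<alpha> (max 0 (MAX \<alpha>. k \<alpha>))" for \<alpha>
    proof (rule mono[OF k])
      have "k \<alpha> \<le> (MAX \<alpha>. k \<alpha>)" by simp
      then show "k \<alpha> \<le> max 0 (MAX \<alpha>. k \<alpha>)" by linarith
    qed
  qed
qed

text \<open>The Lipschitz constant of \<open>u0\<close> bounds the initial space slopes, hence the
  initial time slopes by \<open>C\<close>. Then \<open>- m \<le> C\<close>, so \<open>l\<close> and
  \<open>r\<close> lie in a sublevel set of \<open>H\<close> at height \<open>C\<close>, which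
  \<open>P\<close> bounds. None of these constants depends on the steps.\<close>

lemma numerical_solution_bounds:
  fixes c :: "'n::finite \<Rightarrow> real"
  assumes split: "\<And>\<alpha>. split_hamiltonian (c \<alpha>) (H \<alpha>) (Hm \<alpha>) (Hp \<alpha>)" and "A0 e u0"
  obtains C P where "0 \<le> C" "0 \<le> P"
    and "\<And>dt dx U. 0 < dt \<Longrightarrow> 0 < dx \<Longrightarrow> numerical_solution e Hm Hp u0 dt dx U \<Longrightarrow> CFL H Hm Hp dt dx U \<Longrightarrow>
      \<exists>l r. bounded_slope_scheme c H Hm Hp dt dx U l r \<and>
        (\<forall>\<alpha> n i. l \<alpha> \<le> slope_fwd dx U \<alpha> n i \<and> slope_fwd dx U \<alpha> n i \<le> r \<alpha> \<and>
          \<bar>slope_fwd dx U \<alpha> n i\<bar> \<le> P \<and> \<bar>time_slope dt U \<alpha> n i\<bar> \<le> C)"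
proof -
  interpret split_hamiltonian "c \<alpha>" "H \<alpha>" "Hm \<alpha>" "Hp \<alpha>" for \<alpha> by (rule split)
  interpret R: split_hamiltonian "- c \<alpha>" "\<lambda>p. H \<alpha> (- p)" "\<lambda>p. Hp \<alpha> (- p)" "\<lambda>p. Hm \<alpha> (- p)" for \<alpha>
    by (rule reflect)
  obtain K where K: "0 \<le> K" "\<And>\<alpha>. K-lipschitz_on {0..} (\<lambda>x. u0 (x *\<^sub>R e \<alpha>))"
  proof (rule finite_uniform_bound[of "\<lambda>\<alpha> K. K-lipschitz_on {0..} (\<lambda>x. u0 (x *\<^sub>R e \<alpha>))"])
    show "\<exists>K. K-lipschitz_on {0..} (\<lambda>x. u0 (x *\<^sub>R e \<alpha>))" for \<alpha>
      using \<open>A0 e u0\<close> by (simp add: A0_def)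
  qed (auto intro: lipschitz_on_le)
  have "\<exists>C. \<forall>p. \<bar>p\<bar> \<le> K \<longrightarrow> \<bar>Hm \<alpha> p\<bar> \<le> C \<and> \<bar>Hp \<alpha> p\<bar> \<le> C" for \<alpha>
  proof -
    have "bounded (Hm \<alpha> ` {-K..K})" "bounded (Hp \<alpha> ` {-K..K})"
      by (intro compact_imp_bounded compact_continuous_image continuous_hm continuous_hp; simp)+
    then obtain a b where "\<forall>p\<in>{-K..K}. \<bar>Hm \<alpha> p\<bar> \<le> a" "\<forall>p\<in>{-K..K}. \<bar>Hp \<alpha> p\<bar> \<le> b"
      unfolding bounded_iff by auto
    then show ?thesis by (intro exI[of _ "max a b"]) (auto simp: le_max_iff_disj abs_le_iff[of _ K])
  qed
  then obtain C where C: "0 \<le> C" "\<And>\<alpha>. \<forall>p. \<bar>p\<bar> \<le> K \<longrightarrow> \<bar>Hm \<alpha> p\<bar> \<le> C \<and> \<bar>Hp \<alpha> p\<bar> \<le> C"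
    by (rule finite_uniform_bound[where Q = "\<lambda>\<alpha> C. \<forall>p. \<bar>p\<bar> \<le> K \<longrightarrow> \<bar>Hm \<alpha> p\<bar> \<le> C \<and> \<bar>Hp \<alpha> p\<bar> \<le> C"])
      (auto intro: order_trans)
  have "\<exists>P. \<forall>p. H \<alpha> p \<le> C \<longrightarrow> \<bar>p\<bar> \<le> P" for \<alpha>
    using bounded_sublevel[of \<alpha> C] unfolding bounded_iff by auto
  then obtain P where P: "0 \<le> P" "\<And>\<alpha>. \<forall>p. H \<alpha> p \<le> C \<longrightarrow> \<bar>p\<bar> \<le> P"
    by (rule finite_uniform_bound[where Q = "\<lambda>\<alpha> P. \<forall>p. H \<alpha> p \<le> C \<longrightarrow> \<bar>p\<bar> \<le> P"]) (auto intro: order_trans)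
  show thesis
  proof (rule that[OF C(1) P(1)])
    fix dt dx :: real and U
    assume pos: "0 < dt" "0 < dx" and num: "numerical_solution e Hm Hp u0 dt dx U"
      and cfl: "CFL H Hm Hp dt dx U"
    interpret S: junction_scheme c H Hm Hp dt dx U
      using pos num split unfolding numerical_solution_def by unfold_locales blast+
    have slope0: "\<bar>slope_fwd dx U \<alpha> 0 i\<bar> \<le> K" for \<alpha> i
    proof -
      have "dist (U \<alpha> 0 (i + 1)) (U \<alpha> 0 i) \<le> K * dist (real (i + 1) * dx) (real i * dx)"
        using lipschitz_onD[OF K(2)[of \<alpha>], of "real (i + 1) * dx" "real i * dx"] num pos
        unfolding numerical_solution_def by simp
      then show ?thesis using pos by (simp add: slope_fwd_def dist_real_def field_simps)
    qed
    have slope0': "\<bar>slope_bwd dx U \<alpha> 0 i\<bar> \<le> K" if "1 \<le> i" for \<alpha> i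
      using slope0[of \<alpha> "i - 1"] that by (simp add: slope_fwd_def slope_bwd_def)
    have W0: "\<bar>time_slope dt U \<alpha> 0 i\<bar> \<le> C" for \<alpha> i
    proof (cases "i = 0")
      case True
      obtain \<beta> where "(MAX \<beta>. Hm \<beta> (slope_fwd dx U \<beta> 0 0)) = Hm \<beta> (slope_fwd dx U \<beta> 0 0)"
        using MAX_attained[of "\<lambda>\<beta>. Hm \<beta> (slope_fwd dx U \<beta> 0 0)"] by auto
      then show ?thesis using S.vertex_step[of \<alpha> 0] C(2)[rule_format, OF slope0[of \<beta> 0], of \<beta>] True
        by (simp add: add_eq_0_iff2)
    next
      case False
      then show ?thesis
        using S.interior_step[of i \<alpha> 0] C(2)[rule_format, OF slope0[of \<alpha> i], of \<alpha>] C(2)[rule_format, OF slope0'[of i \<alpha>], of \<alpha>]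
        by (auto simp: add_eq_0_iff2 max_def split: if_splits)
    qed
    have m0_le: "m0 dt U \<le> ereal (time_slope dt U \<alpha> 0 i)" for \<alpha> i
      unfolding m0_def by (meson INF_lower UNIV_I order_trans)
    have m0_ge: "ereal (- C) \<le> m0 dt U"
      unfolding m0_def using W0 by (intro INF_greatest) (simp add: abs_le_iff minus_le_iff)
    obtain m where m: "m0 dt U = ereal m"
      using m0_le[of undefined 0] m0_ge by (cases "m0 dt U") auto
    have m_le: "m \<le> time_slope dt U \<alpha> 0 i" for \<alpha> i using m0_le[of \<alpha> i] m by simp
    have level: "H \<alpha> (c \<alpha>) \<le> - m" for \<alpha>
      using S.step_fwd[of \<alpha> 0 0] m_le[of \<alpha> 0] min_le_hm[of \<alpha> "slope_fwd dx U \<alpha> 0 0"] by linarith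
    have "\<exists>l\<le>c \<alpha>. H \<alpha> l = - m \<and> (\<forall>p. Hm \<alpha> p \<le> - m \<longrightarrow> l \<le> p)" for \<alpha>
      by (rule sublevel_left_end[OF level[of \<alpha>]]) blast
    then obtain l where l: "\<And>\<alpha>. l \<alpha> \<le> c \<alpha>" "\<And>\<alpha>. H \<alpha> (l \<alpha>) = - m" "\<And>\<alpha> p. Hm \<alpha> p \<le> - m \<Longrightarrow> l \<alpha> \<le> p"
      by metis
    have "\<exists>r\<le>- c \<alpha>. H \<alpha> (- r) = - m \<and> (\<forall>p. Hp \<alpha> (- p) \<le> - m \<longrightarrow> r \<le> p)" for \<alpha>
      by (rule R.sublevel_left_end[of \<alpha> "- m"]) (use level[of \<alpha>] in auto)
    then obtain r' where r': "\<And>\<alpha>. r' \<alpha> \<le> - c \<alpha>" "\<And>\<alpha>. H \<alpha> (- r' \<alpha>) = - m"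
        "\<And>\<alpha> p. Hp \<alpha> (- p) \<le> - m \<Longrightarrow> r' \<alpha> \<le> p"
      by metis
    define r where "r \<alpha> = - r' \<alpha>" for \<alpha>
    have r: "c \<alpha> \<le> r \<alpha>" "H \<alpha> (r \<alpha>) = - m" "Hp \<alpha> p \<le> - m \<Longrightarrow> p \<le> r \<alpha>" for \<alpha> p
      using r'(1)[of \<alpha>] r'(2)[of \<alpha>] r'(3)[of \<alpha> "- p"] by (auto simp: r_def)
    have speed: "\<bar>deriv (H \<alpha>) p\<bar> \<le> dx / dt" if "l \<alpha> \<le> p" "p \<le> r \<alpha>" for \<alpha> p
    proof -
      \<comment> \<open>The CFL supremum runs between generalized inverses; since \<open>l\<close>
        and \<open>r\<close> attain the level \<open>- m\<close>, that interval contains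
        \<open>[l, r]\<close>.\<close>
      have "Hm \<alpha> (l \<alpha>) = - m" "Hp \<alpha> (r \<alpha>) = - m" using l r by (simp_all add: hm_eq hp_eq)
      then have "inv_minus (Hm \<alpha>) (- m0 dt U) \<le> ereal (l \<alpha>)" "ereal (r \<alpha>) \<le> inv_plus (Hp \<alpha>) (- m0 dt U)"
        unfolding inv_minus_def inv_plus_def m by (auto intro!: Inf_lower Sup_upper)
      then have "inv_minus (Hm \<alpha>) (- m0 dt U) \<le> ereal p" "ereal p \<le> inv_plus (Hp \<alpha>) (- m0 dt U)"
        using that by (meson ereal_less_eq(3) order_trans)+
      then have "ereal \<bar>deriv (H \<alpha>) p\<bar> \<le> ereal (dx / dt)"
        using cfl unfolding CFL_def SUP_le_iff by blast
      then show ?thesis by simp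
    qed
    interpret B: bounded_slope_scheme c H Hm Hp dt dx U l r
      by unfold_locales (use l r speed in auto)
    have est: "(\<forall>\<alpha> i. l \<alpha> \<le> slope_fwd dx U \<alpha> n i \<and> slope_fwd dx U \<alpha> n i \<le> r \<alpha>) \<and>
      (\<forall>\<alpha> i. m \<le> time_slope dt U \<alpha> n i \<and> time_slope dt U \<alpha> n i \<le> C)" for n
      by (rule B.gradient_estimate) (use l r m_le W0 in \<open>auto simp: abs_le_iff\<close>)
    have "- C \<le> m" using m0_ge m by simp
    then have "\<bar>time_slope dt U \<alpha> n i\<bar> \<le> C" for \<alpha> n i
    proof -
      have "m \<le> time_slope dt U \<alpha> n i" "time_slope dt U \<alpha> n i \<le> C" using est by auto
      then show ?thesis using \<open>- C \<le> m\<close> by linarith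
    qed
    moreover have "\<bar>slope_fwd dx U \<alpha> n i\<bar> \<le> P" for \<alpha> n i
      proof -
      have "\<bar>l \<alpha>\<bar> \<le> P" "\<bar>r \<alpha>\<bar> \<le> P" using P(2)[rule_format, of \<alpha>] l(2) r(2) \<open>- C \<le> m\<close> by simp_all
      moreover have "l \<alpha> \<le> slope_fwd dx U \<alpha> n i" "slope_fwd dx U \<alpha> n i \<le> r \<alpha>" using est by auto
      ultimately show ?thesis by linarith
    qed
    ultimately show "\<exists>l r. bounded_slope_scheme c H Hm Hp dt dx U l r \<and>
        (\<forall>\<alpha> n i. l \<alpha> \<le> slope_fwd dx U \<alpha> n i \<and> slope_fwd dx U \<alpha> n i \<le> r \<alpha> \<and>
          \<bar>slope_fwd dx U \<alpha> n i\<bar> \<le> P \<and> \<bar>time_slope dt U \<alpha> n i\<bar> \<le> C)"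
      using B.bounded_slope_scheme_axioms est by blast
  qed
qed


section \<open>Contact of cones with the grid functions\<close>

definition cone :: "real \<Rightarrow> real \<Rightarrow> real \<Rightarrow> real \<Rightarrow> real \<Rightarrow> real" where
  "cone a b \<eta> t x = a * t + b * x + \<eta> * (\<bar>t\<bar> + \<bar>x\<bar>)"

lemma cone_minus: "cone (- a) (- b) \<eta> t x = - cone a b (- \<eta>) t x"
  by (simp add: cone_def algebra_simps)

lemma cone_time_diff:
  assumes "0 \<le> s" shows "\<bar>cone a b \<eta> (t + s) x - cone a b \<eta> t x - a * s\<bar> \<le> \<bar>\<eta>\<bar> * s"
proof -
  have "\<bar>\<eta> * (\<bar>t + s\<bar> - \<bar>t\<bar>)\<bar> \<le> \<bar>\<eta>\<bar> * s"
    using assms unfolding abs_mult by (intro mult_left_mono) auto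
  then show ?thesis by (simp add: cone_def algebra_simps)
qed

lemma cone_space_diff:
  assumes "0 \<le> s" shows "\<bar>cone a b \<eta> t (x + s) - cone a b \<eta> t x - b * s\<bar> \<le> \<bar>\<eta>\<bar> * s"
proof -
  have "\<bar>\<eta> * (\<bar>x + s\<bar> - \<bar>x\<bar>)\<bar> \<le> \<bar>\<eta>\<bar> * s"
    using assms unfolding abs_mult by (intro mult_left_mono) auto
  then show ?thesis by (simp add: cone_def algebra_simps)
qed

lemma cone_separable: "cone a b \<eta> t x - cone a b \<eta> t y = cone a b \<eta> s x - cone a b \<eta> s y"
  by (simp add: cone_def algebra_simps)

lemma cone_upper: "cone a b \<eta> t x \<le> (\<bar>a\<bar> + \<bar>b\<bar> + \<bar>\<eta>\<bar>) * (\<bar>t\<bar> + \<bar>x\<bar>)"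
proof -
  have "a * t \<le> \<bar>a\<bar> * \<bar>t\<bar>" "b * x \<le> \<bar>b\<bar> * \<bar>x\<bar>" "\<eta> * (\<bar>t\<bar> + \<bar>x\<bar>) \<le> \<bar>\<eta>\<bar> * (\<bar>t\<bar> + \<bar>x\<bar>)"
    by (simp_all add: mult_right_mono abs_mult[symmetric])
  moreover have "0 \<le> \<bar>a\<bar> * \<bar>x\<bar>" "0 \<le> \<bar>b\<bar> * \<bar>t\<bar>" by simp_all
  ultimately show ?thesis unfolding cone_def distrib_left distrib_right by linarith
qed

lemma grid_floor:
  fixes t d :: real
  assumes "0 < d" "0 \<le> t"
  shows "real (nat \<lfloor>t / d\<rfloor>) * d \<le> t" "t < real (nat \<lfloor>t / d\<rfloor>) * d + d"
proof -
  have eq: "real (nat \<lfloor>t / d\<rfloor>) = of_int \<lfloor>t / d\<rfloor>" using assms by simp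
  show "real (nat \<lfloor>t / d\<rfloor>) * d \<le> t"
    using of_int_floor_le[of "t / d"] unfolding eq pos_le_divide_eq[OF assms(1)] .
  have "t / d < of_int \<lfloor>t / d\<rfloor> + 1" by linarith
  then show "t < real (nat \<lfloor>t / d\<rfloor>) * d + d"
    unfolding eq pos_divide_less_eq[OF assms(1)] distrib_right by simp
qed

lemma finite_grid:
  fixes d t :: real
  assumes "0 < d" shows "finite {n::nat. \<bar>real n * d - t\<bar> \<le> r}"
proof (rule finite_subset)
  show "{n::nat. \<bar>real n * d - t\<bar> \<le> r} \<subseteq> {..nat \<lceil>(t + r) / d\<rceil>}"
  proof clarsimp
    fix n :: nat assume "\<bar>real n * d - t\<bar> \<le> r"
    then have "real n * d \<le> t + r" by linarith
    then have "real n \<le> (t + r) / d" using assms by (simp add: pos_le_divide_eq)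
    then show "n \<le> nat \<lceil>(t + r) / d\<rceil>" by linarith
  qed
qed simp

text \<open>Doubling the opening of the cone makes the contact strict, which forces the maximum over the grid
  points of the neighbourhood to lie in its interior.\<close>

lemma discrete_contact:
  fixes V :: "real \<Rightarrow> real \<Rightarrow> 'n::finite \<Rightarrow> nat \<Rightarrow> nat \<Rightarrow> real"
  assumes small: "\<And>d. 0 < d \<Longrightarrow> \<forall>\<^sub>F (dt, dx) in G. 0 < dt \<and> dt < d \<and> 0 < dx \<and> dx < d"
    and conv: "\<And>R \<eta>. 0 < \<eta> \<Longrightarrow> \<forall>\<^sub>F (dt, dx) in G. \<forall>\<alpha> n i. real n * dt \<le> R \<longrightarrow> real i * dx \<le> R \<longrightarrow>
      \<bar>V dt dx \<alpha> n i - w \<alpha> (real n * dt) (real i * dx)\<bar> \<le> \<eta>"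
    and lip: "\<And>\<alpha> t s x y. 0 \<le> t \<Longrightarrow> 0 \<le> s \<Longrightarrow> 0 \<le> x \<Longrightarrow> 0 \<le> y \<Longrightarrow>
      \<bar>w \<alpha> t x - w \<alpha> s y\<bar> \<le> L * (\<bar>t - s\<bar> + \<bar>x - y\<bar>)"
    and A: "A \<noteq> {}" and \<eta>: "0 < \<eta>" and \<rho>: "0 < \<rho>" "\<rho> < t0" and x0: "0 \<le> x0"
    and w0: "\<And>\<alpha>. \<alpha> \<in> A \<Longrightarrow> w \<alpha> t0 x0 = w0"
    and touch: "\<And>\<alpha> t x. \<alpha> \<in> A \<Longrightarrow> \<bar>t - t0\<bar> \<le> \<rho> \<Longrightarrow> 0 \<le> x \<Longrightarrow> \<bar>x - x0\<bar> \<le> \<rho> \<Longrightarrow>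
      w \<alpha> t x \<le> w0 + cone a (b \<alpha>) \<eta> (t - t0) (x - x0)"
  shows "\<forall>\<^sub>F (dt, dx) in G. \<exists>\<alpha>\<in>A. \<exists>n i k.
    \<bar>real (n + 1) * dt - t0\<bar> \<le> \<rho> \<and> \<bar>real n * dt - t0\<bar> \<le> \<rho> \<and> \<bar>real i * dx - x0\<bar> + dx \<le> \<rho> \<and>
    V dt dx \<alpha> (n + 1) i = cone a (b \<alpha>) (2 * \<eta>) (real (n + 1) * dt - t0) (real i * dx - x0) + k \<and>
    (\<forall>\<beta>\<in>A. \<forall>m j. \<bar>real m * dt - t0\<bar> \<le> \<rho> \<longrightarrow> \<bar>real j * dx - x0\<bar> \<le> \<rho> \<longrightarrow>
      V dt dx \<beta> m j \<le> cone a (b \<beta>) (2 * \<eta>) (real m * dt - t0) (real j * dx - x0) + k)"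
proof -
  \<comment> \<open>The error budget is \<open>4 * \<kappa>\<close>: convergence, Lipschitz bound
    and cone at the grid point next to \<open>(t0, x0)\<close>, and convergence at the maximum. The
    wider cone exceeds the original one by \<open>\<eta>\<close> times the distance, so the budget
    \<open>\<eta> * \<rho> / 2\<close> confines the maximum to distance
    \<open>\<rho> / 2\<close>.\<close>
  define \<kappa> where "\<kappa> = \<eta> * \<rho> / 8"
  have \<kappa>: "0 < \<kappa>" using \<eta> \<rho> by (simp add: \<kappa>_def)
  obtain \<alpha>0 where \<alpha>0: "\<alpha>0 \<in> A" using A by auto
  define M where "M = \<bar>L\<bar> + \<bar>a\<bar> + \<bar>b \<alpha>0\<bar> + 2 * \<eta> + 1"
  have M: "1 \<le> M" "L \<le> M" "\<bar>a\<bar> + \<bar>b \<alpha>0\<bar> + \<bar>2 * \<eta>\<bar> \<le> M" using \<eta> by (simp_all add: M_def)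
  \<comment> \<open>The first bound makes rounding \<open>(t0, x0)\<close> to the grid cost at most
    \<open>\<kappa>\<close>, both for \<open>w\<close> and for the cone; the second leaves room for
    the grid neighbours of the maximum.\<close>
  define d where "d = min (\<kappa> / (2 * M)) (\<rho> / 2)"
  have d: "0 < d" "2 * (M * d) \<le> \<kappa>" "d \<le> \<rho> / 2"
    using \<kappa> M \<rho> by (auto simp: d_def min_def field_simps)
  show ?thesis
    using small[OF d(1)] conv[OF \<kappa>, of "t0 + x0 + \<rho>"]
  proof (eventually_elim, clarify)
    fix dt dx
    assume dt: "0 < dt" "dt < d" and dx: "0 < dx" "dx < d"
      and V: "\<forall>\<alpha> n i. real n * dt \<le> t0 + x0 + \<rho> \<longrightarrow> real i * dx \<le> t0 + x0 + \<rho> \<longrightarrow>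
          \<bar>V dt dx \<alpha> n i - w \<alpha> (real n * dt) (real i * dx)\<bar> \<le> \<kappa>"
    define \<psi> where "\<psi> \<alpha> n i = cone a (b \<alpha>) (2 * \<eta>) (real n * dt - t0) (real i * dx - x0)" for \<alpha> and n i :: nat
    define N where "N = A \<times> {n. \<bar>real n * dt - t0\<bar> \<le> \<rho>} \<times> {i. \<bar>real i * dx - x0\<bar> \<le> \<rho>}"
    have V': "\<bar>V dt dx \<alpha> n i - w \<alpha> (real n * dt) (real i * dx)\<bar> \<le> \<kappa>" if "(\<alpha>, n, i) \<in> N" for \<alpha> n i
    proof -
      have "real n * dt \<le> t0 + \<rho>" "real i * dx \<le> x0 + \<rho>" using that by (auto simp: N_def)
      then show ?thesis using V x0 \<rho> by simp
    qed
    define n0 i0 where "n0 = nat \<lfloor>t0 / dt\<rfloor>" and "i0 = nat \<lfloor>x0 / dx\<rfloor>"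
    have near: "\<bar>real n0 * dt - t0\<bar> \<le> d" "\<bar>real i0 * dx - x0\<bar> \<le> d"
      using grid_floor[of dt t0] grid_floor[of dx x0] dt dx \<rho> x0 unfolding n0_def i0_def by linarith+
    then have N0: "(\<alpha>0, n0, i0) \<in> N" using \<alpha>0 d \<rho> by (auto simp: N_def)
    have "finite N" unfolding N_def using finite_grid dt dx by (intro finite_cartesian_product) auto
    moreover define f where "f = (\<lambda>(\<alpha>, n, i). V dt dx \<alpha> n i - \<psi> \<alpha> n i)"
    ultimately obtain z where z: "z \<in> N" "Max (f ` N) = f z"
      using N0 obtains_MAX[of N f] by blast
    obtain \<alpha> m i where z_eq: "z = (\<alpha>, m, i)" by (cases z) auto
    define k where "k = V dt dx \<alpha> m i - \<psi> \<alpha> m i"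
    have max: "V dt dx \<beta> n j \<le> \<psi> \<beta> n j + k" if "(\<beta>, n, j) \<in> N" for \<beta> n j
    proof -
      have "f (\<beta>, n, j) \<le> f z" unfolding z(2)[symmetric] using that \<open>finite N\<close> by (intro Max_ge) auto
      then show ?thesis by (simp add: f_def z_eq k_def)
    qed
    have k_ge: "w0 - 3 * \<kappa> \<le> k"
    proof -
      let ?d = "\<bar>real n0 * dt - t0\<bar> + \<bar>real i0 * dx - x0\<bar>"
      have d2: "M * ?d \<le> \<kappa>"
      proof -
        have "M * ?d \<le> M * (2 * d)" using near M by (intro mult_left_mono) auto
        then show ?thesis using d by simp
      qed
      have "w0 - L * ?d \<le> w \<alpha>0 (real n0 * dt) (real i0 * dx)"
        using lip[of "real n0 * dt" t0 "real i0 * dx" x0 \<alpha>0] w0[OF \<alpha>0] dt dx \<rho> x0 by simp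
      moreover have "L * ?d \<le> M * ?d" using M by (intro mult_right_mono) auto
      moreover have "\<psi> \<alpha>0 n0 i0 \<le> M * ?d"
        unfolding \<psi>_def by (rule order_trans[OF cone_upper]) (use M in \<open>intro mult_right_mono; simp\<close>)
      ultimately show ?thesis using max[OF N0] V'[OF N0] d2 by linarith
    qed
    have \<alpha>: "\<alpha> \<in> A" using z(1) by (simp add: z_eq N_def)
    let ?d = "\<bar>real m * dt - t0\<bar> + \<bar>real i * dx - x0\<bar>"
    have "w \<alpha> (real m * dt) (real i * dx) \<le> w0 + cone a (b \<alpha>) \<eta> (real m * dt - t0) (real i * dx - x0)"
      using z(1) dx by (intro touch) (auto simp: z_eq N_def)
    moreover have "\<psi> \<alpha> m i = cone a (b \<alpha>) \<eta> (real m * dt - t0) (real i * dx - x0) + \<eta> * ?d"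
      by (simp add: \<psi>_def cone_def algebra_simps)
    ultimately have "\<eta> * ?d \<le> 4 * \<kappa>"
      using V'[of \<alpha> m i] z(1) k_ge by (simp add: z_eq k_def)
    then have near': "?d \<le> \<rho> / 2" using \<eta> by (simp add: \<kappa>_def)
    \<comment> \<open>As \<open>\<rho> < t0\<close>, the initial time is out of reach, so the
      maximum lies on a level produced by a step of the scheme.\<close>
    have "m \<noteq> 0" using near' \<rho> abs_ge_zero[of "real i * dx - x0"] by (intro notI) (auto simp del: abs_ge_zero)
    then obtain n where m: "m = n + 1" by (cases m) auto
    have "\<bar>real n * dt - t0\<bar> \<le> \<bar>real m * dt - t0\<bar> + dt" using dt by (simp add: m algebra_simps)
    then have "\<bar>real n * dt - t0\<bar> \<le> \<rho>" using near' dt d by linarith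
    moreover have "\<bar>real i * dx - x0\<bar> + dx \<le> \<rho>" "\<bar>real (n + 1) * dt - t0\<bar> \<le> \<rho>"
      using near' dx d \<rho> unfolding m by linarith+
    moreover have "V dt dx \<alpha> (n + 1) i = \<psi> \<alpha> (n + 1) i + k" by (simp add: k_def m)
    moreover have "V dt dx \<beta> n j \<le> \<psi> \<beta> n j + k"
      if "\<beta> \<in> A" "\<bar>real n * dt - t0\<bar> \<le> \<rho>" "\<bar>real j * dx - x0\<bar> \<le> \<rho>" for \<beta> n j
      using that by (intro max) (simp add: N_def)
    ultimately show "\<exists>\<alpha>\<in>A. \<exists>n i k.
      \<bar>real (n + 1) * dt - t0\<bar> \<le> \<rho> \<and> \<bar>real n * dt - t0\<bar> \<le> \<rho> \<and> \<bar>real i * dx - x0\<bar> + dx \<le> \<rho> \<and>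
      V dt dx \<alpha> (n + 1) i = cone a (b \<alpha>) (2 * \<eta>) (real (n + 1) * dt - t0) (real i * dx - x0) + k \<and>
      (\<forall>\<beta>\<in>A. \<forall>m j. \<bar>real m * dt - t0\<bar> \<le> \<rho> \<longrightarrow> \<bar>real j * dx - x0\<bar> \<le> \<rho> \<longrightarrow>
        V dt dx \<beta> m j \<le> cone a (b \<beta>) (2 * \<eta>) (real m * dt - t0) (real j * dx - x0) + k)"
      using \<alpha> unfolding \<psi>_def by blast
  qed
qed


section \<open>Viscosity inequalities for the limit\<close>

text \<open>The first-order superdifferential relative to \<open>x \<ge> 0\<close>, one-sided at
  \<open>x0 = 0\<close>, with the little-o remainder expressed by cones of arbitrarily small
  opening.\<close>

definition superjet_on_halfline :: "(real \<Rightarrow> real \<Rightarrow> real) \<Rightarrow> real \<Rightarrow> real \<Rightarrow> real \<Rightarrow> real \<Rightarrow> bool" where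
  "superjet_on_halfline f t0 x0 a b \<longleftrightarrow> (\<forall>\<eta>>0. \<exists>\<rho>>0. \<forall>t x. \<bar>t - t0\<bar> \<le> \<rho> \<longrightarrow> 0 \<le> x \<longrightarrow> \<bar>x - x0\<bar> \<le> \<rho> \<longrightarrow>
     f t x \<le> f t0 x0 + cone a b \<eta> (t - t0) (x - x0))"

lemma superjet_radius:
  fixes f :: "'n::finite \<Rightarrow> real \<Rightarrow> real \<Rightarrow> real"
  assumes "\<And>\<alpha>. \<alpha> \<in> A \<Longrightarrow> superjet_on_halfline (f \<alpha>) t0 x0 a (b \<alpha>)" and "0 < \<eta>" "0 < d"
  obtains \<rho> where "0 < \<rho>" "\<rho> < d"
    "\<And>\<alpha> t x. \<alpha> \<in> A \<Longrightarrow> \<bar>t - t0\<bar> \<le> \<rho> \<Longrightarrow> 0 \<le> x \<Longrightarrow> \<bar>x - x0\<bar> \<le> \<rho> \<Longrightarrow>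
      f \<alpha> t x \<le> f \<alpha> t0 x0 + cone a (b \<alpha>) \<eta> (t - t0) (x - x0)"
proof -
  have "\<forall>\<alpha>\<in>A. \<exists>\<rho>>0. \<forall>t x. \<bar>t - t0\<bar> \<le> \<rho> \<longrightarrow> 0 \<le> x \<longrightarrow> \<bar>x - x0\<bar> \<le> \<rho> \<longrightarrow>
      f \<alpha> t x \<le> f \<alpha> t0 x0 + cone a (b \<alpha>) \<eta> (t - t0) (x - x0)"
    using assms unfolding superjet_on_halfline_def by blast
  then obtain r where r: "\<And>\<alpha>. \<alpha> \<in> A \<Longrightarrow> 0 < r \<alpha>"
    "\<And>\<alpha> t x. \<alpha> \<in> A \<Longrightarrow> \<bar>t - t0\<bar> \<le> r \<alpha> \<Longrightarrow> 0 \<le> x \<Longrightarrow> \<bar>x - x0\<bar> \<le> r \<alpha> \<Longrightarrow>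
      f \<alpha> t x \<le> f \<alpha> t0 x0 + cone a (b \<alpha>) \<eta> (t - t0) (x - x0)"
    by metis
  define \<rho> where "\<rho> = Min (insert (d / 2) (r ` A))"
  show thesis
  proof (rule that)
    show "0 < \<rho>" unfolding \<rho>_def using r(1) \<open>0 < d\<close> by (subst Min_gr_iff) auto
    have "\<rho> \<le> d / 2" unfolding \<rho>_def by (intro Min_le) auto
    then show "\<rho> < d" using \<open>0 < d\<close> by simp
    show "f \<alpha> t x \<le> f \<alpha> t0 x0 + cone a (b \<alpha>) \<eta> (t - t0) (x - x0)"
      if "\<alpha> \<in> A" "\<bar>t - t0\<bar> \<le> \<rho>" "0 \<le> x" "\<bar>x - x0\<bar> \<le> \<rho>" for \<alpha> t x
    proof -
      have "\<rho> \<le> r \<alpha>" unfolding \<rho>_def using that by (intro Min_le) auto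
      then show ?thesis using that by (intro r(2)) auto
    qed
  qed
qed

lemma limit_le_zero:
  fixes f :: "real \<Rightarrow> real"
  assumes "continuous_on UNIV f" and "\<And>\<eta>. 0 < \<eta> \<Longrightarrow> f \<eta> \<le> 0"
  shows "f 0 \<le> 0"
proof (rule tendsto_upperbound)
  show "(f \<longlongrightarrow> f 0) (at_right 0)"
    using assms(1) by (simp add: continuous_on_eq_continuous_within continuous_within filterlim_at_split)
  show "\<forall>\<^sub>F \<eta> in at_right 0. f \<eta> \<le> 0"
    using assms(2) by (auto simp: eventually_at_filter)
qed simp

locale scheme_limit =
  fixes G :: "(real \<times> real) filter" and c :: "'n::finite \<Rightarrow> real" and H Hm Hp :: "'n \<Rightarrow> real \<Rightarrow> real"
    and U :: "real \<Rightarrow> real \<Rightarrow> 'n \<Rightarrow> nat \<Rightarrow> nat \<Rightarrow> real" and w :: "'n \<Rightarrow> real \<Rightarrow> real \<Rightarrow> real" and L :: real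
  assumes G: "G \<noteq> bot"
    and small: "\<And>d. 0 < d \<Longrightarrow> \<forall>\<^sub>F (dt, dx) in G. 0 < dt \<and> dt < d \<and> 0 < dx \<and> dx < d"
    and conv: "\<And>R \<eta>. 0 < \<eta> \<Longrightarrow> \<forall>\<^sub>F (dt, dx) in G. \<forall>\<alpha> n i. real n * dt \<le> R \<longrightarrow> real i * dx \<le> R \<longrightarrow>
      \<bar>U dt dx \<alpha> n i - w \<alpha> (real n * dt) (real i * dx)\<bar> \<le> \<eta>"
    and lip: "\<And>\<alpha> t s x y. 0 \<le> t \<Longrightarrow> 0 \<le> s \<Longrightarrow> 0 \<le> x \<Longrightarrow> 0 \<le> y \<Longrightarrow>
      \<bar>w \<alpha> t x - w \<alpha> s y\<bar> \<le> L * (\<bar>t - s\<bar> + \<bar>x - y\<bar>)"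
    and split: "\<And>\<alpha>. split_hamiltonian (c \<alpha>) (H \<alpha>) (Hm \<alpha>) (Hp \<alpha>)"
    and scheme: "\<forall>\<^sub>F (dt, dx) in G. \<exists>l r. bounded_slope_scheme c H Hm Hp dt dx (U dt dx) l r \<and>
      (\<forall>\<alpha> n i. l \<alpha> \<le> slope_fwd dx (U dt dx) \<alpha> n i \<and> slope_fwd dx (U dt dx) \<alpha> n i \<le> r \<alpha>)"
    and w_vertex: "w \<alpha> t 0 = w \<beta> t 0"
begin

sublocale split_hamiltonian "c \<alpha>" "H \<alpha>" "Hm \<alpha>" "Hp \<alpha>" for \<alpha>
  by (rule split)

text \<open>The sign \<open>s\<close> covers contact from above and, through \<open>- w\<close>,
  from below. With \<open>A\<close> the set of all branches, the grid points of the whole junction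
  compete for one maximum. The radius \<open>d\<close> can be chosen to keep the contact away from
  the vertex.\<close>

lemma contact:
  assumes s: "\<bar>s\<bar> = 1" and jet: "\<And>\<alpha>. \<alpha> \<in> A \<Longrightarrow> superjet_on_halfline (\<lambda>t x. s * w \<alpha> t x) t0 x0 a (b \<alpha>)"
    and A: "A \<noteq> {}" and \<eta>: "0 < \<eta>" and pos: "0 < t0" "0 \<le> x0" "0 < d"
    and w0: "\<And>\<alpha> \<beta>. \<alpha> \<in> A \<Longrightarrow> \<beta> \<in> A \<Longrightarrow> w \<alpha> t0 x0 = w \<beta> t0 x0"
  obtains dt dx l r \<alpha> n i k \<psi> where "bounded_slope_scheme c H Hm Hp dt dx (U dt dx) l r"
    "\<And>\<alpha> n i. l \<alpha> \<le> slope_fwd dx (U dt dx) \<alpha> n i \<and> slope_fwd dx (U dt dx) \<alpha> n i \<le> r \<alpha>"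
    "\<psi> = (\<lambda>\<alpha> n i. cone a (b \<alpha>) (2 * \<eta>) (real n * dt - t0) (real i * dx - x0))"
    "\<alpha> \<in> A" "\<bar>real i * dx - x0\<bar> < d" "s * U dt dx \<alpha> (n + 1) i = \<psi> \<alpha> (n + 1) i + k"
    "\<And>\<beta> m j. \<beta> \<in> A \<Longrightarrow> m = n \<or> m = n + 1 \<Longrightarrow> \<bar>real j * dx - real i * dx\<bar> \<le> dx \<Longrightarrow> s * U dt dx \<beta> m j \<le> \<psi> \<beta> m j + k"
proof -
  obtain \<rho> where \<rho>: "0 < \<rho>" "\<rho> < min t0 d"
    "\<And>\<alpha> t x. \<alpha> \<in> A \<Longrightarrow> \<bar>t - t0\<bar> \<le> \<rho> \<Longrightarrow> 0 \<le> x \<Longrightarrow> \<bar>x - x0\<bar> \<le> \<rho> \<Longrightarrow>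
      s * w \<alpha> t x \<le> s * w \<alpha> t0 x0 + cone a (b \<alpha>) \<eta> (t - t0) (x - x0)"
    by (rule superjet_radius[of A "\<lambda>\<alpha> t x. s * w \<alpha> t x" t0 x0 a b \<eta> "min t0 d"]) (use jet \<eta> pos in auto)
  have \<rho>_less: "\<rho> < t0" "\<rho> < d" using \<rho>(2) by simp_all
  obtain \<alpha>0 where \<alpha>0: "\<alpha>0 \<in> A" using A by auto
  have scale: "\<bar>s * p - s * q\<bar> = \<bar>p - q\<bar>" for p q
    using s by (simp flip: right_diff_distrib add: abs_mult)
  have "\<forall>\<^sub>F (dt, dx) in G. \<exists>\<alpha>\<in>A. \<exists>n i k.
    \<bar>real (n + 1) * dt - t0\<bar> \<le> \<rho> \<and> \<bar>real n * dt - t0\<bar> \<le> \<rho> \<and> \<bar>real i * dx - x0\<bar> + dx \<le> \<rho> \<and>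
    s * U dt dx \<alpha> (n + 1) i = cone a (b \<alpha>) (2 * \<eta>) (real (n + 1) * dt - t0) (real i * dx - x0) + k \<and>
    (\<forall>\<beta>\<in>A. \<forall>m j. \<bar>real m * dt - t0\<bar> \<le> \<rho> \<longrightarrow> \<bar>real j * dx - x0\<bar> \<le> \<rho> \<longrightarrow>
      s * U dt dx \<beta> m j \<le> cone a (b \<beta>) (2 * \<eta>) (real m * dt - t0) (real j * dx - x0) + k)"
  proof (rule discrete_contact[OF small _ _ A \<eta> \<rho>(1) \<rho>_less(1) pos(2)])
    show "\<forall>\<^sub>F (dt, dx) in G. \<forall>\<alpha> n i. real n * dt \<le> R \<longrightarrow> real i * dx \<le> R \<longrightarrow>
      \<bar>s * U dt dx \<alpha> n i - s * w \<alpha> (real n * dt) (real i * dx)\<bar> \<le> \<epsilon>" if "0 < \<epsilon>" for R \<epsilon>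
      unfolding scale by (rule conv[OF that])
    show "\<bar>s * w \<alpha> t x - s * w \<alpha> t' y\<bar> \<le> L * (\<bar>t - t'\<bar> + \<bar>x - y\<bar>)"
      if "0 \<le> t" "0 \<le> t'" "0 \<le> x" "0 \<le> y" for \<alpha> t t' x y
      unfolding scale by (rule lip[OF that])
    show w0': "s * w \<alpha> t0 x0 = s * w \<alpha>0 t0 x0" if "\<alpha> \<in> A" for \<alpha>
      using w0[OF that \<alpha>0] by simp
    show "s * w \<alpha> t x \<le> s * w \<alpha>0 t0 x0 + cone a (b \<alpha>) \<eta> (t - t0) (x - x0)"
      if "\<alpha> \<in> A" "\<bar>t - t0\<bar> \<le> \<rho>" "0 \<le> x" "\<bar>x - x0\<bar> \<le> \<rho>" for \<alpha> t x
      using \<rho>(3)[OF that] w0'[OF that(1)] by simp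
  qed
  from eventually_happens'[OF G eventually_conj[OF scheme this]]
  obtain dt dx l r \<alpha> n i k where S: "bounded_slope_scheme c H Hm Hp dt dx (U dt dx) l r"
    and slopes: "\<And>\<alpha> n i. l \<alpha> \<le> slope_fwd dx (U dt dx) \<alpha> n i \<and> slope_fwd dx (U dt dx) \<alpha> n i \<le> r \<alpha>"
    and \<alpha>: "\<alpha> \<in> A" and near: "\<bar>real (n + 1) * dt - t0\<bar> \<le> \<rho>" "\<bar>real n * dt - t0\<bar> \<le> \<rho>"
      "\<bar>real i * dx - x0\<bar> + dx \<le> \<rho>"
    and contact: "s * U dt dx \<alpha> (n + 1) i = cone a (b \<alpha>) (2 * \<eta>) (real (n + 1) * dt - t0) (real i * dx - x0) + k"
    and le: "\<forall>\<beta>\<in>A. \<forall>m j. \<bar>real m * dt - t0\<bar> \<le> \<rho> \<longrightarrow> \<bar>real j * dx - x0\<bar> \<le> \<rho> \<longrightarrow>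
      s * U dt dx \<beta> m j \<le> cone a (b \<beta>) (2 * \<eta>) (real m * dt - t0) (real j * dx - x0) + k"
    unfolding split_paired_Ex prod.case by blast
  interpret S: bounded_slope_scheme c H Hm Hp dt dx "U dt dx" l r by (rule S)
  show thesis
  proof (rule that[OF S slopes refl \<alpha> _ contact])
    show "\<bar>real i * dx - x0\<bar> < d" using near \<rho>_less S.pos by linarith
    fix \<beta> m j assume \<beta>: "\<beta> \<in> A" and m: "m = n \<or> m = n + 1" and j: "\<bar>real j * dx - real i * dx\<bar> \<le> dx"
    have "\<bar>real m * dt - t0\<bar> \<le> \<rho>" using near m by auto
    moreover have "\<bar>real j * dx - x0\<bar> \<le> \<rho>" using near j by linarith
    ultimately show "s * U dt dx \<beta> m j \<le> cone a (b \<beta>) (2 * \<eta>) (real m * dt - t0) (real j * dx - x0) + k"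
      using le \<beta> by blast
  qed
qed

lemma cone_grid_bounds:
  assumes "0 < dt" "0 < dx" and \<psi>: "\<psi> = (\<lambda>n i. cone a b \<eta> (real n * dt - t0) (real i * dx - x0))"
  shows "\<bar>(\<psi> (n + 1) i - \<psi> n i) / dt - a\<bar> \<le> \<bar>\<eta>\<bar>" "\<bar>(\<psi> n (i + 1) - \<psi> n i) / dx - b\<bar> \<le> \<bar>\<eta>\<bar>"
    "\<psi> n i - \<psi> n j = \<psi> m i - \<psi> m j"
proof -
  have "\<bar>\<psi> (n + 1) i - \<psi> n i - a * dt\<bar> \<le> \<bar>\<eta>\<bar> * dt" "\<bar>\<psi> n (i + 1) - \<psi> n i - b * dx\<bar> \<le> \<bar>\<eta>\<bar> * dx"
    using cone_time_diff[of dt a b \<eta> "real n * dt - t0" "real i * dx - x0"]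
      cone_space_diff[of dx a b \<eta> "real n * dt - t0" "real i * dx - x0"] assms(1,2)
    by (simp_all add: \<psi> algebra_simps)
  moreover have "\<psi> (n + 1) i - \<psi> n i - a * dt = ((\<psi> (n + 1) i - \<psi> n i) / dt - a) * dt"
     "\<psi> n (i + 1) - \<psi> n i - b * dx = ((\<psi> n (i + 1) - \<psi> n i) / dx - b) * dx"
    using assms(1,2) by (simp_all add: field_simps)
  ultimately show "\<bar>(\<psi> (n + 1) i - \<psi> n i) / dt - a\<bar> \<le> \<bar>\<eta>\<bar>" "\<bar>(\<psi> n (i + 1) - \<psi> n i) / dx - b\<bar> \<le> \<bar>\<eta>\<bar>"
    using assms(1,2) by (simp_all only: abs_mult abs_of_pos mult_le_cancel_right_pos)
  show "\<psi> n i - \<psi> n j = \<psi> m i - \<psi> m j"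
    unfolding \<psi> by (rule cone_separable)
qed

text \<open>Subsolutions can be treated on one branch at a time, because the inequality
  \<open>W + Hm p\<^sub>+ \<le> 0\<close> holds at the vertex as well. As the cone is a sum of a function of \<open>t\<close> and one of \<open>x\<close>, its
  space slope at the contact point is the same at both time levels; at the upper one it is at least
  the slope of the scheme, hence above \<open>l\<close>, where the truncated flux agrees with \<open>Hm\<close>.\<close>

lemma subsolution_fwd:
  assumes jet: "superjet_on_halfline (w \<alpha>) t0 x0 a b" and pos: "0 < t0" "0 \<le> x0"
  shows "a + Hm \<alpha> b \<le> 0"
proof -
  have *: "a - 2 * \<eta> + Hm \<alpha> (b + 2 * \<eta>) \<le> 0" if \<eta>: "0 < \<eta>" for \<eta>
  proof -
    obtain dt dx l r \<beta> n i k \<Psi> where S: "bounded_slope_scheme c H Hm Hp dt dx (U dt dx) l r"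
      and slopes: "\<And>\<alpha> n i. l \<alpha> \<le> slope_fwd dx (U dt dx) \<alpha> n i \<and> slope_fwd dx (U dt dx) \<alpha> n i \<le> r \<alpha>"
      and \<Psi>: "\<Psi> = (\<lambda>\<alpha>::'n. \<lambda>n i. cone a b (2 * \<eta>) (real n * dt - t0) (real i * dx - x0))"
      and \<beta>: "\<beta> \<in> {\<alpha>}" and contact: "1 * U dt dx \<beta> (n + 1) i = \<Psi> \<beta> (n + 1) i + k"
      and le: "\<And>\<beta> m j. \<beta> \<in> {\<alpha>} \<Longrightarrow> m = n \<or> m = n + 1 \<Longrightarrow> \<bar>real j * dx - real i * dx\<bar> \<le> dx \<Longrightarrow>
        1 * U dt dx \<beta> m j \<le> \<Psi> \<beta> m j + k"
      by (rule contact[of 1 "{\<alpha>}" t0 x0 a "\<lambda>_. b" \<eta> 1]) (use jet \<eta> pos in auto)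
    interpret S: bounded_slope_scheme c H Hm Hp dt dx "U dt dx" l r by (rule S)
    define V where "V = U dt dx \<alpha>"
    define \<psi> where "\<psi> = \<Psi> \<alpha>"
    note \<psi> = cone_grid_bounds[OF S.pos fun_cong[OF \<Psi>, of \<alpha>], folded \<psi>_def]
    have contact: "V (n + 1) i = \<psi> (n + 1) i + k" using contact \<beta> by (simp add: V_def \<psi>_def)
    have le: "V n i \<le> \<psi> n i + k" "V n (i + 1) \<le> \<psi> n (i + 1) + k" "V (n + 1) (i + 1) \<le> \<psi> (n + 1) (i + 1) + k"
      using le[of \<alpha> n i] le[of \<alpha> n "i + 1"] le[of \<alpha> "n + 1" "i + 1"] S.pos
      by (simp_all add: V_def \<psi>_def distrib_right)
    define \<sigma> where "\<sigma> = (\<psi> n (i + 1) - \<psi> n i) / dx"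
    have "V n i - dt * S.F 0 \<alpha> ((V n (i + 1) - V n i) / dx) \<le> \<psi> n i + k - dt * S.F 0 \<alpha> \<sigma>"
      unfolding \<sigma>_def by (rule S.F_step_mono) (use le S.pos in auto)
    moreover have "S.F 0 \<alpha> ((V n (i + 1) - V n i) / dx) = Hm \<alpha> (slope_fwd dx (U dt dx) \<alpha> n i)"
      using slopes[of \<alpha> n i] by (simp add: S.F_def extension_eq slope_fwd_def V_def)
    moreover have "V (n + 1) i \<le> V n i - dt * Hm \<alpha> (slope_fwd dx (U dt dx) \<alpha> n i)"
      using S.step_fwd[of \<alpha> n i] S.pos by (simp add: time_slope_def V_def field_simps)
    ultimately have "dt * ((\<psi> (n + 1) i - \<psi> n i) / dt + S.F 0 \<alpha> \<sigma>) \<le> 0"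
      using contact S.pos by (simp add: distrib_left)
    then have "(\<psi> (n + 1) i - \<psi> n i) / dt + S.F 0 \<alpha> \<sigma> \<le> 0"
      using S.pos by (simp add: mult_le_0_iff)
    moreover have "l \<alpha> \<le> \<sigma>"
    proof -
      have "slope_fwd dx (U dt dx) \<alpha> (n + 1) i \<le> (\<psi> (n + 1) (i + 1) - \<psi> (n + 1) i) / dx"
        using le contact S.pos by (simp add: slope_fwd_def V_def divide_right_mono)
      then show ?thesis
        using slopes[of \<alpha> "n + 1" i] \<psi>(3)[of n "i + 1" i "n + 1"] by (simp add: \<sigma>_def)
    qed
    then have "S.F 0 \<alpha> \<sigma> = Hm \<alpha> \<sigma>" by (simp add: S.F_def extension_eq)
    moreover have "Hm \<alpha> (b + 2 * \<eta>) \<le> Hm \<alpha> \<sigma>"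
      using \<psi>(2)[of n i] \<eta> by (intro hm_antimono) (simp add: \<sigma>_def abs_le_iff)
    ultimately show ?thesis using \<psi>(1)[of n i] \<eta> by (simp add: abs_le_iff)
  qed
  have "continuous_on UNIV (\<lambda>\<eta>. a - 2 * \<eta> + Hm \<alpha> (b + 2 * \<eta>))"
    by (intro continuous_intros continuous_on_compose2[OF continuous_hm[of UNIV \<alpha>]]) auto
  from limit_le_zero[OF this *] show ?thesis by simp
qed

text \<open>Mirror image of the forward case: the slope towards the left neighbour has to stay below
  \<open>r\<close>, where the truncated backward flux agrees with \<open>Hp\<close>. The vertex has
  no left neighbour, so the contact radius is taken to be \<open>x0\<close>, which forces a positive
  index.\<close>

lemma subsolution_bwd:
  assumes jet: "superjet_on_halfline (w \<alpha>) t0 x0 a b" and pos: "0 < t0" "0 < x0"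
  shows "a + Hp \<alpha> b \<le> 0"
proof -
  have *: "a - 2 * \<eta> + Hp \<alpha> (b - 2 * \<eta>) \<le> 0" if \<eta>: "0 < \<eta>" for \<eta>
  proof -
    obtain dt dx l r \<beta> n i k \<Psi> where S: "bounded_slope_scheme c H Hm Hp dt dx (U dt dx) l r"
      and slopes: "\<And>\<alpha> n i. l \<alpha> \<le> slope_fwd dx (U dt dx) \<alpha> n i \<and> slope_fwd dx (U dt dx) \<alpha> n i \<le> r \<alpha>"
      and \<Psi>: "\<Psi> = (\<lambda>\<alpha>::'n. \<lambda>n i. cone a b (2 * \<eta>) (real n * dt - t0) (real i * dx - x0))"
      and \<beta>: "\<beta> \<in> {\<alpha>}" and near: "\<bar>real i * dx - x0\<bar> < x0"
      and contact: "1 * U dt dx \<beta> (n + 1) i = \<Psi> \<beta> (n + 1) i + k"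
      and le: "\<And>\<beta> m j. \<beta> \<in> {\<alpha>} \<Longrightarrow> m = n \<or> m = n + 1 \<Longrightarrow> \<bar>real j * dx - real i * dx\<bar> \<le> dx \<Longrightarrow>
        1 * U dt dx \<beta> m j \<le> \<Psi> \<beta> m j + k"
      by (rule contact[of 1 "{\<alpha>}" t0 x0 a "\<lambda>_. b" \<eta> x0]) (use jet \<eta> pos in auto)
    interpret S: bounded_slope_scheme c H Hm Hp dt dx "U dt dx" l r by (rule S)
    have "i \<noteq> 0" using near by (intro notI) simp
    then obtain j where i: "i = j + 1" by (cases i) auto
    define V where "V = U dt dx \<alpha>"
    define \<psi> where "\<psi> = \<Psi> \<alpha>"
    note \<psi> = cone_grid_bounds[OF S.pos fun_cong[OF \<Psi>, of \<alpha>], folded \<psi>_def]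
    have contact: "V (n + 1) i = \<psi> (n + 1) i + k" using contact \<beta> by (simp add: V_def \<psi>_def)
    have le: "V n i \<le> \<psi> n i + k" "V n j \<le> \<psi> n j + k" "V (n + 1) j \<le> \<psi> (n + 1) j + k"
      using le[of \<alpha> n i] le[of \<alpha> n j] le[of \<alpha> "n + 1" j] S.pos
      by (simp_all add: V_def \<psi>_def distrib_right i)
    define \<sigma> where "\<sigma> = (\<psi> n i - \<psi> n j) / dx"
    have \<sigma>: "(\<psi> n j - \<psi> n i) / dx = - \<sigma>" by (simp add: \<sigma>_def minus_divide_left)
    have bwd: "(V m j - V m i) / dx = - slope_bwd dx (U dt dx) \<alpha> m i" for m
      by (simp add: slope_bwd_def V_def i minus_divide_left)
    have slopes: "slope_bwd dx (U dt dx) \<alpha> m i \<le> r \<alpha>" for m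
      using slopes[of \<alpha> m j] by (simp add: i slope_fwd_def slope_bwd_def)
    have "V n i - dt * S.G 0 \<alpha> ((V n j - V n i) / dx) \<le> \<psi> n i + k - dt * S.G 0 \<alpha> ((\<psi> n j - \<psi> n i) / dx)"
      by (rule S.G_step_mono) (use le S.pos in auto)
    moreover have "S.G 0 \<alpha> ((V n j - V n i) / dx) = Hp \<alpha> (slope_bwd dx (U dt dx) \<alpha> n i)"
      unfolding bwd using slopes[of n] by (simp add: S.G_def extension_eq)
    moreover have "V (n + 1) i \<le> V n i - dt * Hp \<alpha> (slope_bwd dx (U dt dx) \<alpha> n i)"
      using S.step_bwd[of i \<alpha> n] S.pos i by (simp add: time_slope_def V_def field_simps)
    ultimately have "dt * ((\<psi> (n + 1) i - \<psi> n i) / dt + S.G 0 \<alpha> (- \<sigma>)) \<le> 0"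
      using contact S.pos by (simp add: distrib_left \<sigma>)
    then have "(\<psi> (n + 1) i - \<psi> n i) / dt + S.G 0 \<alpha> (- \<sigma>) \<le> 0"
      using S.pos by (simp add: mult_le_0_iff)
    moreover have "\<sigma> \<le> r \<alpha>"
    proof -
      have "(\<psi> (n + 1) i - \<psi> (n + 1) j) / dx \<le> slope_bwd dx (U dt dx) \<alpha> (n + 1) i"
        using le contact S.pos by (simp add: slope_bwd_def V_def i divide_right_mono)
      then show ?thesis
        using slopes[of "n + 1"] \<psi>(3)[of n i j "n + 1"] by (simp add: \<sigma>_def)
    qed
    then have "S.G 0 \<alpha> (- \<sigma>) = Hp \<alpha> \<sigma>" by (simp add: S.G_def extension_eq)
    moreover have "Hp \<alpha> (b - 2 * \<eta>) \<le> Hp \<alpha> \<sigma>"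
      using \<psi>(2)[of n j] \<eta> S.R.hm_antimono[of "- \<sigma>" "- (b - 2 * \<eta>)" \<alpha>] by (simp add: \<sigma>_def abs_le_iff i)
    ultimately show ?thesis using \<psi>(1)[of n i] \<eta> by (simp add: abs_le_iff)
  qed
  have "continuous_on UNIV (\<lambda>\<eta>. a - 2 * \<eta> + Hp \<alpha> (b - 2 * \<eta>))"
    by (intro continuous_intros continuous_on_compose2[OF continuous_hp[of UNIV \<alpha>]]) auto
  from limit_le_zero[OF this *] show ?thesis by simp
qed

text \<open>Here no lower bound on the slopes of the cone is needed: the truncated fluxes lie below \<open>Hm\<close> and
  \<open>Hp\<close>.\<close>

lemma supersolution:
  assumes jet: "\<And>\<alpha>. \<alpha> \<in> A \<Longrightarrow> superjet_on_halfline (\<lambda>t x. - w \<alpha> t x) t0 x0 (- a) (- b \<alpha>)"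
    and t0: "0 < t0" and A: "x0 = 0 \<and> A = UNIV \<or> 0 < x0 \<and> A = {\<alpha>0}"
  shows "\<exists>\<alpha>\<in>A. 0 \<le> a + H \<alpha> (b \<alpha>)"
proof (rule ccontr)
  \<comment> \<open>\<open>f \<alpha> \<eta>\<close> shifts all arguments by the opening of the cone
    in the direction that increases the operator; at \<open>\<eta> = 0\<close> it is
    \<open>a + H \<alpha> (b \<alpha>)\<close>. Arguing by contradiction makes one
    \<open>\<eta>\<close> serve all branches, although the branch of contact is not known in
    advance.\<close>
  define f where "f \<alpha> \<eta> = a + 2 * \<eta> + max (Hp \<alpha> (b \<alpha> + 2 * \<eta>)) (Hm \<alpha> (b \<alpha> - 2 * \<eta>))" for \<alpha> \<eta>
  assume "\<not> ?thesis"
  then have neg: "f \<alpha> 0 < 0" if "\<alpha> \<in> A" for \<alpha>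
    using that h_eq_max[of \<alpha> "b \<alpha>"] by (force simp: f_def not_le)
  have "\<forall>\<^sub>F \<eta> in at_right 0. f \<alpha> \<eta> < 0" if "\<alpha> \<in> A" for \<alpha>
  proof (rule order_tendstoD(2)[OF _ neg[OF that]])
    have "continuous_on UNIV (f \<alpha>)"
      unfolding f_def[abs_def]
      by (intro continuous_intros continuous_on_compose2[OF continuous_hm[of UNIV \<alpha>]]
          continuous_on_compose2[OF continuous_hp[of UNIV \<alpha>]]) auto
    then show "(f \<alpha> \<longlongrightarrow> f \<alpha> 0) (at_right 0)"
      by (simp add: continuous_on_eq_continuous_within continuous_within filterlim_at_split)
  qed
  then have "\<forall>\<^sub>F \<eta> in at_right 0. \<forall>\<alpha>\<in>A. f \<alpha> \<eta> < 0"
    by (intro eventually_ball_finite) auto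
  then have "\<forall>\<^sub>F \<eta> in at_right 0. (\<forall>\<alpha>\<in>A. f \<alpha> \<eta> < 0) \<and> (0::real) < \<eta>"
    by (intro eventually_conj) (auto simp: eventually_at_filter)
  then obtain \<eta> where f_neg: "\<And>\<alpha>. \<alpha> \<in> A \<Longrightarrow> f \<alpha> \<eta> < 0" and \<eta>: "0 < \<eta>"
    using eventually_happens'[OF trivial_limit_at_right_real] by force
  \<comment> \<open>For \<open>x0 > 0\<close> the radius \<open>x0\<close> excludes contact at index
    0. For \<open>x0 = 0\<close> any radius will do: contact may occur at the vertex or inside some
    branch, and both cases are treated.\<close>
  obtain dt dx l r \<alpha> n i k \<Psi> where S: "bounded_slope_scheme c H Hm Hp dt dx (U dt dx) l r"
    and slopes: "\<And>\<alpha> n i. l \<alpha> \<le> slope_fwd dx (U dt dx) \<alpha> n i \<and> slope_fwd dx (U dt dx) \<alpha> n i \<le> r \<alpha>"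
    and \<Psi>: "\<Psi> = (\<lambda>\<alpha> n i. cone (- a) (- b \<alpha>) (2 * \<eta>) (real n * dt - t0) (real i * dx - x0))"
    and \<alpha>: "\<alpha> \<in> A" and near: "\<bar>real i * dx - x0\<bar> < (if x0 = 0 then 1 else x0)"
    and contact: "- 1 * U dt dx \<alpha> (n + 1) i = \<Psi> \<alpha> (n + 1) i + k"
    and le: "\<And>\<beta> m j. \<beta> \<in> A \<Longrightarrow> m = n \<or> m = n + 1 \<Longrightarrow> \<bar>real j * dx - real i * dx\<bar> \<le> dx \<Longrightarrow>
      - 1 * U dt dx \<beta> m j \<le> \<Psi> \<beta> m j + k"
  proof (rule contact[of "- 1" A t0 x0 "- a" "\<lambda>\<alpha>. - b \<alpha>" \<eta> "if x0 = 0 then 1 else x0"])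
    show "w \<alpha> t0 x0 = w \<beta> t0 x0" if "\<alpha> \<in> A" "\<beta> \<in> A" for \<alpha> \<beta>
      using A that w_vertex[of \<alpha> t0 \<beta>] by auto
  qed (use jet \<eta> t0 A in auto)
  interpret S: bounded_slope_scheme c H Hm Hp dt dx "U dt dx" l r by (rule S)
  define \<psi> where "\<psi> \<alpha> n i = - \<Psi> \<alpha> n i" for \<alpha> n i
  have \<psi>_cone: "\<psi> \<alpha> = (\<lambda>n i. cone a (b \<alpha>) (- (2 * \<eta>)) (real n * dt - t0) (real i * dx - x0))" for \<alpha>
    by (simp add: \<psi>_def[abs_def] \<Psi> cone_minus)
  note \<psi> = cone_grid_bounds[OF S.pos \<psi>_cone]
  have contact: "U dt dx \<alpha> (n + 1) i = \<psi> \<alpha> (n + 1) i - k" using contact by (simp add: \<psi>_def)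
  have le: "\<psi> \<beta> n j \<le> U dt dx \<beta> n j + k" if "\<beta> \<in> A" "j = i \<or> j = i + 1 \<or> i = j + 1" for \<beta> j
  proof -
    have "\<bar>real j * dx - real i * dx\<bar> \<le> dx" using that(2) S.pos by (auto simp: distrib_right)
    then show ?thesis using le[of \<beta> n j] that by (simp add: \<psi>_def)
  qed
  have F_le: "S.F 0 \<beta> ((\<psi> \<beta> n (j + 1) - \<psi> \<beta> n j) / dx) \<le> Hm \<beta> (b \<beta> - 2 * \<eta>)" for \<beta> j
    unfolding S.F_def extension_def using \<psi>(2)[of \<beta> n j] \<eta>
    by (auto simp: abs_le_iff intro!: hm_antimono)
  have time: "(\<psi> \<alpha> (n + 1) i - \<psi> \<alpha> n i) / dt \<le> a + 2 * \<eta>"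
    using \<psi>(1)[of \<alpha> n i] \<eta> by (simp add: abs_le_iff)
  have "\<exists>\<beta>\<in>A. 0 \<le> f \<beta> \<eta>"
  proof (cases "i = 0")
    case False
    then obtain j where i: "i = j + 1" by (cases i) auto
    let ?G = "\<lambda>X. S.G 0 \<alpha> ((X n j - X n i) / dx)" and ?F = "\<lambda>X. S.F 0 \<alpha> ((X n (i + 1) - X n i) / dx)"
    have bwd: "(U dt dx \<alpha> n j - U dt dx \<alpha> n i) / dx = - slope_fwd dx (U dt dx) \<alpha> n j"
      by (simp add: slope_fwd_def i minus_divide_left)
    have "?G (U dt dx \<alpha>) = Hp \<alpha> (slope_bwd dx (U dt dx) \<alpha> n i)"
      "?F (U dt dx \<alpha>) = Hm \<alpha> (slope_fwd dx (U dt dx) \<alpha> n i)"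
      using slopes[of \<alpha> n j] slopes[of \<alpha> n i] unfolding bwd
      by (simp_all add: S.G_def S.F_def extension_eq slope_fwd_def slope_bwd_def i)
    then have "U dt dx \<alpha> (n + 1) i = U dt dx \<alpha> n i - dt * max (?G (U dt dx \<alpha>)) (?F (U dt dx \<alpha>))"
      using S.interior_step[of i \<alpha> n] S.pos i by (simp add: time_slope_def field_simps)
    moreover have "\<psi> \<alpha> n i - dt * max (?G (\<psi> \<alpha>)) (?F (\<psi> \<alpha>))
        \<le> U dt dx \<alpha> n i + k - dt * max (?G (U dt dx \<alpha>)) (?F (U dt dx \<alpha>))"
      by (rule S.interior_step_mono) (use le \<alpha> i S.pos in auto)
    ultimately have "0 \<le> dt * ((\<psi> \<alpha> (n + 1) i - \<psi> \<alpha> n i) / dt + max (?G (\<psi> \<alpha>)) (?F (\<psi> \<alpha>)))"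
      using contact S.pos by (simp add: distrib_left)
    then have "0 \<le> (\<psi> \<alpha> (n + 1) i - \<psi> \<alpha> n i) / dt + max (?G (\<psi> \<alpha>)) (?F (\<psi> \<alpha>))"
      using S.pos by (simp add: zero_le_mult_iff)
    moreover have "?G (\<psi> \<alpha>) \<le> Hp \<alpha> (b \<alpha> + 2 * \<eta>)"
    proof -
      have "(\<psi> \<alpha> n j - \<psi> \<alpha> n i) / dx = - ((\<psi> \<alpha> n (j + 1) - \<psi> \<alpha> n j) / dx)"
        by (simp add: i minus_divide_left)
      then have "- (b \<alpha> + 2 * \<eta>) \<le> (\<psi> \<alpha> n j - \<psi> \<alpha> n i) / dx"
        using \<psi>(2)[of \<alpha> n j] \<eta> by (simp add: abs_le_iff)
      then show ?thesis
        using S.R.hm_antimono[of "- (b \<alpha> + 2 * \<eta>)" "max ((\<psi> \<alpha> n j - \<psi> \<alpha> n i) / dx) (- r \<alpha>)" \<alpha>]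
        by (simp add: S.G_def extension_def le_max_iff_disj add.commute)
    qed
    ultimately have "0 \<le> f \<alpha> \<eta>"
      using F_le[of \<alpha> i] time unfolding f_def by linarith
    then show ?thesis using \<alpha> by blast
  next
    case True
    then have A: "A = UNIV" "x0 = 0" using A near by (auto split: if_splits)
    let ?F = "\<lambda>X \<beta>. S.F 0 \<beta> ((X \<beta> n 1 - X \<alpha> n 0) / dx)"
    have "?F (U dt dx) \<beta> = Hm \<beta> (slope_fwd dx (U dt dx) \<beta> n 0)" for \<beta>
      using slopes[of \<beta> n 0] S.vertex[of \<alpha> n \<beta>] by (simp add: S.F_def extension_eq slope_fwd_def)
    then have "U dt dx \<alpha> (n + 1) 0 = U dt dx \<alpha> n 0 - dt * (MAX \<beta>. ?F (U dt dx) \<beta>)"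
      using S.vertex_step[of \<alpha> n] S.pos by (simp add: time_slope_def field_simps)
    moreover have "\<psi> \<alpha> n 0 - dt * (MAX \<beta>. ?F \<psi> \<beta>) \<le> U dt dx \<alpha> n 0 + k - dt * (MAX \<beta>. ?F (U dt dx) \<beta>)"
      by (rule S.vertex_step_mono) (use le A True S.pos in auto)
    ultimately have "0 \<le> dt * ((\<psi> \<alpha> (n + 1) i - \<psi> \<alpha> n i) / dt + (MAX \<beta>. ?F \<psi> \<beta>))"
      using contact S.pos True by (simp add: distrib_left)
    then have "0 \<le> (\<psi> \<alpha> (n + 1) i - \<psi> \<alpha> n i) / dt + (MAX \<beta>. ?F \<psi> \<beta>)"
      using S.pos by (simp add: zero_le_mult_iff)
    moreover obtain \<beta> where "(MAX \<beta>. ?F \<psi> \<beta>) = ?F \<psi> \<beta>" using MAX_attained[of "?F \<psi>"] by auto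
    \<comment> \<open>The flux of \<open>\<beta>\<close> starts from the vertex value on
      \<open>\<alpha>\<close>, while \<open>F_le\<close> speaks of a slope along
      \<open>\<beta>\<close>. At \<open>x = 0\<close> the space slope does not enter the cone, so
      the two vertex values coincide.\<close>
    moreover have "\<psi> \<alpha> n 0 = \<psi> \<beta> n 0" by (simp add: \<psi>_cone A cone_def)
    ultimately have "0 \<le> f \<beta> \<eta>"
      using F_le[of \<beta> 0] time unfolding f_def by simp
    then show ?thesis using A by blast
  qed
  then show False using f_neg by fastforce
qed

end


section \<open>Compactness\<close>

lemma increments_bound:
  fixes f :: "nat \<Rightarrow> real"
  assumes "\<And>n. \<bar>f (n + 1) - f n\<bar> \<le> K"
  shows "\<bar>f m - f n\<bar> \<le> K * \<bar>real m - real n\<bar>"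
proof -
  have *: "\<bar>f (n + k) - f n\<bar> \<le> K * real k" for n k
  proof (induction k)
    case (Suc k)
    then show ?case using assms[of "n + k"] by (simp add: algebra_simps)
  qed simp
  show ?thesis
  proof (cases "n \<le> m")
    case True
    then show ?thesis using *[of n "m - n"] by (simp add: of_nat_diff)
  next
    case False
    then show ?thesis using *[of m "n - m"] by (simp add: of_nat_diff abs_minus_commute)
  qed
qed

lemma grid_lipschitz:
  assumes pos: "0 < dt" "0 < dx" and LC: "P \<le> L" "C \<le> L"
    and slopes: "\<And>\<alpha> n i. \<bar>slope_fwd dx U \<alpha> n i\<bar> \<le> P" "\<And>\<alpha> n i. \<bar>time_slope dt U \<alpha> n i\<bar> \<le> C"
  shows "\<bar>U \<alpha> m j - U \<alpha> n i\<bar> \<le> L * (\<bar>real m * dt - real n * dt\<bar> + \<bar>real j * dx - real i * dx\<bar>)"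
proof -
  have scale: "\<bar>real p * d - real q * d\<bar> = d * \<bar>real p - real q\<bar>" if "0 < d" for p q d
    using that by (simp flip: left_diff_distrib add: abs_mult)
  have "\<bar>U \<alpha> n (i + 1) - U \<alpha> n i\<bar> \<le> L * dx" for n i
    using slopes(1)[of \<alpha> n i] pos LC order_trans[OF _ mult_right_mono[OF LC(1), of dx]]
    by (simp add: slope_fwd_def pos_divide_le_eq)
  from increments_bound[of "U \<alpha> m", OF this]
  have "\<bar>U \<alpha> m j - U \<alpha> m i\<bar> \<le> L * \<bar>real j * dx - real i * dx\<bar>"
    by (simp add: scale pos mult.assoc)
  moreover have "\<bar>U \<alpha> (n + 1) i - U \<alpha> n i\<bar> \<le> L * dt" for n i
    using slopes(2)[of \<alpha> n i] pos LC order_trans[OF _ mult_right_mono[OF LC(2), of dt]]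
    by (simp add: time_slope_def pos_divide_le_eq)
  from increments_bound[of "\<lambda>n. U \<alpha> n i", OF this]
  have "\<bar>U \<alpha> m i - U \<alpha> n i\<bar> \<le> L * \<bar>real m * dt - real n * dt\<bar>"
    by (simp add: scale pos mult.assoc)
  ultimately show ?thesis by (simp add: distrib_left)
qed

text \<open>Tychonoff's theorem, for a filter instead of a sequence.\<close>

lemma pointwise_convergent_refinement:
  fixes V :: "'e \<Rightarrow> 'z \<Rightarrow> real"
  assumes F: "F \<noteq> bot" and bounded: "\<forall>\<^sub>F \<epsilon> in F. \<forall>z. \<bar>V \<epsilon> z\<bar> \<le> B z"
  obtains G v where "G \<le> F" "G \<noteq> bot" "\<And>z. ((\<lambda>\<epsilon>. V \<epsilon> z) \<longlongrightarrow> v z) G"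
proof -
  let ?S = "PiE UNIV (\<lambda>z. {- B z..B z})"
  have "compactin (product_topology (\<lambda>_. euclidean) UNIV) ?S"
    by (subst compactin_PiE) simp
  then have S: "compact ?S"
    by (simp only: euclidean_product_topology compactin_euclidean_iff)
  have "eventually (\<lambda>f. f \<in> ?S) (filtermap V F)"
    using bounded by (auto simp: eventually_filtermap abs_le_iff minus_le_iff elim!: eventually_mono)
  moreover have "filtermap V F \<noteq> bot" using F by (simp add: filtermap_bot_iff)
  ultimately obtain v where v: "inf (nhds v) (filtermap V F) \<noteq> bot"
    using S unfolding compact_filter by blast
  \<comment> \<open>\<open>v\<close> is only a cluster point of the family. Meeting \<open>F\<close>
    with the preimages of the neighbourhoods of \<open>v\<close> turns it into a limit, and
    clustering is exactly what keeps this meet proper.\<close>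
  define G where "G = inf F (filtercomap V (nhds v))"
  show thesis
  proof
    show "G \<le> F" by (simp add: G_def)
    show "G \<noteq> bot"
    proof
      assume "G = bot"
      then have "eventually (\<lambda>_. False) G" by simp
      then obtain P Q where P: "eventually P F" and Q: "eventually Q (nhds v)" and PQ: "\<And>\<epsilon>. P \<epsilon> \<Longrightarrow> \<not> Q (V \<epsilon>)"
        unfolding G_def eventually_inf eventually_filtercomap by blast
      have "eventually (\<lambda>f. \<not> Q f) (filtermap V F)"
        using P PQ by (auto simp: eventually_filtermap elim: eventually_mono)
      then have "eventually (\<lambda>_. False) (inf (nhds v) (filtermap V F))"
        unfolding eventually_inf using Q by blast
      then show False using v by (simp add: trivial_limit_def)
    qed
    have "filtermap V G \<le> nhds v"
      by (rule order_trans[OF _ filtermap_filtercomap]) (auto simp: G_def intro: filtermap_mono)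
    then have "(V \<longlongrightarrow> v) G" by (simp add: filterlim_def)
    show "((\<lambda>\<epsilon>. V \<epsilon> z) \<longlongrightarrow> v z) G" for z
    proof (rule topological_tendstoI)
      fix A :: "real set" assume A: "open A" "v z \<in> A"
      have "open ((\<lambda>f. f z) -` A)"
        using A by (intro open_vimage continuous_on_product_coordinates)
      then show "\<forall>\<^sub>F \<epsilon> in G. V \<epsilon> z \<in> A"
        using topological_tendstoD[OF \<open>(V \<longlongrightarrow> v) G\<close>, of "(\<lambda>f. f z) -` A"] A by simp
    qed
  qed
qed

text \<open>An Arzela-Ascoli argument. As the grids move with the steps, the grid functions are read
  as step functions at fixed points. Pointwise limits inherit the Lipschitz bound, and this bound
  turns convergence on a finite net into locally uniform convergence.\<close>

lemma scheme_compactness: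
  fixes U :: "real \<Rightarrow> real \<Rightarrow> 'n::finite \<Rightarrow> nat \<Rightarrow> nat \<Rightarrow> real"
  assumes F: "F \<noteq> bot"
    and small: "\<And>d. 0 < d \<Longrightarrow> \<forall>\<^sub>F (dt, dx) in F. 0 < dt \<and> dt < d \<and> 0 < dx \<and> dx < d"
    and lip: "\<forall>\<^sub>F (dt, dx) in F. \<forall>\<alpha> m n i j. \<bar>U dt dx \<alpha> m j - U dt dx \<alpha> n i\<bar>
      \<le> L * (\<bar>real m * dt - real n * dt\<bar> + \<bar>real j * dx - real i * dx\<bar>)"
    and init: "\<forall>\<^sub>F (dt, dx) in F. \<forall>\<alpha> i. U dt dx \<alpha> 0 i = g \<alpha> (real i * dx)"
    and g: "\<And>\<alpha>. K-lipschitz_on {0..} (g \<alpha>)"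
    and vertex: "\<forall>\<^sub>F (dt, dx) in F. \<forall>\<alpha> \<beta> n. U dt dx \<alpha> n 0 = U dt dx \<beta> n 0"
  obtains G w where "G \<le> F" "G \<noteq> bot"
    "\<And>R \<eta>. 0 < \<eta> \<Longrightarrow> \<forall>\<^sub>F (dt, dx) in G. \<forall>\<alpha> n i. real n * dt \<le> R \<longrightarrow> real i * dx \<le> R \<longrightarrow>
      \<bar>U dt dx \<alpha> n i - w \<alpha> (real n * dt) (real i * dx)\<bar> \<le> \<eta>"
    "\<And>\<alpha> t s x y. 0 \<le> t \<Longrightarrow> 0 \<le> s \<Longrightarrow> 0 \<le> x \<Longrightarrow> 0 \<le> y \<Longrightarrow>
      \<bar>w \<alpha> t x - w \<alpha> s y\<bar> \<le> L * (\<bar>t - s\<bar> + \<bar>x - y\<bar>)"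
    "\<And>\<alpha> x. 0 \<le> x \<Longrightarrow> w \<alpha> 0 x = g \<alpha> x" "\<And>\<alpha> \<beta> t. w \<alpha> t 0 = w \<beta> t 0"
proof -
  have L: "0 \<le> L"
  proof -
    obtain dt dx :: real where "0 < dt" "\<forall>\<alpha> m n i j. \<bar>U dt dx \<alpha> m j - U dt dx \<alpha> n i\<bar>
      \<le> L * (\<bar>real m * dt - real n * dt\<bar> + \<bar>real j * dx - real i * dx\<bar>)"
      using eventually_happens'[OF F eventually_conj[OF small[OF zero_less_one] lip]] by auto
    then have "0 \<le> L * (\<bar>real 1 * dt - real 0 * dt\<bar> + \<bar>real 0 * dx - real 0 * dx\<bar>)"
      by (meson abs_ge_zero order_trans)
    then show ?thesis using \<open>0 < dt\<close> by (simp add: zero_le_mult_iff)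
  qed
  define V where "V = (\<lambda>(dt, dx) (\<alpha>, t, x). U dt dx \<alpha> (nat \<lfloor>t / dt\<rfloor>) (nat \<lfloor>x / dx\<rfloor>))"
  \<comment> \<open>The product runs over all real \<open>t\<close> and \<open>x\<close>. For
    negative arguments \<open>nat\<close> returns index 0, so a bound in terms of the absolute value
    holds there as well.\<close>
  have floor_le: "real (nat \<lfloor>s / d\<rfloor>) * d \<le> \<bar>s\<bar>" if "0 < d" for s d :: real
  proof (cases "0 \<le> s")
    case True
    then show ?thesis using grid_floor(1)[OF that, of s] by simp
  next
    case False
    then have "s / d < 0" using that by (simp add: divide_neg_pos)
    then show ?thesis by simp
  qed
  have "\<forall>\<^sub>F \<epsilon> in F. \<forall>z. \<bar>V \<epsilon> z\<bar> \<le> (\<lambda>(\<alpha>, t, x). \<bar>g \<alpha> 0\<bar> + L * (\<bar>t\<bar> + \<bar>x\<bar>)) z"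
    using small[OF zero_less_one] lip init
  proof eventually_elim
    case (elim \<epsilon>)
    obtain dt dx where \<epsilon>: "\<epsilon> = (dt, dx)" by (cases \<epsilon>)
    have "\<bar>U dt dx \<alpha> (nat \<lfloor>t / dt\<rfloor>) (nat \<lfloor>x / dx\<rfloor>)\<bar> \<le> \<bar>g \<alpha> 0\<bar> + L * (\<bar>t\<bar> + \<bar>x\<bar>)" for \<alpha> t x
    proof -
      let ?n = "nat \<lfloor>t / dt\<rfloor>" and ?i = "nat \<lfloor>x / dx\<rfloor>"
      have "\<bar>U dt dx \<alpha> ?n ?i - U dt dx \<alpha> 0 0\<bar> \<le> L * (\<bar>real ?n * dt - real 0 * dt\<bar> + \<bar>real ?i * dx - real 0 * dx\<bar>)"
        using elim(2) unfolding \<epsilon> by blast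
      also have "\<dots> \<le> L * (\<bar>t\<bar> + \<bar>x\<bar>)"
        using floor_le[of dt t] floor_le[of dx x] elim(1) L unfolding \<epsilon> by (intro mult_left_mono) auto
      finally have "\<bar>U dt dx \<alpha> ?n ?i - U dt dx \<alpha> 0 0\<bar> \<le> L * (\<bar>t\<bar> + \<bar>x\<bar>)" .
      moreover have "U dt dx \<alpha> 0 0 = g \<alpha> 0" using elim(3) by (simp add: \<epsilon>)
      ultimately show ?thesis by linarith
    qed
    then show ?case by (auto simp: V_def \<epsilon>)
  qed
  from pointwise_convergent_refinement[OF F this]
  obtain G v where GF: "G \<le> F" and G: "G \<noteq> bot" and v: "\<And>z. ((\<lambda>\<epsilon>. V \<epsilon> z) \<longlongrightarrow> v z) G"
    by blast
  define w where "w \<alpha> t x = v (\<alpha>, t, x)" for \<alpha> t x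
  have w: "((\<lambda>\<epsilon>. V \<epsilon> (\<alpha>, t, x)) \<longlongrightarrow> w \<alpha> t x) G" for \<alpha> t x
    using v by (simp add: w_def)
  note small = filter_leD[OF GF small]
  note lip = filter_leD[OF GF lip]
  note init = filter_leD[OF GF init]
  note vertex = filter_leD[OF GF vertex]
  have V_lip: "\<bar>U dt dx \<alpha> n i - V (dt, dx) (\<alpha>, t, x)\<bar> \<le> L * (\<bar>real n * dt - t\<bar> + \<bar>real i * dx - x\<bar> + 2 * d)"
    if dd: "0 < dt" "dt < d" "0 < dx" "dx < d" and tx: "0 \<le> t" "0 \<le> x"
      and lip: "\<forall>\<alpha> m n i j. \<bar>U dt dx \<alpha> m j - U dt dx \<alpha> n i\<bar>
        \<le> L * (\<bar>real m * dt - real n * dt\<bar> + \<bar>real j * dx - real i * dx\<bar>)" for dt dx d t x \<alpha> n i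
  proof -
    let ?n = "nat \<lfloor>t / dt\<rfloor>" and ?i = "nat \<lfloor>x / dx\<rfloor>"
    have "\<bar>U dt dx \<alpha> n i - U dt dx \<alpha> ?n ?i\<bar> \<le> L * (\<bar>real n * dt - real ?n * dt\<bar> + \<bar>real i * dx - real ?i * dx\<bar>)"
      using lip by blast
    also have "\<dots> \<le> L * (\<bar>real n * dt - t\<bar> + \<bar>real i * dx - x\<bar> + 2 * d)"
      using grid_floor[of dt t] grid_floor[of dx x] dd tx L by (intro mult_left_mono) linarith+
    finally show ?thesis by (simp add: V_def)
  qed
  have w_lip: "\<bar>w \<alpha> t x - w \<alpha> s y\<bar> \<le> L * (\<bar>t - s\<bar> + \<bar>x - y\<bar>)"
    if tx: "0 \<le> t" "0 \<le> s" "0 \<le> x" "0 \<le> y" for \<alpha> t s x y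
  proof (rule field_le_epsilon)
    fix \<epsilon> :: real assume "0 < \<epsilon>"
    \<comment> \<open>Rounding costs at most \<open>d\<close> in each coordinate of each of the two
      points, hence \<open>4 * d\<close>; the summand 1 avoids division by zero.\<close>
    define d where "d = \<epsilon> / (4 * (L + 1))"
    have d: "0 < d" "L * (4 * d) \<le> \<epsilon>" using \<open>0 < \<epsilon>\<close> L by (auto simp: d_def field_simps)
    have "((\<lambda>\<epsilon>. \<bar>V \<epsilon> (\<alpha>, t, x) - V \<epsilon> (\<alpha>, s, y)\<bar>) \<longlongrightarrow> \<bar>w \<alpha> t x - w \<alpha> s y\<bar>) G"
      by (intro tendsto_intros w)
    moreover have "\<forall>\<^sub>F \<epsilon>' in G. \<bar>V \<epsilon>' (\<alpha>, t, x) - V \<epsilon>' (\<alpha>, s, y)\<bar> \<le> L * (\<bar>t - s\<bar> + \<bar>x - y\<bar>) + \<epsilon>"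
      using small[OF d(1)] lip
    proof (eventually_elim, clarify)
      fix dt dx assume dd: "0 < dt" "dt < d" "0 < dx" "dx < d" and lip: "\<forall>\<alpha> m n i j. \<bar>U dt dx \<alpha> m j - U dt dx \<alpha> n i\<bar>
        \<le> L * (\<bar>real m * dt - real n * dt\<bar> + \<bar>real j * dx - real i * dx\<bar>)"
      let ?n = "nat \<lfloor>t / dt\<rfloor>" and ?i = "nat \<lfloor>x / dx\<rfloor>"
      have "\<bar>V (dt, dx) (\<alpha>, t, x) - V (dt, dx) (\<alpha>, s, y)\<bar>
          \<le> L * (\<bar>real ?n * dt - s\<bar> + \<bar>real ?i * dx - y\<bar> + 2 * d)"
        using V_lip[OF dd tx(2,4) lip, of \<alpha> ?n ?i] by (simp add: V_def)
      also have "\<dots> \<le> L * ((\<bar>t - s\<bar> + \<bar>x - y\<bar>) + 4 * d)"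
        using grid_floor[of dt t] grid_floor[of dx x] dd tx L by (intro mult_left_mono) linarith+
      also have "\<dots> \<le> L * (\<bar>t - s\<bar> + \<bar>x - y\<bar>) + \<epsilon>" using d by (simp add: distrib_left)
      finally show "\<bar>V (dt, dx) (\<alpha>, t, x) - V (dt, dx) (\<alpha>, s, y)\<bar> \<le> L * (\<bar>t - s\<bar> + \<bar>x - y\<bar>) + \<epsilon>" .
    qed
    ultimately show "\<bar>w \<alpha> t x - w \<alpha> s y\<bar> \<le> L * (\<bar>t - s\<bar> + \<bar>x - y\<bar>) + \<epsilon>"
      by (rule tendsto_upperbound[OF _ _ G])
  qed
  show thesis
  proof (rule that[OF GF G])
    fix R \<eta> :: real assume \<eta>: "0 < \<eta>"
    \<comment> \<open>On a net of mesh \<open>d\<close> the error is below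
      \<open>\<eta> / 2\<close>. Moving to a net point costs \<open>2 * d\<close> for
      \<open>w\<close> and, with rounding, \<open>4 * d\<close> for the step functions; together
      \<open>6 * d\<close>.\<close>
    define d where "d = \<eta> / (12 * (L + 1))"
    have d: "0 < d" "L * (6 * d) \<le> \<eta> / 2" using \<eta> L by (auto simp: d_def field_simps)
    define N where "N = nat \<lceil>R / d\<rceil>"
    have "\<forall>\<^sub>F \<epsilon> in G. \<forall>(\<alpha>, j, k)\<in>UNIV \<times> {..N} \<times> {..N}.
        \<bar>V \<epsilon> (\<alpha>, real j * d, real k * d) - w \<alpha> (real j * d) (real k * d)\<bar> < \<eta> / 2"
      using tendstoD[OF w, of "\<eta> / 2"] \<eta> by (intro eventually_ball_finite) (auto simp: dist_real_def)
    then show "\<forall>\<^sub>F (dt, dx) in G. \<forall>\<alpha> n i. real n * dt \<le> R \<longrightarrow> real i * dx \<le> R \<longrightarrow>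
      \<bar>U dt dx \<alpha> n i - w \<alpha> (real n * dt) (real i * dx)\<bar> \<le> \<eta>"
      using small[OF d(1)] lip
    proof (eventually_elim, clarify)
      fix dt dx \<alpha> n i
      assume V: "\<forall>(\<alpha>, j, k)\<in>UNIV \<times> {..N} \<times> {..N}.
          \<bar>V (dt, dx) (\<alpha>, real j * d, real k * d) - w \<alpha> (real j * d) (real k * d)\<bar> < \<eta> / 2"
        and dd: "0 < dt" "dt < d" "0 < dx" "dx < d" and lip: "\<forall>\<alpha> m n i j. \<bar>U dt dx \<alpha> m j - U dt dx \<alpha> n i\<bar>
        \<le> L * (\<bar>real m * dt - real n * dt\<bar> + \<bar>real j * dx - real i * dx\<bar>)"
        and R: "real n * dt \<le> R" "real i * dx \<le> R"
      define j k where "j = nat \<lfloor>real n * dt / d\<rfloor>" and "k = nat \<lfloor>real i * dx / d\<rfloor>"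
      have near: "\<bar>real n * dt - real j * d\<bar> \<le> d" "\<bar>real i * dx - real k * d\<bar> \<le> d"
        using grid_floor[OF d(1), of "real n * dt"] grid_floor[OF d(1), of "real i * dx"] dd
        unfolding j_def k_def by (auto simp: abs_le_iff)
      have "real n * dt / d \<le> R / d" "real i * dx / d \<le> R / d" using R d by (simp_all add: divide_right_mono)
      then have "j \<le> N" "k \<le> N" unfolding j_def k_def N_def by linarith+
      then have 1: "\<bar>V (dt, dx) (\<alpha>, real j * d, real k * d) - w \<alpha> (real j * d) (real k * d)\<bar> < \<eta> / 2"
        using V by auto
      have "\<bar>w \<alpha> (real j * d) (real k * d) - w \<alpha> (real n * dt) (real i * dx)\<bar>
          \<le> L * (\<bar>real j * d - real n * dt\<bar> + \<bar>real k * d - real i * dx\<bar>)"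
        using dd d by (intro w_lip) auto
      also have "\<dots> \<le> L * (2 * d)" using near L by (intro mult_left_mono) linarith+
      finally have 2: "\<bar>w \<alpha> (real j * d) (real k * d) - w \<alpha> (real n * dt) (real i * dx)\<bar> \<le> L * (2 * d)" .
      have "\<bar>U dt dx \<alpha> n i - V (dt, dx) (\<alpha>, real j * d, real k * d)\<bar>
          \<le> L * (\<bar>real n * dt - real j * d\<bar> + \<bar>real i * dx - real k * d\<bar> + 2 * d)"
        using V_lip[OF dd _ _ lip, of "real j * d" "real k * d" \<alpha> n i] d by simp
      also have "\<dots> \<le> L * (4 * d)" using near L by (intro mult_left_mono) linarith+
      finally have 3: "\<bar>U dt dx \<alpha> n i - V (dt, dx) (\<alpha>, real j * d, real k * d)\<bar> \<le> L * (4 * d)" .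
      have eq: "L * (2 * d) = 2 * (L * d)" "L * (4 * d) = 4 * (L * d)" "L * (6 * d) = 6 * (L * d)" by simp_all
      show "\<bar>U dt dx \<alpha> n i - w \<alpha> (real n * dt) (real i * dx)\<bar> \<le> \<eta>"
        using 1 2 3 d(2) unfolding eq by linarith
    qed
  next
    show "\<bar>w \<alpha> t x - w \<alpha> s y\<bar> \<le> L * (\<bar>t - s\<bar> + \<bar>x - y\<bar>)"
      if "0 \<le> t" "0 \<le> s" "0 \<le> x" "0 \<le> y" for \<alpha> t s x y by (rule w_lip[OF that])
  next
    fix \<alpha> and x :: real assume x: "0 \<le> x"
    have "((\<lambda>\<epsilon>. V \<epsilon> (\<alpha>, 0, x)) \<longlongrightarrow> g \<alpha> x) G"
    proof (rule tendstoI)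
      fix \<eta> :: real assume "0 < \<eta>"
      have K: "0 \<le> K" using g lipschitz_on_nonneg by blast
      define d where "d = \<eta> / (K + 1)"
      have d: "0 < d" "K * d < \<eta>" using \<open>0 < \<eta>\<close> K by (auto simp: d_def field_simps)
      show "\<forall>\<^sub>F \<epsilon> in G. dist (V \<epsilon> (\<alpha>, 0, x)) (g \<alpha> x) < \<eta>"
        using small[OF d(1)] init
      proof (eventually_elim, clarify)
        fix dt dx assume dd: "0 < dt" "0 < dx" "dx < d" and init: "\<forall>\<alpha> i. U dt dx \<alpha> 0 i = g \<alpha> (real i * dx)"
        let ?i = "nat \<lfloor>x / dx\<rfloor>"
        have "dist (g \<alpha> (real ?i * dx)) (g \<alpha> x) \<le> K * dist (real ?i * dx) x"
          using x dd by (intro lipschitz_onD[OF g]) auto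
        also have "\<dots> \<le> K * d"
          using grid_floor[of dx x] dd x K by (intro mult_left_mono) (auto simp: dist_real_def)
        finally show "dist (V (dt, dx) (\<alpha>, 0, x)) (g \<alpha> x) < \<eta>"
          using d init by (simp add: V_def)
      qed
    qed
    then show "w \<alpha> 0 x = g \<alpha> x" using w tendsto_unique[OF G] by blast
  next
    fix \<alpha> \<beta> t
    have "\<forall>\<^sub>F \<epsilon> in G. V \<epsilon> (\<alpha>, t, 0) = V \<epsilon> (\<beta>, t, 0)"
      using vertex by eventually_elim (auto simp: V_def)
    then have "((\<lambda>\<epsilon>. V \<epsilon> (\<alpha>, t, 0)) \<longlongrightarrow> w \<beta> t 0) G"
      using w[of \<beta> t 0] tendsto_cong by force
    then show "w \<alpha> t 0 = w \<beta> t 0" using w tendsto_unique[OF G] by blast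
  qed
qed


section \<open>The limit is a viscosity solution\<close>

lemma A1'_imp_split:
  assumes "A1' H Hm Hp"
  shows "\<exists>c. split_hamiltonian c (H \<alpha>) (Hm \<alpha>) (Hp \<alpha>)"
proof -
  obtain \<gamma> L L' L'' where \<gamma>: "0 < \<gamma>"
    and L: "(\<forall>q. (L has_real_derivative L' q) (at q)) \<and> (\<forall>q. (L' has_real_derivative L'' q) (at q)) \<and>
     continuous_on UNIV L'' \<and> (\<forall>q. \<gamma> \<le> L'' q) \<and> (\<forall>p. H \<alpha> p = (SUP q. p * q - L q)) \<and>
     (\<forall>p. Hm \<alpha> p = (SUP q\<in>{..0}. p * q - L q)) \<and> (\<forall>p. Hp \<alpha> p = (SUP q\<in>{0..}. p * q - L q))"
    using assms unfolding A1'_def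
    by (elim exE conjE allE[of _ \<alpha>]) (rule that, assumption, intro conjI; assumption)
  have "split_hamiltonian (L' 0) (H \<alpha>) (Hm \<alpha>) (Hp \<alpha>)"
    by (rule legendre_split[OF \<gamma>, of L'' L L']) (use L in simp_all)
  then show ?thesis ..
qed

text \<open>The increment is taken first in \<open>x\<close> at time \<open>t0\<close>, by the
  one-sided derivative at \<open>x0\<close>, and then in \<open>t\<close> at abscissa
  \<open>x\<close>, by the mean value inequality and continuity of the time derivative. The sign
  \<open>s\<close> again covers both kinds of contact.\<close>

lemma C1_halfline_superjet:
  assumes C1: "C1_halfline T f" and t0: "0 < t0" "t0 < T" and x0: "0 \<le> x0" and s: "\<bar>s\<bar> = 1"
    and eq: "g t0 x0 = s * f t0 x0" and d: "0 < d"
    and le: "\<And>t x. \<bar>t - t0\<bar> < d \<Longrightarrow> 0 \<le> x \<Longrightarrow> \<bar>x - x0\<bar> < d \<Longrightarrow> g t x \<le> s * f t x"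
  shows "superjet_on_halfline g t0 x0 (s * time_deriv f t0 x0) (s * space_deriv f t0 x0)"
  unfolding superjet_on_halfline_def
proof (intro allI impI)
  fix \<eta> :: real assume \<eta>: "0 < \<eta>"
  define a b where "a = time_deriv f t0 x0" and "b = space_deriv f t0 x0"
  have f_t: "((\<lambda>s. f s x) has_real_derivative time_deriv f t x) (at t)" if "0 < t" "t < T" "0 \<le> x" for t x
    using C1 that unfolding C1_halfline_def time_deriv_def
    by (auto simp: DERIV_deriv_iff_real_differentiable)
  have "(\<lambda>y. f t0 y) differentiable (at x0 within {0..})"
    using C1 t0 x0 unfolding C1_halfline_def by auto
  then have f_x: "(f t0 has_vector_derivative b) (at x0 within {0..})"
    unfolding b_def space_deriv_def by (simp add: vector_derivative_works)
  then have "\<exists>d>0. \<forall>y\<in>{0..}. norm (y - x0) < d \<longrightarrow>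
      norm (f t0 y - f t0 x0 - (y - x0) *\<^sub>R b) \<le> \<eta> * norm (y - x0)"
    using \<eta> unfolding has_vector_derivative_def has_derivative_within_alt by blast
  then obtain d1 where d1: "0 < d1"
    "\<And>y. 0 \<le> y \<Longrightarrow> \<bar>y - x0\<bar> < d1 \<Longrightarrow> \<bar>f t0 y - f t0 x0 - b * (y - x0)\<bar> \<le> \<eta> * \<bar>y - x0\<bar>"
    unfolding real_norm_def real_scaleR_def by (auto simp: mult.commute[of b])
  have "continuous_on ({0<..<T} \<times> {0..}) (\<lambda>(t, x). time_deriv f t x)"
    using C1 unfolding C1_halfline_def by blast
  moreover have "(t0, x0) \<in> {0<..<T} \<times> {0..}" using t0 x0 by simp
  ultimately have "\<exists>d>0. \<forall>z\<in>{0<..<T} \<times> {0..}. dist z (t0, x0) < d \<longrightarrow>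
      dist ((\<lambda>(t, x). time_deriv f t x) z) ((\<lambda>(t, x). time_deriv f t x) (t0, x0)) < \<eta>"
    using \<eta> unfolding continuous_on_iff by blast
  then obtain d2 where d2: "0 < d2"
    "\<And>t x. t \<in> {0<..<T} \<Longrightarrow> 0 \<le> x \<Longrightarrow> dist (t, x) (t0, x0) < d2 \<Longrightarrow> \<bar>time_deriv f t x - a\<bar> < \<eta>"
    unfolding dist_real_def a_def by auto
  define m where "m = min (min d d1) (min (d2 / 2) (min t0 (T - t0)))"
  have m: "0 < m" "m \<le> d" "m \<le> d1" "m \<le> t0" "m \<le> T - t0"
    using d d1(1) d2(1) t0 by (simp_all add: m_def min_le_iff_disj)
  have "m \<le> d2 / 2" unfolding m_def by (intro min.coboundedI2 min.coboundedI1) simp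
  define \<rho> where "\<rho> = m / 2"
  have \<rho>: "0 < \<rho>" "2 * \<rho> \<le> d" "2 * \<rho> \<le> d1" "4 * \<rho> \<le> d2" "2 * \<rho> \<le> t0" "2 * \<rho> \<le> T - t0"
    using m \<open>m \<le> d2 / 2\<close> by (simp_all add: \<rho>_def)
  have bound: "g t x \<le> g t0 x0 + cone (s * a) (s * b) \<eta> (t - t0) (x - x0)"
    if near: "\<bar>t - t0\<bar> \<le> \<rho>" "0 \<le> x" "\<bar>x - x0\<bar> \<le> \<rho>" for t x
  proof -
    have "\<bar>f t0 x - f t0 x0 - b * (x - x0)\<bar> \<le> \<eta> * \<bar>x - x0\<bar>"
      using near \<rho> by (intro d1) auto
    moreover have "norm ((f t x - a * t) - (f t0 x - a * t0)) \<le> \<eta> * norm (t - t0)"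
    proof (rule field_differentiable_bound[of "{t0 - \<rho>..t0 + \<rho>}"])
      fix \<tau> assume \<tau>: "\<tau> \<in> {t0 - \<rho>..t0 + \<rho>}"
      then have \<tau>': "0 < \<tau>" "\<tau> < T" "\<bar>\<tau> - t0\<bar> \<le> \<rho>" using \<rho> by auto
      show "((\<lambda>t. f t x - a * t) has_field_derivative time_deriv f \<tau> x - a) (at \<tau> within {t0 - \<rho>..t0 + \<rho>})"
        using f_t[OF \<tau>'(1,2) near(2)]
        by (auto intro!: derivative_eq_intros intro: has_field_derivative_at_within)
      have "dist (\<tau>, x) (t0, x0) \<le> \<bar>\<tau> - t0\<bar> + \<bar>x - x0\<bar>"
        using sqrt_sum_squares_le_sum_abs[of "\<tau> - t0" "x - x0"] by (simp add: dist_Pair_Pair dist_real_def)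
      then have "dist (\<tau>, x) (t0, x0) < d2" using \<tau>' near \<rho> by linarith
      then show "norm (time_deriv f \<tau> x - a) \<le> \<eta>"
        using d2(2)[of \<tau> x] \<tau>' near by simp
    qed (use near in auto)
    ultimately have "\<bar>f t x - f t0 x0 - (a * (t - t0) + b * (x - x0))\<bar> \<le> \<eta> * (\<bar>t - t0\<bar> + \<bar>x - x0\<bar>)"
      unfolding real_norm_def distrib_left right_diff_distrib by linarith
    then have "\<bar>s * (f t x - f t0 x0 - (a * (t - t0) + b * (x - x0)))\<bar> \<le> \<eta> * (\<bar>t - t0\<bar> + \<bar>x - x0\<bar>)"
      using s by (simp add: abs_mult)
    moreover have "g t x \<le> s * f t x" using near \<rho> by (intro le) auto
    moreover have "s * (f t x - f t0 x0 - (a * (t - t0) + b * (x - x0)))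
        = s * f t x - s * f t0 x0 - (s * a * (t - t0) + s * b * (x - x0))"
      by (simp add: algebra_simps)
    ultimately show ?thesis unfolding eq cone_def by linarith
  qed
  then show "\<exists>\<rho>>0. \<forall>t x. \<bar>t - t0\<bar> \<le> \<rho> \<longrightarrow> 0 \<le> x \<longrightarrow> \<bar>x - x0\<bar> \<le> \<rho> \<longrightarrow>
      g t x \<le> g t0 x0 + cone (s * time_deriv f t0 x0) (s * space_deriv f t0 x0) \<eta> (t - t0) (x - x0)"
    using \<rho>(1) unfolding a_def b_def by blast
qed

text \<open>From the vertex only \<open>x \<ge> 0\<close> is visible, so a larger slope gives a
  larger cone. Applied to \<open>- w\<close>, this permits lowering the test slopes at the
  vertex.\<close>

lemma superjet_slope_mono:
  assumes "superjet_on_halfline f t0 0 a b" "b \<le> b'"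
  shows "superjet_on_halfline f t0 0 a b'"
proof -
  have "cone a b \<eta> t x \<le> cone a b' \<eta> t x" if "0 \<le> x" for \<eta> t x
    using assms(2) that by (simp add: cone_def mult_right_mono)
  then show ?thesis
    using assms(1) unfolding superjet_on_halfline_def diff_zero by (meson add_left_mono order_trans)
qed

lemma continuous_on_filterlim_inf:
  assumes "continuous_on S f" "z \<in> S"
  shows "filterlim f (nhds (f z)) (inf (nhds z) (principal S))"
proof (rule topological_tendstoI)
  fix B assume "open B" "f z \<in> B"
  then obtain A where "open A" "z \<in> A" "\<And>y. y \<in> S \<Longrightarrow> y \<in> A \<Longrightarrow> f y \<in> B"
    using assms unfolding continuous_on_topological by metis
  then show "\<forall>\<^sub>F y in inf (nhds z) (principal S). f y \<in> B"
    unfolding eventually_inf_principal eventually_nhds by blast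
qed

lemma envelopes_of_continuous:
  assumes "continuous_on S f" "z \<in> S"
  shows "usc_env S f z = ereal (f z)" "lsc_env S f z = ereal (f z)"
proof -
  have "inf (nhds z) (principal S) \<noteq> bot"
  proof
    assume "inf (nhds z) (principal S) = bot"
    then have "\<forall>\<^sub>F y in nhds z. y \<notin> S"
      by (simp add: trivial_limit_def eventually_inf_principal)
    then show False using eventually_nhds_x_imp_x assms(2) by metis
  qed
  moreover have "((\<lambda>w. ereal (f w)) \<longlongrightarrow> ereal (f z)) (inf (nhds z) (principal S))"
    using continuous_on_filterlim_inf[OF assms] by simp
  ultimately show "usc_env S f z = ereal (f z)" "lsc_env S f z = ereal (f z)"
    unfolding usc_env_def lsc_env_def by (auto intro: lim_imp_Limsup lim_imp_Liminf)
qed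

lemma semicontinuous_of_continuous:
  assumes "continuous_on S f" "\<And>z. z \<in> S \<Longrightarrow> g z = f z"
  shows "usc_on S g" "lsc_on S g"
proof -
  have g: "(g \<longlongrightarrow> g z) (at z within S)" if "z \<in> S" for z
    using assms continuous_on_cong[of S S g f] that unfolding continuous_on_def by metis
  show "usc_on S g" unfolding usc_on_def using order_tendstoD(2)[OF g] by blast
  show "lsc_on S g" unfolding lsc_on_def using order_tendstoD(1)[OF g] by blast
qed

section \<open>Gluing the branch limits on the junction\<close>

locale junction_limit = scheme_limit G c H Hm Hp U w L
  for G and c :: "'n::finite \<Rightarrow> real" and H Hm Hp U w L +
  fixes e :: "'n \<Rightarrow> real^2" and u0 :: "real^2 \<Rightarrow> real" and T :: real
  assumes e: "inj e" "\<And>\<alpha>. norm (e \<alpha>) = 1" and L_nonneg: "0 \<le> L"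
    and init: "\<And>\<alpha> x. 0 \<le> x \<Longrightarrow> w \<alpha> 0 x = u0 (x *\<^sub>R e \<alpha>)"
begin

text \<open>The norm of a point is its abscissa on its branch; at the vertex the choice of the branch does not
  matter by \<open>w_vertex\<close>.\<close>

definition v :: "real \<times> (real^2) \<Rightarrow> real" where
  "v z = w (SOME \<alpha>. \<exists>x\<ge>0. snd z = x *\<^sub>R e \<alpha>) (fst z) (norm (snd z))"

lemma v_branch:
  assumes "0 \<le> x" shows "v (t, x *\<^sub>R e \<alpha>) = w \<alpha> t x"
proof -
  define \<beta> where "\<beta> = (SOME \<beta>. \<exists>y\<ge>0. x *\<^sub>R e \<alpha> = y *\<^sub>R e \<beta>)"
  have "\<exists>y\<ge>0. x *\<^sub>R e \<alpha> = y *\<^sub>R e \<beta>"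
    unfolding \<beta>_def using assms by (intro someI[of "\<lambda>\<beta>. \<exists>y\<ge>0. x *\<^sub>R e \<alpha> = y *\<^sub>R e \<beta>" \<alpha>] exI[of _ x]) simp
  then obtain y where y: "0 \<le> y" "x *\<^sub>R e \<alpha> = y *\<^sub>R e \<beta>" by auto
  have norm: "norm (x *\<^sub>R e \<alpha>) = x" using assms e by simp
  then have "y = x" using y e by simp
  have "w \<beta> t x = w \<alpha> t x"
  proof (cases "x = 0")
    case False
    then have "e \<alpha> = e \<beta>" using y \<open>y = x\<close> by simp
    then show ?thesis using e injD by metis
  qed (use w_vertex in auto)
  then show ?thesis unfolding v_def fst_conv snd_conv norm \<beta>_def[symmetric] .
qed

text \<open>Exhibits a branch as the solution set of a continuous equation, hence as a closed set;
  continuity on the junction is then glued over a finite closed cover.\<close>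

lemma branch_eq: "{x *\<^sub>R e \<alpha> | x. 0 \<le> x} = {y. y = norm y *\<^sub>R e \<alpha>}"
proof (intro set_eqI iffI; clarsimp)
  show "\<exists>x. y = x *\<^sub>R e \<alpha> \<and> 0 \<le> x" if "y = norm y *\<^sub>R e \<alpha>" for y
    using that by (intro exI[of _ "norm y"]) simp
qed (use e in simp)

lemma continuous_v: "continuous_on ({0..} \<times> junction e) v"
proof -
  define B where "B \<alpha> = {0::real..} \<times> {y. y = norm y *\<^sub>R e \<alpha>}" for \<alpha>
  have "continuous_on (\<Union>\<alpha>. B \<alpha>) v"
  proof (rule continuous_on_closed_Union)
    fix \<alpha>
    show "closed (B \<alpha>)" unfolding B_def
      by (intro closed_Times closed_atLeast closed_Collect_eq continuous_intros)
    have "(2 * L)-lipschitz_on (B \<alpha>) v"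
    proof (rule lipschitz_onI)
      fix z z' assume "z \<in> B \<alpha>" "z' \<in> B \<alpha>"
      then have z: "0 \<le> fst z" "snd z = norm (snd z) *\<^sub>R e \<alpha>" "0 \<le> fst z'" "snd z' = norm (snd z') *\<^sub>R e \<alpha>"
        by (auto simp: B_def)
      have "v z = w \<alpha> (fst z) (norm (snd z))" "v z' = w \<alpha> (fst z') (norm (snd z'))"
        using v_branch[of "norm (snd z)" "fst z" \<alpha>] v_branch[of "norm (snd z')" "fst z'" \<alpha>] z(2,4)
        by (metis norm_ge_zero prod.collapse)+
      then have "dist (v z) (v z') \<le> L * (\<bar>fst z - fst z'\<bar> + \<bar>norm (snd z) - norm (snd z')\<bar>)"
        using lip[of "fst z" "fst z'" "norm (snd z)" "norm (snd z')" \<alpha>] z by (simp add: dist_real_def)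
      also have "\<dots> \<le> L * (dist z z' + dist z z')"
      proof (intro mult_left_mono add_mono L_nonneg)
        show "\<bar>fst z - fst z'\<bar> \<le> dist z z'" using dist_fst_le[of z z'] by (simp add: dist_real_def)
        show "\<bar>norm (snd z) - norm (snd z')\<bar> \<le> dist z z'"
          using norm_triangle_ineq3[of "snd z" "snd z'"] dist_snd_le[of z z'] by (simp add: dist_norm)
      qed
      finally show "dist (v z) (v z') \<le> 2 * L * dist z z'" by simp
    qed (use L_nonneg in simp)
    then show "continuous_on (B \<alpha>) v" by (rule lipschitz_on_continuous_on)
  qed simp
  moreover have "(\<Union>\<alpha>. B \<alpha>) = {0..} \<times> junction e"
    unfolding B_def junction_def branch_eq by auto
  ultimately show ?thesis by simp
qed

lemma branch_in_JT: "0 < t \<Longrightarrow> t < T \<Longrightarrow> 0 \<le> x \<Longrightarrow> (t, x *\<^sub>R e \<alpha>) \<in> JT e T"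
  by (auto simp: junction_def)

lemma eventually_near_branch:
  assumes ev: "\<forall>\<^sub>F Q in at (t0, x0 *\<^sub>R e \<alpha>) within JT e T. R Q" and R0: "R (t0, x0 *\<^sub>R e \<alpha>)"
    and t0: "0 < t0" "t0 < T"
  obtains d where "0 < d"
    "\<And>t x. \<bar>t - t0\<bar> < d \<Longrightarrow> 0 \<le> x \<Longrightarrow> \<bar>x - x0\<bar> < d \<Longrightarrow> 0 < t \<and> t < T \<and> R (t, x *\<^sub>R e \<alpha>)"
proof -
  obtain d where d: "0 < d"
    "\<And>Q. Q \<in> JT e T \<Longrightarrow> dist Q (t0, x0 *\<^sub>R e \<alpha>) < d \<Longrightarrow> R Q"
    using ev R0 unfolding eventually_at by metis
  show thesis
  proof (rule that[of "min (d / 2) (min t0 (T - t0))"])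
    fix t x :: real
    assume near: "\<bar>t - t0\<bar> < min (d / 2) (min t0 (T - t0))" "0 \<le> x" "\<bar>x - x0\<bar> < min (d / 2) (min t0 (T - t0))"
    have "dist (x *\<^sub>R e \<alpha>) (x0 *\<^sub>R e \<alpha>) = \<bar>x - x0\<bar>"
      by (simp add: dist_norm e flip: scaleR_left_diff_distrib)
    then have "dist (t, x *\<^sub>R e \<alpha>) (t0, x0 *\<^sub>R e \<alpha>) \<le> \<bar>t - t0\<bar> + \<bar>x - x0\<bar>"
      using sqrt_sum_squares_le_sum_abs[of "t - t0" "x - x0"]
      by (simp add: dist_Pair_Pair dist_real_def e)
    moreover have "0 < t" "t < T" using near(1) by linarith+
    ultimately show "0 < t \<and> t < T \<and> R (t, x *\<^sub>R e \<alpha>)"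
      using near by (intro conjI d(2) branch_in_JT) linarith+
  qed (use d t0 in auto)
qed

text \<open>Stated for any \<open>f\<close> that agrees with \<open>v\<close> on the domain, because
  the notion of solution tests the real-valued envelopes of \<open>v\<close> and not
  \<open>v\<close> itself.\<close>

lemma jet_above:
  assumes touch: "touches_from_above e T \<phi> f (t0, x0 *\<^sub>R e \<alpha>)" and \<phi>: "\<phi> \<in> C1_star e T"
    and f: "\<And>z. z \<in> JT0 e T \<Longrightarrow> f z = v z" and t0: "0 < t0" "t0 < T" and x0: "0 \<le> x0"
  shows "superjet_on_halfline (w \<alpha>) t0 x0
    (time_deriv (branch e \<phi> \<alpha>) t0 x0) (space_deriv (branch e \<phi> \<alpha>) t0 x0)"
proof -
  have fw: "f (t, x *\<^sub>R e \<alpha>) = w \<alpha> t x" if "0 < t" "t < T" "0 \<le> x" for t x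
    using branch_in_JT[OF that, of \<alpha>] that by (subst f) (auto simp: v_branch)
  obtain d where d: "0 < d" "\<And>t x. \<bar>t - t0\<bar> < d \<Longrightarrow> 0 \<le> x \<Longrightarrow> \<bar>x - x0\<bar> < d \<Longrightarrow>
      0 < t \<and> t < T \<and> f (t, x *\<^sub>R e \<alpha>) \<le> \<phi> (t, x *\<^sub>R e \<alpha>)"
    by (rule eventually_near_branch[of "\<lambda>Q. f Q \<le> \<phi> Q" t0 x0 \<alpha>])
      (use touch t0 in \<open>auto simp: touches_from_above_def\<close>)
  have "superjet_on_halfline (w \<alpha>) t0 x0
    (1 * time_deriv (branch e \<phi> \<alpha>) t0 x0) (1 * space_deriv (branch e \<phi> \<alpha>) t0 x0)"
  proof (rule C1_halfline_superjet[OF _ t0 x0 _ _ d(1)])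
    show "C1_halfline T (branch e \<phi> \<alpha>)" using \<phi> by (simp add: C1_star_def)
    show "w \<alpha> t0 x0 = 1 * branch e \<phi> \<alpha> t0 x0"
      using touch fw[OF t0 x0] by (simp add: touches_from_above_def branch_def)
    show "w \<alpha> t x \<le> 1 * branch e \<phi> \<alpha> t x" if "\<bar>t - t0\<bar> < d" "0 \<le> x" "\<bar>x - x0\<bar> < d" for t x
      using d(2)[OF that] fw[of t x] that by (simp add: branch_def)
  qed simp
  then show ?thesis by simp
qed

lemma jet_below:
  assumes touch: "touches_from_below e T \<phi> f (t0, x0 *\<^sub>R e \<alpha>)" and \<phi>: "\<phi> \<in> C1_star e T"
    and f: "\<And>z. z \<in> JT0 e T \<Longrightarrow> f z = v z" and t0: "0 < t0" "t0 < T" and x0: "0 \<le> x0"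
  shows "superjet_on_halfline (\<lambda>t x. - w \<alpha> t x) t0 x0
    (- time_deriv (branch e \<phi> \<alpha>) t0 x0) (- space_deriv (branch e \<phi> \<alpha>) t0 x0)"
proof -
  have fw: "f (t, x *\<^sub>R e \<alpha>) = w \<alpha> t x" if "0 < t" "t < T" "0 \<le> x" for t x
    using branch_in_JT[OF that, of \<alpha>] that by (subst f) (auto simp: v_branch)
  obtain d where d: "0 < d" "\<And>t x. \<bar>t - t0\<bar> < d \<Longrightarrow> 0 \<le> x \<Longrightarrow> \<bar>x - x0\<bar> < d \<Longrightarrow>
      0 < t \<and> t < T \<and> f (t, x *\<^sub>R e \<alpha>) \<ge> \<phi> (t, x *\<^sub>R e \<alpha>)"
    by (rule eventually_near_branch[of "\<lambda>Q. f Q \<ge> \<phi> Q" t0 x0 \<alpha>])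
      (use touch t0 in \<open>auto simp: touches_from_below_def\<close>)
  have "superjet_on_halfline (\<lambda>t x. - w \<alpha> t x) t0 x0
    (- 1 * time_deriv (branch e \<phi> \<alpha>) t0 x0) (- 1 * space_deriv (branch e \<phi> \<alpha>) t0 x0)"
  proof (rule C1_halfline_superjet[OF _ t0 x0 _ _ d(1)])
    show "C1_halfline T (branch e \<phi> \<alpha>)" using \<phi> by (simp add: C1_star_def)
    show "- w \<alpha> t0 x0 = - 1 * branch e \<phi> \<alpha> t0 x0"
      using touch fw[OF t0 x0] by (simp add: touches_from_below_def branch_def)
    show "- w \<alpha> t x \<le> - 1 * branch e \<phi> \<alpha> t x" if "\<bar>t - t0\<bar> < d" "0 \<le> x" "\<bar>x - x0\<bar> < d" for t x
      using d(2)[OF that] fw[of t x] that by (simp add: branch_def)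
  qed simp
  then show ?thesis by simp
qed

lemma viscosity_subsolution_v:
  assumes f: "\<And>z. z \<in> JT0 e T \<Longrightarrow> f z = v z"
  shows "viscosity_subsolution e T H Hm f"
  unfolding viscosity_subsolution_def
proof (intro conjI ballI allI impI)
  have "continuous_on (JT0 e T) v" by (rule continuous_on_subset[OF continuous_v]) auto
  then show "usc_on (JT0 e T) f" using f by (rule semicontinuous_of_continuous)
next
  fix \<phi> t \<alpha> and x :: real
  assume \<phi>: "\<phi> \<in> C1_star e T" and t: "t \<in> {0<..<T}" and x: "0 < x"
    and touch: "touches_from_above e T \<phi> f (t, x *\<^sub>R e \<alpha>)"
  have jet: "superjet_on_halfline (w \<alpha>) t x
    (time_deriv (branch e \<phi> \<alpha>) t x) (space_deriv (branch e \<phi> \<alpha>) t x)"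
    using t x by (intro jet_above[OF touch \<phi> f]) auto
  show "interior_operator e H \<phi> \<alpha> t x \<le> 0"
    using subsolution_fwd[OF jet] subsolution_bwd[OF jet] t x
    by (simp add: interior_operator_def h_eq_max[of \<alpha>] max_def)
next
  fix \<phi> t assume \<phi>: "\<phi> \<in> C1_star e T" and t: "t \<in> {0<..<T}"
    and touch: "touches_from_above e T \<phi> f (t, 0)"
  \<comment> \<open>For a subsolution the vertex condition decouples: the forward inequality on the
    branch attaining the maximum is all of it.\<close>
  obtain \<alpha> where \<alpha>: "(MAX \<alpha>. Hm \<alpha> (space_deriv (branch e \<phi> \<alpha>) t 0)) = Hm \<alpha> (space_deriv (branch e \<phi> \<alpha>) t 0)"
    using MAX_attained[of "\<lambda>\<alpha>. Hm \<alpha> (space_deriv (branch e \<phi> \<alpha>) t 0)"] by auto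
  have touch': "touches_from_above e T \<phi> f (t, 0 *\<^sub>R e \<alpha>)" using touch by simp
  have "superjet_on_halfline (w \<alpha>) t 0
    (time_deriv (branch e \<phi> \<alpha>) t 0) (space_deriv (branch e \<phi> \<alpha>) t 0)"
    using t by (intro jet_above[OF touch' \<phi> f]) auto
  from subsolution_fwd[OF this] show "junction_operator e Hm \<phi> t \<le> 0"
    using t unfolding junction_operator_def \<alpha> by (simp add: time_deriv_def branch_def)
qed

lemma viscosity_supersolution_v:
  assumes f: "\<And>z. z \<in> JT0 e T \<Longrightarrow> f z = v z"
  shows "viscosity_supersolution e T H Hm f"
  unfolding viscosity_supersolution_def
proof (intro conjI ballI allI impI)
  have "continuous_on (JT0 e T) v" by (rule continuous_on_subset[OF continuous_v]) auto
  then show "lsc_on (JT0 e T) f" using f by (rule semicontinuous_of_continuous)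
next
  fix \<phi> t \<alpha> and x :: real
  assume \<phi>: "\<phi> \<in> C1_star e T" and t: "t \<in> {0<..<T}" and x: "0 < x"
    and touch: "touches_from_below e T \<phi> f (t, x *\<^sub>R e \<alpha>)"
  have jet: "superjet_on_halfline (\<lambda>t x. - w \<alpha> t x) t x
    (- time_deriv (branch e \<phi> \<alpha>) t x) (- space_deriv (branch e \<phi> \<alpha>) t x)"
    using t x by (intro jet_below[OF touch \<phi> f]) auto
  show "0 \<le> interior_operator e H \<phi> \<alpha> t x"
    using supersolution[of "{\<alpha>}" t x _ "\<lambda>_. space_deriv (branch e \<phi> \<alpha>) t x" \<alpha>] jet t x
    by (auto simp: interior_operator_def)
next
  fix \<phi> t assume \<phi>: "\<phi> \<in> C1_star e T" and t: "t \<in> {0<..<T}"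
    and touch: "touches_from_below e T \<phi> f (t, 0)"
  define a where "a = deriv (\<lambda>s. \<phi> (s, 0)) t"
  define q where "q \<alpha> = space_deriv (branch e \<phi> \<alpha>) t 0" for \<alpha>
  \<comment> \<open>Capping the slopes at \<open>c\<close> does not change \<open>Hm\<close>, and makes it agree with \<open>H\<close>, so that a contact away
    from the vertex is harmless.\<close>
  have jet: "superjet_on_halfline (\<lambda>t x. - w \<alpha> t x) t 0 (- a) (- min (q \<alpha>) (c \<alpha>))" for \<alpha>
  proof (rule superjet_slope_mono)
    have touch': "touches_from_below e T \<phi> f (t, 0 *\<^sub>R e \<alpha>)" using touch by simp
    have "superjet_on_halfline (\<lambda>t x. - w \<alpha> t x) t 0
      (- time_deriv (branch e \<phi> \<alpha>) t 0) (- space_deriv (branch e \<phi> \<alpha>) t 0)"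
      using t by (intro jet_below[OF touch' \<phi> f]) auto
    then show "superjet_on_halfline (\<lambda>t x. - w \<alpha> t x) t 0 (- a) (- q \<alpha>)"
      by (simp add: a_def q_def time_deriv_def branch_def)
  qed simp
  obtain \<alpha> where "0 \<le> a + H \<alpha> (min (q \<alpha>) (c \<alpha>))"
    using supersolution[of UNIV t 0 a "\<lambda>\<alpha>. min (q \<alpha>) (c \<alpha>)"] jet t by auto
  moreover have "Hm \<alpha> (q \<alpha>) \<le> (MAX \<alpha>. Hm \<alpha> (q \<alpha>))" by simp
  ultimately have "0 \<le> a + (MAX \<alpha>. Hm \<alpha> (q \<alpha>))"
    unfolding hm_eq[of \<alpha>] by linarith
  then show "0 \<le> junction_operator e Hm \<phi> t"
    unfolding junction_operator_def a_def q_def .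
qed

lemma viscosity_solution_v: "0 < T \<Longrightarrow> viscosity_solution e T H Hm u0 v"
proof -
  assume T: "0 < T"
  have "continuous_on (JT0 e T) v" by (rule continuous_on_subset[OF continuous_v]) auto
  note env = envelopes_of_continuous[OF this]
  have "v (0, y) = u0 y \<and> (0, y) \<in> JT0 e T" if y: "y \<in> junction e" for y
  proof -
    obtain \<alpha> x where "y = x *\<^sub>R e \<alpha>" "0 \<le> x" using y by (auto simp: junction_def)
    then show ?thesis using v_branch[of x 0 \<alpha>] init[of x \<alpha>] y T by simp
  qed
  then show ?thesis
    unfolding viscosity_solution_def using env
    by (auto intro!: viscosity_subsolution_v viscosity_supersolution_v)
qed

lemma bounded_distance_v:
  assumes T: "0 < T"
  shows "bounded_distance_to_initial e T u0 v"
proof -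
  \<comment> \<open>The summand 1 keeps the constant positive when \<open>L = 0\<close>.\<close>
  have "\<bar>v (t, y) - u0 y\<bar> \<le> L * T + 1" if t: "0 < t" "t < T" and "y \<in> junction e" for t y
  proof -
    obtain \<alpha> x where y: "y = x *\<^sub>R e \<alpha>" "0 \<le> x" using \<open>y \<in> junction e\<close> by (auto simp: junction_def)
    have "\<bar>v (t, y) - u0 y\<bar> \<le> L * t"
      using lip[of t 0 x x \<alpha>] init[of x \<alpha>] v_branch[of x t \<alpha>] y t by simp
    also have "\<dots> \<le> L * T" using t L_nonneg by (intro mult_left_mono) auto
    finally show ?thesis by simp
  qed
  moreover have "0 < L * T + 1" using mult_nonneg_nonneg[OF L_nonneg, of T] T by linarith
  ultimately show ?thesis
    unfolding bounded_distance_to_initial_def by (intro exI[of _ "L * T + 1"]) auto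
qed

end

theorem theorem1p8:
  fixes e :: "'n::finite \<Rightarrow> real^2"
    and H Hm Hp :: "'n \<Rightarrow> real \<Rightarrow> real"
    and u0 :: "real^2 \<Rightarrow> real"
    and T :: real
    and u :: "real \<times> (real^2) \<Rightarrow> real"
    and U :: "real \<Rightarrow> real \<Rightarrow> 'n \<Rightarrow> nat \<Rightarrow> nat \<Rightarrow> real"
    and K :: "(real \<times> (real^2)) set"
  assumes "inj e" and "\<And>\<alpha>. norm (e \<alpha>) = 1"
    and "A0 e u0" and "A1' H Hm Hp" and "T > 0"
    and "viscosity_solution e T H Hm u0 u" and "bounded_distance_to_initial e T u0 u"
    and the_unique: "\<And>v. viscosity_solution e T H Hm u0 v \<Longrightarrow> bounded_distance_to_initial e T u0 v
           \<Longrightarrow> (\<forall>z\<in>JT0 e T. v z = u z)"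
    and "\<And>dt dx. dt > 0 \<Longrightarrow> dx > 0 \<Longrightarrow> numerical_solution e Hm Hp u0 dt dx (U dt dx)"
    and "compact K" and "K \<subseteq> JT0 e T"
  shows "Limsup (at (0, 0) within {(dt, dx). dt > 0 \<and> dx > 0 \<and> CFL H Hm Hp dt dx (U dt dx)})
           (\<lambda>(dt, dx). grid_error e K u dt dx (U dt dx)) = 0"
proof -
  have e: "inj e" "\<And>\<alpha>. norm (e \<alpha>) = 1" by fact+
  have num: "numerical_solution e Hm Hp u0 dt dx (U dt dx)" if "0 < dt" "0 < dx" for dt dx
    using that by fact
  have "\<exists>c. split_hamiltonian c (H \<alpha>) (Hm \<alpha>) (Hp \<alpha>)" for \<alpha>
    by (rule A1'_imp_split) fact
  then obtain c where split: "\<And>\<alpha>. split_hamiltonian (c \<alpha>) (H \<alpha>) (Hm \<alpha>) (Hp \<alpha>)" by metis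
  obtain C P where CP: "0 \<le> C" "0 \<le> P"
    and est: "\<And>dt dx U. 0 < dt \<Longrightarrow> 0 < dx \<Longrightarrow> numerical_solution e Hm Hp u0 dt dx U \<Longrightarrow> CFL H Hm Hp dt dx U \<Longrightarrow>
      \<exists>l r. bounded_slope_scheme c H Hm Hp dt dx U l r \<and>
        (\<forall>\<alpha> n i. l \<alpha> \<le> slope_fwd dx U \<alpha> n i \<and> slope_fwd dx U \<alpha> n i \<le> r \<alpha> \<and>
          \<bar>slope_fwd dx U \<alpha> n i\<bar> \<le> P \<and> \<bar>time_slope dt U \<alpha> n i\<bar> \<le> C)"
    by (rule numerical_solution_bounds[OF split \<open>A0 e u0\<close>]) (erule that; assumption)
  define S where "S = {(dt, dx). dt > 0 \<and> dx > 0 \<and> CFL H Hm Hp dt dx (U dt dx)}"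
  define F where "F = at (0, 0) within S"
  define L where "L = C + P"
  have L: "P \<le> L" "C \<le> L" "0 \<le> L" using CP by (simp_all add: L_def)
  have in_S: "\<forall>\<^sub>F \<epsilon> in F. \<epsilon> \<in> S" by (simp add: F_def eventually_at_filter)
  have small: "\<forall>\<^sub>F (dt, dx) in F. 0 < dt \<and> dt < d \<and> 0 < dx \<and> dx < d" if "0 < d" for d
  proof -
    have "\<forall>\<^sub>F \<epsilon> in F. \<epsilon> \<in> S \<and> dist \<epsilon> (0, 0) < d"
      using that unfolding F_def eventually_at by blast
    then show ?thesis
    proof eventually_elim
      case (elim \<epsilon>)
      then show ?case
        using dist_fst_le[of \<epsilon> "(0, 0)"] dist_snd_le[of \<epsilon> "(0, 0)"]
        by (auto simp: S_def dist_real_def)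
    qed
  qed
  have scheme: "\<forall>\<^sub>F (dt, dx) in F. \<exists>l r. bounded_slope_scheme c H Hm Hp dt dx (U dt dx) l r \<and>
      (\<forall>\<alpha> n i. l \<alpha> \<le> slope_fwd dx (U dt dx) \<alpha> n i \<and> slope_fwd dx (U dt dx) \<alpha> n i \<le> r \<alpha>)"
    using in_S
  proof (eventually_elim, clarify)
    fix dt dx assume "(dt, dx) \<in> S"
    then show "\<exists>l r. bounded_slope_scheme c H Hm Hp dt dx (U dt dx) l r \<and>
      (\<forall>\<alpha> n i. l \<alpha> \<le> slope_fwd dx (U dt dx) \<alpha> n i \<and> slope_fwd dx (U dt dx) \<alpha> n i \<le> r \<alpha>)"
      using est[OF _ _ num, of dt dx] unfolding S_def by blast
  qed
  have lip: "\<forall>\<^sub>F (dt, dx) in F. \<forall>\<alpha> m n i j. \<bar>U dt dx \<alpha> m j - U dt dx \<alpha> n i\<bar>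
      \<le> L * (\<bar>real m * dt - real n * dt\<bar> + \<bar>real j * dx - real i * dx\<bar>)"
    using in_S
  proof (eventually_elim, clarify)
    fix dt dx \<alpha> m n i j assume \<epsilon>: "(dt, dx) \<in> S"
    then have "\<bar>slope_fwd dx (U dt dx) \<alpha> n i\<bar> \<le> P" "\<bar>time_slope dt (U dt dx) \<alpha> n i\<bar> \<le> C" for \<alpha> n i
      using est[OF _ _ num, of dt dx] unfolding S_def by blast+
    then show "\<bar>U dt dx \<alpha> m j - U dt dx \<alpha> n i\<bar>
      \<le> L * (\<bar>real m * dt - real n * dt\<bar> + \<bar>real j * dx - real i * dx\<bar>)"
      using \<epsilon> by (intro grid_lipschitz[OF _ _ L(1,2)]) (auto simp: S_def)
  qed
  have init: "\<forall>\<^sub>F (dt, dx) in F. \<forall>\<alpha> i. U dt dx \<alpha> 0 i = u0 ((real i * dx) *\<^sub>R e \<alpha>)"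
    using in_S by eventually_elim (use num in \<open>auto simp: S_def numerical_solution_def\<close>)
  have vertex: "\<forall>\<^sub>F (dt, dx) in F. \<forall>\<alpha> \<beta> n. U dt dx \<alpha> n 0 = U dt dx \<beta> n 0"
    using in_S
  proof (eventually_elim, clarify)
    fix dt dx \<alpha> \<beta> n assume "(dt, dx) \<in> S"
    then show "U dt dx \<alpha> n 0 = U dt dx \<beta> n 0"
      using num[of dt dx] unfolding S_def numerical_solution_def by blast
  qed
  obtain Lip where Lip: "\<And>\<alpha>. Lip-lipschitz_on {0..} (\<lambda>x. u0 (x *\<^sub>R e \<alpha>))"
  proof (rule finite_uniform_bound[of "\<lambda>\<alpha> K. K-lipschitz_on {0..} (\<lambda>x. u0 (x *\<^sub>R e \<alpha>))"])
    show "\<exists>K. K-lipschitz_on {0..} (\<lambda>x. u0 (x *\<^sub>R e \<alpha>))" for \<alpha>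
      using \<open>A0 e u0\<close> by (simp add: A0_def)
  qed (auto intro: lipschitz_on_le)
  obtain R where R: "\<And>z. z \<in> K \<Longrightarrow> norm z \<le> R"
    using compact_imp_bounded[OF \<open>compact K\<close>] by (auto simp: bounded_iff)
  have "\<forall>\<^sub>F (dt, dx) in F. grid_error e K u dt dx (U dt dx) \<le> ennreal \<eta>" if \<eta>: "0 < \<eta>" for \<eta>
  proof (rule ccontr)
    \<comment> \<open>The steps with a large error. The negated claim says that they are frequent
      along \<open>F\<close>, which is precisely nontriviality of the meet; \<open>F\<close> itself
      may be trivial if no small steps satisfy the CFL condition.\<close>
    define E where "E = {(dt, dx). \<not> grid_error e K u dt dx (U dt dx) \<le> ennreal \<eta>}"
    assume "\<not> ?thesis"
    then have bot: "inf F (principal E) \<noteq> bot"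
      by (simp add: trivial_limit_def eventually_inf_principal E_def case_prod_unfold)
    note le = filter_leD[OF inf_le1[of F "principal E"]]
    obtain G w where G_le: "G \<le> inf F (principal E)" and G_bot: "G \<noteq> bot"
      and conv: "\<And>R \<eta>. 0 < \<eta> \<Longrightarrow> \<forall>\<^sub>F (dt, dx) in G. \<forall>\<alpha> n i. real n * dt \<le> R \<longrightarrow> real i * dx \<le> R \<longrightarrow>
        \<bar>U dt dx \<alpha> n i - w \<alpha> (real n * dt) (real i * dx)\<bar> \<le> \<eta>"
      and w: "\<And>\<alpha> t s x y. 0 \<le> t \<Longrightarrow> 0 \<le> s \<Longrightarrow> 0 \<le> x \<Longrightarrow> 0 \<le> y \<Longrightarrow>
        \<bar>w \<alpha> t x - w \<alpha> s y\<bar> \<le> L * (\<bar>t - s\<bar> + \<bar>x - y\<bar>)"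
        "\<And>\<alpha> x. 0 \<le> x \<Longrightarrow> w \<alpha> 0 x = u0 (x *\<^sub>R e \<alpha>)" "\<And>\<alpha> \<beta> t. w \<alpha> t 0 = w \<beta> t 0"
      by (rule scheme_compactness[OF bot le[OF small] le[OF lip] le[OF init] Lip le[OF vertex]]) blast+
    have GF: "G \<le> F" using G_le by simp
    interpret junction_limit G c H Hm Hp U w L e u0 T
      by (rule junction_limit.intro[OF
            scheme_limit.intro[OF G_bot filter_leD[OF GF small] conv w(1) split filter_leD[OF GF scheme] w(3)]
            junction_limit_axioms.intro[where e = e and w = w and ?u0.0 = u0, OF e L(3) w(2)]])
    have v: "v z = u z" if "z \<in> K" for z
      using the_unique[OF viscosity_solution_v bounded_distance_v] \<open>T > 0\<close> \<open>K \<subseteq> JT0 e T\<close> that by blast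
    have "\<forall>\<^sub>F \<epsilon> in G. \<epsilon> \<in> E"
      using G_le by (simp add: le_principal)
    moreover have "\<forall>\<^sub>F \<epsilon> in G. \<epsilon> \<notin> E"
      using conv[OF \<eta>, of R] filter_leD[OF GF in_S]
    proof (eventually_elim, clarify)
      fix dt dx
      assume conv: "\<forall>\<alpha> n i. real n * dt \<le> R \<longrightarrow> real i * dx \<le> R \<longrightarrow>
        \<bar>U dt dx \<alpha> n i - w \<alpha> (real n * dt) (real i * dx)\<bar> \<le> \<eta>"
        and "(dt, dx) \<in> S" "(dt, dx) \<in> E"
      then have pos: "0 < dt" "0 < dx" by (auto simp: S_def)
      have "\<bar>branch e u \<alpha> (real n * dt) (real i * dx) - U dt dx \<alpha> n i\<bar> \<le> \<eta>"
        if K: "(real n * dt, (real i * dx) *\<^sub>R e \<alpha>) \<in> K" for \<alpha> n i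
      proof -
        \<comment> \<open>The norm of a pair dominates both components and the directions are unit
          vectors, so the single bound \<open>R\<close> on \<open>K\<close> limits both grid
          coordinates.\<close>
        have "norm (real n * dt) \<le> R" "norm ((real i * dx) *\<^sub>R e \<alpha>) \<le> R"
          using order_trans[OF norm_fst_le R[OF K]] order_trans[OF norm_snd_le R[OF K]] .
        moreover have "norm ((real i * dx) *\<^sub>R e \<alpha>) = real i * dx" using pos e(2) by simp
        moreover have "norm (real n * dt) = real n * dt" using pos by simp
        ultimately have "real n * dt \<le> R" "real i * dx \<le> R" by linarith+
        then have "\<bar>U dt dx \<alpha> n i - w \<alpha> (real n * dt) (real i * dx)\<bar> \<le> \<eta>" using conv by blast
        then show ?thesis
          using v[OF K] v_branch[of "real i * dx" "real n * dt" \<alpha>] pos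
          by (simp add: branch_def abs_minus_commute)
      qed
      then have "grid_error e K u dt dx (U dt dx) \<le> ennreal \<eta>"
        unfolding grid_error_def by (intro SUP_least) (auto intro: ennreal_leI)
      then show False using \<open>(dt, dx) \<in> E\<close> by (simp add: E_def)
    qed
    ultimately have "\<forall>\<^sub>F \<epsilon> in G. False" by eventually_elim simp
    then show False using G_bot by (simp add: trivial_limit_def)
  qed
  then have le: "Limsup F (\<lambda>(dt, dx). grid_error e K u dt dx (U dt dx)) \<le> ennreal \<eta>" if "0 < \<eta>" for \<eta>
    using that by (intro Limsup_bounded) (simp add: case_prod_unfold)
  have "Limsup F (\<lambda>(dt, dx). grid_error e K u dt dx (U dt dx)) \<le> 0"
  proof (rule ennreal_le_epsilon)
    fix \<eta> :: real assume "0 < \<eta>"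
    then show "Limsup F (\<lambda>(dt, dx). grid_error e K u dt dx (U dt dx)) \<le> 0 + ennreal \<eta>"
      unfolding add_0_left by (rule le)
  qed
  then show ?thesis unfolding F_def S_def by (rule le_zero_eq[THEN iffD1])
qed

end
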